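(* Let $G$ be a group that is a central extension $Z\hookrightarrow G\twoheadrightarrow F$ (a short exact sequence with the image of $Z$ central in $G$), where $Z$ is an infinite cyclic group and $F$ is a hyperbolic group. Then $G$ is a hierarchically hyperbolic group.
   Context: *Hierarchically hyperbolic space (HHS).* Let $\mathcal X$ be a (quasi)geodesic metric space and $E\ge 1$. An $E$-HHS structure on $\mathcal X$ is an index set $\mathfrak S$ together with $E$-hyperbolic geodesic spaces $\mathcal C(V)$, $V\in\mathfrak S$, and the following data. Write $d_V(x,y)$ for $d_{\mathcal C(V)}(\varphi_V(x),\varphi_V(y))$, and similarly with a subset of $\mathcal C(V)$ in place of $\varphi_V(x)$ or $\varphi_V(y)$. (1) Projections: maps $\varphi_V:\mathcal X\to 2^{\mathcal C(V)}$ sending points to nonempty sets of diameter $\le E$, each $(E,E)$-coarsely Lipschitz and $E$-coarsely surjective. (2) Nesting: a partial order $\sqsubseteq$ on $\mathfrak S$ with a unique maximal element (if $\mathfrak S\ne\emptyset$). For $V\sqsubsetneq W$ there is a subset $\rho^V_W\subseteq\mathcal C(W)$ of diameter $\le E$ and a map $\rho^W_V:\mathcal C(W)\to 2^{\mathcal C(V)}$. Let $\mathfrak S_W=\{V:V\sqsubseteq W\}$. (3) Orthogonality: a symmetric anti-reflexive relation $\perp$; if $V\sqsubseteq W$ and $W\perp U$ then $V\perp U$; if $V\perp W$ then $V,W$ are not $\sqsubseteq$-comparable; for each $T\in\mathfrak S$ and $U\in\mathfrak S_T$ with $\{V\in\mathfrak S_T:V\perp U\}\neq\emptyset$ there is $W\in\mathfrak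 S_T-\{T\}$ such that $V\sqsubseteq W$ whenever $V\sqsubseteq T$ and $V\perp U$. (4) Transversality and consistency: distinct $V,W$ that are neither orthogonal nor $\sqsubseteq$-comparable are called transverse, $V\pitchfork W$; then there are sets $\rho^V_W\subseteq\mathcal C(W)$, $\rho^W_V\subseteq\mathcal C(V)$ of diameter $\le E$ with $\min\{d_W(x,\rho^V_W),d_V(x,\rho^W_V)\}\le E$ for all $x\in\mathcal X$. If $V\sqsubsetneq W$ then $\min\{d_W(x,\rho^V_W),\operatorname{diam}(\varphi_V(x)\cup\rho^W_V(\varphi_W(x)))\}\le E$ for all $x$. If $U\sqsubseteq V$ then $d_W(\rho^U_W,\rho^V_W)\le E$ whenever $V\sqsubsetneq W$, or $V\pitchfork W$ and $W\not\perp U$. (5) Finite complexity: sets of pairwise $\sqsubseteq$-comparable elements have cardinality $\le E$. (6) Large links: for all $W\in\mathfrak S$, $x,x'\in\mathcal X$, with $N=E\,d_W(x,x')+E$, there are $T_1,\dots,T_{\lfloor N\rfloor}\in\mathfrak S_W-\{W\}$ such that for all $T\in\mathfrak S_W-\{W\}$ either $T\sqsubseteq T_i$ for some $i$ or $d_T(x,x')<E$; and $d_W(x,\rho^{T_i}_W)\le N$ for each $i$. (7) Bounded geodesic image: for $V\sqsubsetneq W$ and every geodesic $\gamma$ of $\mathcal C(W)$, either $\operatorname{diam}(\rho^W_V(\gamma))\le E$ or $\gamma$ meets the $E$-neighbourhood of $\rho^V_W$. (8) Partial realisation: for pairwise orthogonal $\{V_j\}$ and $p_j\in\varphi_{V_j}(\mathcal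 X)$ there is $x\in\mathcal X$ with $d_{V_j}(x,p_j)\le E$ for all $j$, and $d_W(x,\rho^{V_j}_W)\le E$ whenever $V_j\sqsubsetneq W$ or $V_j\pitchfork W$. (9) Uniqueness: for each $\kappa\ge0$ there is $\theta(\kappa)$ such that $d_{\mathcal X}(x,y)\ge\theta(\kappa)$ implies $d_V(x,y)\ge\kappa$ for some $V\in\mathfrak S$. *Hierarchically hyperbolic group (HHG).* A finitely generated group $G$ is an HHG if for some $E$ it acts by isometries on a space $\mathcal X$ with an $E$-HHS structure $\mathfrak S$ such that: (i) the action on $\mathcal X$ is metrically proper (for bounded $K$, $\{g: gK\cap K\ne\emptyset\}$ is finite) and cobounded; (ii) $G$ acts on $\mathfrak S$ by bijections preserving $\sqsubseteq,\perp,\pitchfork$; (iii) $\mathfrak S$ has finitely many $G$-orbits; (iv) for each $V\in\mathfrak S$, $g\in G$ there is an isometry $g_V:\mathcal C(V)\to\mathcal C(gV)$ with $(gh)_V=g_{hV}\circ h_V$, $g_V(\varphi_V(x))=\varphi_{gV}(gx)$ for $x\in\mathcal X$, and $g_U(\rho^V_U)=\rho^{gV}_{gU}$ whenever $V\pitchfork U$ or $V\sqsubsetneq U$. The structure $\mathfrak S$ is then called an HHG structure for $G$. *)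

theory Defs
  imports "HOL-Analysis.Analysis" "HOL-Algebra.Group_Action" "HOL-Algebra.Elementary_Groups"
begin

section \<open>Metric notions\<close>

text \<open>The diameter is extended-real-valued (and \<open>0\<close> on the empty set), so that a bound on it
  is meaningful for unbounded sets.\<close>

definition mdiam :: "'a metric \<Rightarrow> 'a set \<Rightarrow> ennreal" where
  "mdiam m A = (SUP x\<in>A. SUP y\<in>A. ennreal (mdist m x y))"

text \<open>Infimal distance of two sets; used below for nonempty sets only, as the infimum of the
  empty set of reals is unspecified.\<close>

definition set_mdist :: "'a metric \<Rightarrow> 'a set \<Rightarrow> 'a set \<Rightarrow> real" where
  "set_mdist m A B = (INF p\<in>A \<times> B. mdist m (fst p) (snd p))"

definition mneighbourhood :: "'a metric \<Rightarrow> real \<Rightarrow> 'a set \<Rightarrow> 'a set" where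
  "mneighbourhood m r A = {p \<in> mspace m. \<exists>a\<in>A. mdist m p a \<le> r}"

abbreviation mbounded_of :: "'a metric \<Rightarrow> 'a set \<Rightarrow> bool" where
  "mbounded_of m \<equiv> Metric_space.mbounded (mspace m) (mdist m)"

definition isometry :: "'a metric \<Rightarrow> 'b metric \<Rightarrow> ('a \<Rightarrow> 'b) \<Rightarrow> bool" where
  "isometry m m' f \<longleftrightarrow> bij_betw f (mspace m) (mspace m') \<and>
     (\<forall>x\<in>mspace m. \<forall>y\<in>mspace m. mdist m' (f x) (f y) = mdist m x y)"

definition geodesic_path :: "'a metric \<Rightarrow> real \<Rightarrow> (real \<Rightarrow> 'a) \<Rightarrow> bool" where
  "geodesic_path m L \<gamma> \<longleftrightarrow> 0 \<le> L \<and> \<gamma> ` {0..L} \<subseteq> mspace m \<and>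
     (\<forall>s\<in>{0..L}. \<forall>t\<in>{0..L}. mdist m (\<gamma> s) (\<gamma> t) = \<bar>s - t\<bar>)"

definition geodesic_metric :: "'a metric \<Rightarrow> bool" where
  "geodesic_metric m \<longleftrightarrow>
     (\<forall>x\<in>mspace m. \<forall>y\<in>mspace m. \<exists>L \<gamma>. geodesic_path m L \<gamma> \<and> \<gamma> 0 = x \<and> \<gamma> L = y)"

definition quasigeodesic_path :: "'a metric \<Rightarrow> real \<Rightarrow> real \<Rightarrow> (real \<Rightarrow> 'a) \<Rightarrow> bool" where
  "quasigeodesic_path m K L \<gamma> \<longleftrightarrow> 0 \<le> L \<and> \<gamma> ` {0..L} \<subseteq> mspace m \<and>
     (\<forall>s\<in>{0..L}. \<forall>t\<in>{0..L}. \<bar>s - t\<bar> / K - K \<le> mdist m (\<gamma> s) (\<gamma> t) \<and>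
                              mdist m (\<gamma> s) (\<gamma> t) \<le> K * \<bar>s - t\<bar> + K)"

definition quasigeodesic_metric :: "'a metric \<Rightarrow> bool" where
  "quasigeodesic_metric m \<longleftrightarrow> (\<exists>K\<ge>1. \<forall>x\<in>mspace m. \<forall>y\<in>mspace m.
     \<exists>L \<gamma>. quasigeodesic_path m K L \<gamma> \<and> \<gamma> 0 = x \<and> \<gamma> L = y)"

text \<open>Gromov's definition of hyperbolicity, which applies to arbitrary metric spaces, in particular
  both to geodesic spaces and to groups with a word metric.\<close>

definition gromov_product :: "('a \<Rightarrow> 'a \<Rightarrow> real) \<Rightarrow> 'a \<Rightarrow> 'a \<Rightarrow> 'a \<Rightarrow> real" where
  "gromov_product d w x y = (d w x + d w y - d x y) / 2"

definition hyperbolic_on :: "real \<Rightarrow> 'a set \<Rightarrow> ('a \<Rightarrow> 'a \<Rightarrow> real) \<Rightarrow> bool" where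
  "hyperbolic_on \<delta> M d \<longleftrightarrow> (\<forall>w\<in>M. \<forall>x\<in>M. \<forall>y\<in>M. \<forall>z\<in>M.
     gromov_product d w x z \<ge> min (gromov_product d w x y) (gromov_product d w y z) - \<delta>)"


section \<open>Finitely generated and hyperbolic groups, central extensions\<close>

definition finite_generating_set :: "('g, 'm) monoid_scheme \<Rightarrow> 'g set \<Rightarrow> bool" where
  "finite_generating_set G S \<longleftrightarrow> finite S \<and> S \<subseteq> carrier G \<and> generate G S = carrier G"

definition finitely_generated_group :: "('g, 'm) monoid_scheme \<Rightarrow> bool" where
  "finitely_generated_group G \<longleftrightarrow> group G \<and> (\<exists>S. finite_generating_set G S)"

definition word_length :: "('g, 'm) monoid_scheme \<Rightarrow> 'g set \<Rightarrow> 'g \<Rightarrow> nat" where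
  "word_length G S g = (LEAST n. \<exists>ws. length ws = n \<and> set ws \<subseteq> S \<union> m_inv G ` S \<and>
                                      foldr (\<otimes>\<^bsub>G\<^esub>) ws \<one>\<^bsub>G\<^esub> = g)"

definition word_dist :: "('g, 'm) monoid_scheme \<Rightarrow> 'g set \<Rightarrow> 'g \<Rightarrow> 'g \<Rightarrow> real" where
  "word_dist G S g h = real (word_length G S (inv\<^bsub>G\<^esub> g \<otimes>\<^bsub>G\<^esub> h))"

definition hyperbolic_group :: "('g, 'm) monoid_scheme \<Rightarrow> bool" where
  "hyperbolic_group G \<longleftrightarrow> group G \<and>
     (\<exists>S \<delta>. finite_generating_set G S \<and> hyperbolic_on \<delta> (carrier G) (word_dist G S))"

definition infinite_cyclic_group :: "('g, 'm) monoid_scheme \<Rightarrow> bool" where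
  "infinite_cyclic_group Z \<longleftrightarrow> group Z \<and> cyclic_group Z \<and> infinite (carrier Z)"

text \<open>The library's \<open>exact_seq\<close> is not used since it forces the three groups to have the same
  element type.\<close>

definition central_extension ::
  "('z, 'k) monoid_scheme \<Rightarrow> ('z \<Rightarrow> 'g) \<Rightarrow> ('g, 'm) monoid_scheme \<Rightarrow> ('g \<Rightarrow> 'f) \<Rightarrow>
   ('f, 'n) monoid_scheme \<Rightarrow> bool" where
  "central_extension Z \<iota> G \<pi> F \<longleftrightarrow> group Z \<and> group G \<and> group F \<and>
     \<iota> \<in> mon Z G \<and> \<pi> \<in> epi G F \<and> \<iota> ` carrier Z = kernel G F \<pi> \<and>
     (\<forall>z\<in>carrier Z. \<forall>g\<in>carrier G. \<iota> z \<otimes>\<^bsub>G\<^esub> g = g \<otimes>\<^bsub>G\<^esub> \<iota> z)"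


section \<open>Hierarchically hyperbolic spaces\<close>

locale hhs_index =
  fixes \<SS> :: "'s set"
    and nest :: "'s \<Rightarrow> 's \<Rightarrow> bool"
    and orth :: "'s \<Rightarrow> 's \<Rightarrow> bool"
  assumes nest_partial_order:
      "partial_order_on \<SS> {(V, W). V \<in> \<SS> \<and> W \<in> \<SS> \<and> nest V W}"
    and nest_unique_maximal:
      "\<SS> \<noteq> {} \<Longrightarrow> \<exists>!T. T \<in> \<SS> \<and> (\<forall>V\<in>\<SS>. nest T V \<longrightarrow> V = T)"
    and orth_sym: "\<lbrakk>V \<in> \<SS>; W \<in> \<SS>; orth V W\<rbrakk> \<Longrightarrow> orth W V"
    and orth_irrefl: "V \<in> \<SS> \<Longrightarrow> \<not> orth V V"
    and orth_nest:
      "\<lbrakk>V \<in> \<SS>; W \<in> \<SS>; U \<in> \<SS>; nest V W; orth W U\<rbrakk> \<Longrightarrow> orth V U"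
    and orth_not_nest: "\<lbrakk>V \<in> \<SS>; W \<in> \<SS>; orth V W\<rbrakk> \<Longrightarrow> \<not> nest V W \<and> \<not> nest W V"
    and orth_container:
      "\<lbrakk>T \<in> \<SS>; U \<in> \<SS>; nest U T; {V \<in> \<SS>. nest V T \<and> orth V U} \<noteq> {}\<rbrakk> \<Longrightarrow>
         \<exists>W\<in>\<SS>. nest W T \<and> W \<noteq> T \<and> (\<forall>V\<in>\<SS>. nest V T \<and> orth V U \<longrightarrow> nest V W)"
begin

definition pnest :: "'s \<Rightarrow> 's \<Rightarrow> bool" where
  "pnest V W \<longleftrightarrow> V \<in> \<SS> \<and> W \<in> \<SS> \<and> nest V W \<and> V \<noteq> W"

definition transv :: "'s \<Rightarrow> 's \<Rightarrow> bool" where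
  "transv V W \<longleftrightarrow> V \<in> \<SS> \<and> W \<in> \<SS> \<and> V \<noteq> W \<and> \<not> orth V W \<and> \<not> nest V W \<and> \<not> nest W V"

end

text \<open>\<open>\<rho> V W\<close> is the subset \<open>\<rho>\<^sup>V\<^sub>W\<close> of \<open>C W\<close>, for \<open>V\<close> properly nested in or transverse to \<open>W\<close>;
  \<open>\<rho>d W V\<close> is the map \<open>\<rho>\<^sup>W\<^sub>V\<close> from \<open>C W\<close> to subsets of \<open>C V\<close>, for \<open>V\<close> properly nested in \<open>W\<close>.
  The values of both are required to be nonempty: otherwise the distances to \<open>\<rho> V W\<close> would be
  meaningless, and the conditions on \<open>\<rho>d\<close> could be satisfied by the constant empty map.

  In the large links axiom the number of the \<open>T\<^sub>i\<close> is bounded by the floor of \<open>N\<close>. They cannot be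
  required to be exactly that many, as there is none at all for a minimal \<open>W\<close>, whereas \<open>N \<ge> 1\<close>.\<close>

locale hhs = hhs_index \<SS> nest orth
  for \<SS> :: "'s set" and nest :: "'s \<Rightarrow> 's \<Rightarrow> bool" and orth :: "'s \<Rightarrow> 's \<Rightarrow> bool" +
  fixes E :: real
    and X :: "'x metric"
    and C :: "'s \<Rightarrow> 'c metric"
    and \<phi> :: "'s \<Rightarrow> 'x \<Rightarrow> 'c set"
    and \<rho> :: "'s \<Rightarrow> 's \<Rightarrow> 'c set"
    and \<rho>d :: "'s \<Rightarrow> 's \<Rightarrow> 'c \<Rightarrow> 'c set"
  assumes E_ge_1: "E \<ge> 1"
    and X_nonempty: "mspace X \<noteq> {}"
    and X_quasigeodesic: "quasigeodesic_metric X"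
    and C_geodesic: "V \<in> \<SS> \<Longrightarrow> geodesic_metric (C V)"
    and C_hyperbolic: "V \<in> \<SS> \<Longrightarrow> hyperbolic_on E (mspace (C V)) (mdist (C V))"
    and proj_sets:
      "\<lbrakk>V \<in> \<SS>; x \<in> mspace X\<rbrakk> \<Longrightarrow>
         \<phi> V x \<subseteq> mspace (C V) \<and> \<phi> V x \<noteq> {} \<and> mdiam (C V) (\<phi> V x) \<le> ennreal E"
    and proj_coarsely_Lipschitz:
      "\<lbrakk>V \<in> \<SS>; x \<in> mspace X; y \<in> mspace X\<rbrakk> \<Longrightarrow>
         set_mdist (C V) (\<phi> V x) (\<phi> V y) \<le> E * mdist X x y + E"
    and proj_coarsely_surjective:
      "V \<in> \<SS> \<Longrightarrow> mspace (C V) \<subseteq> mneighbourhood (C V) E (\<Union>x\<in>mspace X. \<phi> V x)"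
    and rho_sets:
      "pnest V W \<or> transv V W \<Longrightarrow>
         \<rho> V W \<subseteq> mspace (C W) \<and> \<rho> V W \<noteq> {} \<and> mdiam (C W) (\<rho> V W) \<le> ennreal E"
    and rho_map:
      "\<lbrakk>pnest V W; p \<in> mspace (C W)\<rbrakk> \<Longrightarrow> \<rho>d W V p \<subseteq> mspace (C V) \<and> \<rho>d W V p \<noteq> {}"
    and consistency_transv:
      "\<lbrakk>transv V W; x \<in> mspace X\<rbrakk> \<Longrightarrow>
         min (set_mdist (C W) (\<phi> W x) (\<rho> V W)) (set_mdist (C V) (\<phi> V x) (\<rho> W V)) \<le> E"
    and consistency_nest:
      "\<lbrakk>pnest V W; x \<in> mspace X\<rbrakk> \<Longrightarrow>
         min (ennreal (set_mdist (C W) (\<phi> W x) (\<rho> V W)))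
             (mdiam (C V) (\<phi> V x \<union> (\<Union>p\<in>\<phi> W x. \<rho>d W V p))) \<le> ennreal E"
    and consistency_rho:
      "\<lbrakk>U \<in> \<SS>; V \<in> \<SS>; W \<in> \<SS>; nest U V; pnest V W \<or> (transv V W \<and> \<not> orth W U)\<rbrakk> \<Longrightarrow>
         set_mdist (C W) (\<rho> U W) (\<rho> V W) \<le> E"
    and finite_complexity:
      "\<lbrakk>A \<subseteq> \<SS>; \<forall>V\<in>A. \<forall>W\<in>A. nest V W \<or> nest W V\<rbrakk> \<Longrightarrow> finite A \<and> real (card A) \<le> E"
    and large_links:
      "\<lbrakk>W \<in> \<SS>; x \<in> mspace X; x' \<in> mspace X; N = E * set_mdist (C W) (\<phi> W x) (\<phi> W x') + E\<rbrakk> \<Longrightarrow>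
         \<exists>\<T>. finite \<T> \<and> int (card \<T>) \<le> \<lfloor>N\<rfloor> \<and> (\<forall>T\<in>\<T>. pnest T W) \<and>
             (\<forall>T. pnest T W \<longrightarrow>
                (\<exists>T'\<in>\<T>. nest T T') \<or> set_mdist (C T) (\<phi> T x) (\<phi> T x') < E) \<and>
             (\<forall>T\<in>\<T>. set_mdist (C W) (\<phi> W x) (\<rho> T W) \<le> N)"
    and bounded_geodesic_image:
      "\<lbrakk>pnest V W; geodesic_path (C W) L \<gamma>\<rbrakk> \<Longrightarrow>
         mdiam (C V) (\<Union>p\<in>\<gamma> ` {0..L}. \<rho>d W V p) \<le> ennreal E \<or>
         \<gamma> ` {0..L} \<inter> mneighbourhood (C W) E (\<rho> V W) \<noteq> {}"
    and partial_realisation: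
      "\<lbrakk>\<V> \<subseteq> \<SS>; \<forall>V\<in>\<V>. \<forall>W\<in>\<V>. V \<noteq> W \<longrightarrow> orth V W;
        \<forall>V\<in>\<V>. q V \<in> (\<Union>x\<in>mspace X. \<phi> V x)\<rbrakk> \<Longrightarrow>
         \<exists>x\<in>mspace X. \<forall>V\<in>\<V>. set_mdist (C V) (\<phi> V x) {q V} \<le> E \<and>
            (\<forall>W. pnest V W \<or> transv V W \<longrightarrow> set_mdist (C W) (\<phi> W x) (\<rho> V W) \<le> E)"
    and uniqueness:
      "\<kappa> \<ge> 0 \<Longrightarrow> \<exists>\<theta>. \<forall>x\<in>mspace X. \<forall>y\<in>mspace X.
         mdist X x y \<ge> \<theta> \<longrightarrow> (\<exists>V\<in>\<SS>. set_mdist (C V) (\<phi> V x) (\<phi> V y) \<ge> \<kappa>)"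


section \<open>Hierarchically hyperbolic groups\<close>

text \<open>\<open>act\<close> and \<open>iact\<close> are the actions on \<open>X\<close> and on \<open>\<SS>\<close>; \<open>\<theta> g V\<close> is the isometry \<open>g\<^sub>V\<close>.\<close>

locale hhg_structure = hhs \<SS> nest orth E X C \<phi> \<rho> \<rho>d +
    X_action: group_action G "mspace X" act + index_action: group_action G \<SS> iact
  for G :: "('g, 'm) monoid_scheme"
    and \<SS> :: "'s set" and nest :: "'s \<Rightarrow> 's \<Rightarrow> bool" and orth :: "'s \<Rightarrow> 's \<Rightarrow> bool"
    and E :: real and X :: "'x metric" and C :: "'s \<Rightarrow> 'c metric"
    and \<phi> :: "'s \<Rightarrow> 'x \<Rightarrow> 'c set" and \<rho> :: "'s \<Rightarrow> 's \<Rightarrow> 'c set"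
    and \<rho>d :: "'s \<Rightarrow> 's \<Rightarrow> 'c \<Rightarrow> 'c set"
    and act :: "'g \<Rightarrow> 'x \<Rightarrow> 'x" and iact :: "'g \<Rightarrow> 's \<Rightarrow> 's" +
  fixes \<theta> :: "'g \<Rightarrow> 's \<Rightarrow> 'c \<Rightarrow> 'c"
  assumes act_isometry: "g \<in> carrier G \<Longrightarrow> isometry X X (act g)"
    and metrically_proper:
      "mbounded_of X K \<Longrightarrow> finite {g \<in> carrier G. act g ` K \<inter> K \<noteq> {}}"
    and cobounded: "\<exists>B. mbounded_of X B \<and> (\<Union>g\<in>carrier G. act g ` B) = mspace X"
    and iact_nest:
      "\<lbrakk>g \<in> carrier G; V \<in> \<SS>; W \<in> \<SS>\<rbrakk> \<Longrightarrow> nest (iact g V) (iact g W) \<longleftrightarrow> nest V W"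
    and iact_orth:
      "\<lbrakk>g \<in> carrier G; V \<in> \<SS>; W \<in> \<SS>\<rbrakk> \<Longrightarrow> orth (iact g V) (iact g W) \<longleftrightarrow> orth V W"
    and iact_transv:
      "\<lbrakk>g \<in> carrier G; V \<in> \<SS>; W \<in> \<SS>\<rbrakk> \<Longrightarrow> transv (iact g V) (iact g W) \<longleftrightarrow> transv V W"
    and finitely_many_orbits: "finite (orbits G \<SS> iact)"
    and theta_isometry:
      "\<lbrakk>g \<in> carrier G; V \<in> \<SS>\<rbrakk> \<Longrightarrow> isometry (C V) (C (iact g V)) (\<theta> g V)"
    and theta_mult:
      "\<lbrakk>g \<in> carrier G; h \<in> carrier G; V \<in> \<SS>; p \<in> mspace (C V)\<rbrakk> \<Longrightarrow>
         \<theta> (g \<otimes>\<^bsub>G\<^esub> h) V p = \<theta> g (iact h V) (\<theta> h V p)"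
    and theta_proj:
      "\<lbrakk>g \<in> carrier G; V \<in> \<SS>; x \<in> mspace X\<rbrakk> \<Longrightarrow> \<theta> g V ` \<phi> V x = \<phi> (iact g V) (act g x)"
    and theta_rho:
      "\<lbrakk>g \<in> carrier G; transv V U \<or> pnest V U\<rbrakk> \<Longrightarrow>
         \<theta> g U ` \<rho> V U = \<rho> (iact g V) (iact g U)"

text \<open>The existential quantifier cannot range over types, so the types of the structure are fixed.
  A finitely generated group is countable, and \<open>\<SS>\<close> has finitely many orbits; so \<open>\<SS>\<close> is countable
  and may be taken to consist of natural numbers. The points of \<open>X\<close> and of the \<open>C V\<close> are taken from
  the type of real-valued functions on the elements of \<open>G\<close>, which contains (a copy of) each set of
  at most continuum cardinality; for instance, the functions of finite support are the barycentric
  coordinates of simplicial complexes with vertex set \<open>G\<close>.\<close>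

definition hierarchically_hyperbolic_group :: "('g, 'm) monoid_scheme \<Rightarrow> bool" where
  "hierarchically_hyperbolic_group G \<longleftrightarrow> finitely_generated_group G \<and>
     (\<exists>(\<SS> :: nat set) nest orth E (X :: ('g \<Rightarrow> real) metric) (C :: nat \<Rightarrow> ('g \<Rightarrow> real) metric)
        \<phi> \<rho> \<rho>d act iact \<theta>. hhg_structure G \<SS> nest orth E X C \<phi> \<rho> \<rho>d act iact \<theta>)"

end

theory Submission
  imports Defs "HOL-Algebra.Multiplicative_Group"
begin

text \<open>Write elements of \<open>G\<close> as lifts of words over generators of \<open>F\<close> times powers of the central
  generator \<open>z\<close>. The linear isoperimetric inequality of \<open>F\<close> says that a word of length \<open>n\<close> that is
  trivial in \<open>F\<close> lifts to a power of \<open>z\<close> with exponent \<open>O(n)\<close>. Hence, for a large weight \<open>c\<close>, the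
  minimum \<open>q g\<close> of \<open>c * n + k\<close> over all ways to write \<open>g\<close> as a lifted word of length \<open>n\<close> times \<open>z\<^sup>k\<close>
  exists, and minimising words are quasigeodesics in \<open>F\<close>. As these pass near the centres of
  geodesic triangles, \<open>Q g = q g - q (inv g)\<close> is a quasimorphism, and it satisfies
  \<open>Q (g z\<^sup>k) = Q g + 2 k\<close>. So \<open>G\<close> acts properly and coboundedly on the product of \<open>F\<close> with a quasiline on
  which \<open>z\<close> translates by \<open>2\<close>; this product gives two orthogonal domains below a bounded one. Geodesic
  hyperbolic models of the two factors are provided by injective hulls, on which \<open>G\<close> acts
  canonically.\<close>

section \<open>Word metrics\<close>

text \<open>\<open>G\<close> need not be virtually a direct product, so in general no homomorphism
  to the integers is nontrivial on \<open>z\<close>. A quasimorphism unbounded on the powers of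
  \<open>z\<close> is the substitute; its existence expresses that the class of the extension is
  bounded over the reals. The cost \<open>q\<close> alone will not do: it is subadditive, but
  \<open>q g + q (inv g)\<close> grows linearly with the length of \<open>\<pi> g\<close>.
  Antisymmetrising removes this symmetric part and keeps the dependence on \<open>z\<close>.

  The factors must be geodesic spaces with genuine isometries, whereas the two coordinates of
  \<open>G\<close> are only left-invariant pseudometrics: one vanishes on cosets of the powers of
  \<open>z\<close>, the other is a line up to bounded error. The injective hull turns either into a
  geodesic space with the same four-point constant; its points are real functions on
  \<open>G\<close>, as the target type demands, and left translation of functions acts on it. The
  hull is larger than the orbit, so coarse surjectivity needs an argument: hyperbolicity keeps every
  hull point close to the orbit.\<close>

locale discrete_geodesic =
  fixes M :: "'a set" and d :: "'a \<Rightarrow> 'a \<Rightarrow> nat"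
  assumes d_self: "x \<in> M \<Longrightarrow> d x x = 0"
    and d_commute: "\<lbrakk>x \<in> M; y \<in> M\<rbrakk> \<Longrightarrow> d x y = d y x"
    and d_triangle: "\<lbrakk>x \<in> M; y \<in> M; z \<in> M\<rbrakk> \<Longrightarrow> d x z \<le> d x y + d y z"
    and d_between: "\<lbrakk>x \<in> M; y \<in> M; r \<le> d x y\<rbrakk> \<Longrightarrow> \<exists>p\<in>M. d x p = r \<and> d p y = d x y - r"

locale word_metric = group G for G (structure) +
  fixes S :: "'a set"
  assumes gens: "finite_generating_set G S"
begin

definition letters :: "'a set" where "letters = S \<union> m_inv G ` S"

definition ev :: "'a list \<Rightarrow> 'a" where "ev ws = foldr (\<otimes>) ws \<one>"

abbreviation wl :: "'a \<Rightarrow> nat" where "wl \<equiv> word_length G S"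

definition wd :: "'a \<Rightarrow> 'a \<Rightarrow> nat" where "wd x y = wl (inv x \<otimes> y)"

lemma letters_closed: "letters \<subseteq> carrier G"
  and finite_letters: "finite letters"
  and inv_letters: "a \<in> letters \<Longrightarrow> inv a \<in> letters"
  using gens by (auto simp: letters_def finite_generating_set_def)

lemma ev_Nil [simp]: "ev [] = \<one>"
  and ev_Cons [simp]: "ev (a # ws) = a \<otimes> ev ws"
  by (simp_all add: ev_def)

lemma ev_closed: "set ws \<subseteq> letters \<Longrightarrow> ev ws \<in> carrier G"
  using letters_closed by (induction ws) auto

lemma ev_append: "\<lbrakk>set u \<subseteq> letters; set v \<subseteq> letters\<rbrakk> \<Longrightarrow> ev (u @ v) = ev u \<otimes> ev v"
proof (induction u)
  case Nil
  then show ?case by (simp add: ev_closed)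
next
  case (Cons a u)
  then have "a \<in> carrier G" using letters_closed by auto
  with Cons show ?case by (simp add: ev_closed m_assoc)
qed

definition inv_word :: "'a list \<Rightarrow> 'a list" where "inv_word ws = map (m_inv G) (rev ws)"

lemma set_inv_word: "set ws \<subseteq> letters \<Longrightarrow> set (inv_word ws) \<subseteq> letters"
  and length_inv_word [simp]: "length (inv_word ws) = length ws"
  using inv_letters by (auto simp: inv_word_def)

lemma ev_inv_word: "set ws \<subseteq> letters \<Longrightarrow> ev (inv_word ws) = inv (ev ws)"
proof (induction ws)
  case Nil
  then show ?case by (simp add: inv_word_def)
next
  case (Cons a ws)
  then have a: "a \<in> carrier G" "inv a \<in> letters" "set ws \<subseteq> letters"
    using letters_closed inv_letters by auto
  have "ev (inv_word (a # ws)) = ev (inv_word ws @ [inv a])"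
    by (simp add: inv_word_def)
  also have "\<dots> = ev (inv_word ws) \<otimes> ev [inv a]"
    using a by (intro ev_append) (auto simp: set_inv_word)
  also have "\<dots> = inv (ev (a # ws))"
    using a Cons by (simp add: inv_mult_group ev_closed)
  finally show ?case .
qed

lemma ex_word: "g \<in> carrier G \<Longrightarrow> \<exists>ws. set ws \<subseteq> letters \<and> ev ws = g"
proof -
  assume "g \<in> carrier G"
  then have "g \<in> generate G S"
    using gens by (simp add: finite_generating_set_def)
  then show ?thesis
  proof (induction rule: generate.induct)
    case one
    show ?case by (rule exI[of _ "[]"]) simp
  next
    case (incl h)
    then have "h \<in> letters" by (simp add: letters_def)
    then show ?case using letters_closed by (intro exI[of _ "[h]"]) auto
  next
    case (inv h)
    then have "inv h \<in> letters" by (simp add: letters_def)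
    then show ?case using letters_closed by (intro exI[of _ "[inv h]"]) auto
  next
    case (eng h1 h2)
    then obtain u v where "set u \<subseteq> letters" "ev u = h1" "set v \<subseteq> letters" "ev v = h2" by blast
    then show ?case by (intro exI[of _ "u @ v"]) (auto simp: ev_append)
  qed
qed

lemma wl_eq: "wl g = (LEAST n. \<exists>ws. length ws = n \<and> set ws \<subseteq> letters \<and> ev ws = g)"
  by (simp add: word_length_def letters_def ev_def)

lemma wl_le: "set ws \<subseteq> letters \<Longrightarrow> wl (ev ws) \<le> length ws"
  unfolding wl_eq by (rule Least_le) auto

lemma geodesic_word:
  assumes "g \<in> carrier G"
  obtains ws where "set ws \<subseteq> letters" "ev ws = g" "length ws = wl g"
proof -
  have "\<exists>n ws. length ws = n \<and> set ws \<subseteq> letters \<and> ev ws = g"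
    using ex_word[OF assms] by auto
  from LeastI_ex[OF this] show ?thesis using that unfolding wl_eq by blast
qed

lemma wl_one [simp]: "wl \<one> = 0"
  using wl_le[of "[]"] by simp

lemma wl_eq_0: "g \<in> carrier G \<Longrightarrow> wl g = 0 \<longleftrightarrow> g = \<one>"
  by (metis ev_Nil geodesic_word length_0_conv wl_one)

lemma wl_mult: "\<lbrakk>g \<in> carrier G; h \<in> carrier G\<rbrakk> \<Longrightarrow> wl (g \<otimes> h) \<le> wl g + wl h"
proof -
  assume "g \<in> carrier G" "h \<in> carrier G"
  then obtain u v where "set u \<subseteq> letters" "ev u = g" "length u = wl g"
    "set v \<subseteq> letters" "ev v = h" "length v = wl h"
    by (metis geodesic_word)
  then show ?thesis using wl_le[of "u @ v"] by (simp add: ev_append)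
qed

lemma wl_inv_le: "g \<in> carrier G \<Longrightarrow> wl (inv g) \<le> wl g"
  by (metis ev_inv_word geodesic_word length_inv_word set_inv_word wl_le)

lemma wl_inv: "g \<in> carrier G \<Longrightarrow> wl (inv g) = wl g"
  by (metis inv_closed inv_inv order_antisym wl_inv_le)

lemma wd_left_mult:
  "\<lbrakk>g \<in> carrier G; x \<in> carrier G; y \<in> carrier G\<rbrakk> \<Longrightarrow> wd (g \<otimes> x) (g \<otimes> y) = wd x y"
  by (simp add: wd_def inv_mult_group m_assoc inv_solve_left) (metis inv_closed l_inv l_one m_assoc m_closed)

lemma word_dist_eq: "word_dist G S x y = real (wd x y)"
  by (simp add: word_dist_def wd_def)

lemma wd_ev: "\<lbrakk>x \<in> carrier G; set ws \<subseteq> letters\<rbrakk> \<Longrightarrow> wd x (x \<otimes> ev ws) \<le> length ws"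
  by (simp add: wd_def wl_le ev_closed m_assoc[symmetric])

sublocale discrete_geodesic "carrier G" wd
proof
  show "wd x x = 0" if "x \<in> carrier G" for x
    using that by (simp add: wd_def)
  show "wd x y = wd y x" if "x \<in> carrier G" "y \<in> carrier G" for x y
    using that wl_inv[of "inv x \<otimes> y"] by (simp add: wd_def inv_mult_group)
  show tri: "wd x z \<le> wd x y + wd y z" if "x \<in> carrier G" "y \<in> carrier G" "z \<in> carrier G" for x y z
  proof -
    have "inv x \<otimes> z = (inv x \<otimes> y) \<otimes> (inv y \<otimes> z)"
      using that by (metis inv_closed inv_solve_left m_assoc m_closed)
    with that show ?thesis by (simp add: wd_def wl_mult)
  qed
  show "\<exists>p\<in>carrier G. wd x p = r \<and> wd p y = wd x y - r"
    if xy: "x \<in> carrier G" "y \<in> carrier G" and r: "r \<le> wd x y" for x y r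
  proof -
    obtain ws where ws: "set ws \<subseteq> letters" "ev ws = inv x \<otimes> y" "length ws = wd x y"
      using xy unfolding wd_def by (metis geodesic_word inv_closed m_closed)
    define u v where "u = take r ws" and "v = drop r ws"
    have uv: "set u \<subseteq> letters" "set v \<subseteq> letters" "length u = r" "length v = wd x y - r"
      using ws r by (auto simp: u_def v_def dest: in_set_takeD in_set_dropD)
    define p where "p = x \<otimes> ev u"
    have p: "p \<in> carrier G" using uv xy by (simp add: p_def ev_closed)
    have "p \<otimes> ev v = x \<otimes> ev (u @ v)"
      using uv xy by (simp add: p_def ev_append ev_closed m_assoc)
    also have "\<dots> = y"
      using ws xy by (simp add: u_def v_def m_assoc[symmetric])
    finally have "wd p y \<le> wd x y - r" using wd_ev[OF p uv(2)] uv by simp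
    moreover have "wd x p \<le> r" using wd_ev[OF xy(1) uv(1)] uv by (simp add: p_def)
    moreover have "wd x y \<le> wd x p + wd p y" using tri xy p by blast
    ultimately show ?thesis using p r by (intro bexI[of _ p]) linarith+
  qed
qed

lemma finite_wl_ball: "finite {g \<in> carrier G. wl g \<le> n}"
proof (rule finite_subset)
  show "{g \<in> carrier G. wl g \<le> n} \<subseteq> ev ` {ws. set ws \<subseteq> letters \<and> length ws \<le> n}"
  proof
    fix g assume g: "g \<in> {g \<in> carrier G. wl g \<le> n}"
    then obtain ws where "set ws \<subseteq> letters" "ev ws = g" "length ws = wl g"
      using geodesic_word[of g] by blast
    with g show "g \<in> ev ` {ws. set ws \<subseteq> letters \<and> length ws \<le> n}" by auto
  qed
  show "finite (ev ` {ws. set ws \<subseteq> letters \<and> length ws \<le> n})"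
    using finite_letters by (simp add: finite_lists_length_le)
qed

text \<open>The finitely many letters determine the slope. Applied to the distance from the identity
  in a left-invariant pseudometric, this makes the projections coarsely Lipschitz.\<close>

lemma subadditive_le_wl:
  fixes l :: "'a \<Rightarrow> real"
  assumes "l \<one> \<le> 0" "\<And>g h. \<lbrakk>g \<in> carrier G; h \<in> carrier G\<rbrakk> \<Longrightarrow> l (g \<otimes> h) \<le> l g + l h"
  shows "\<exists>c\<ge>0. \<forall>g\<in>carrier G. l g \<le> c * real (wl g)"
proof -
  define c where "c = Max (insert 0 (l ` letters))"
  have c: "l a \<le> c" if "a \<in> letters" for a
    using that finite_letters by (simp add: c_def)
  have "0 \<le> c" using finite_letters by (simp add: c_def)
  have "l (ev ws) \<le> c * real (length ws)" if "set ws \<subseteq> letters" for ws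
    using that
  proof (induction ws)
    case Nil
    then show ?case using assms(1) by simp
  next
    case (Cons a ws)
    then have "l (ev (a # ws)) \<le> l a + l (ev ws)"
      using assms(2) letters_closed by (auto simp: ev_closed)
    with Cons c[of a] show ?case by (simp add: algebra_simps)
  qed
  with \<open>0 \<le> c\<close> show ?thesis by (metis geodesic_word)
qed

end

section \<open>Quasigeodesics in hyperbolic spaces\<close>

text \<open>The four-point form no longer singles out a base point. The arguments of
  \<open>d\<close> stand in the order that unfolding produces, so no symmetry of \<open>d\<close>
  enters.\<close>

lemma hyperbolic_on_iff:
  "hyperbolic_on \<delta> M d \<longleftrightarrow> (\<forall>w\<in>M. \<forall>x\<in>M. \<forall>y\<in>M. \<forall>z\<in>M.
     d x z + d w y \<le> max (d x y + d w z) (d y z + d w x) + 2 * \<delta>)"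
  unfolding hyperbolic_on_def gromov_product_def by (intro ball_cong refl) (auto simp: min_def max_def field_simps)

lemma hyperbolic_on_nonneg: "\<lbrakk>hyperbolic_on \<delta> M d; x \<in> M\<rbrakk> \<Longrightarrow> 0 \<le> \<delta>"
  unfolding hyperbolic_on_def by fastforce

text \<open>Halving the chain instead of removing one point at a time costs \<open>\<delta>\<close>
  per halving, so the loss is logarithmic in the number of points. This forces a path around a large
  ball to be exponentially long.\<close>

lemma gromov_product_chain:
  assumes hyp: "hyperbolic_on \<delta> M d" and p: "p \<in> M"
  shows "\<lbrakk>1 \<le> n; n \<le> 2 ^ k; \<forall>i\<le>n. x i \<in> M\<rbrakk> \<Longrightarrow>
    \<exists>i<n. gromov_product d p (x i) (x (Suc i)) \<le> gromov_product d p (x 0) (x n) + real k * \<delta>"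
proof (induction k arbitrary: n x)
  case 0
  then have "n = 1" by simp
  then show ?case by auto
next
  case (Suc k)
  have \<delta>: "0 \<le> \<delta>" using hyperbolic_on_nonneg[OF hyp p] .
  show ?case
  proof (cases "n = 1")
    case True
    then show ?thesis using \<delta> by auto
  next
    case False
    define m where "m = n div 2"
    have m: "1 \<le> m" "m < n" "m \<le> 2 ^ k" "n - m \<le> 2 ^ k"
      using Suc.prems False by (auto simp: m_def)
    have "gromov_product d p (x 0) (x n) \<ge>
        min (gromov_product d p (x 0) (x m)) (gromov_product d p (x m) (x n)) - \<delta>"
      using hyp p Suc.prems m by (simp add: hyperbolic_on_def)
    then consider "gromov_product d p (x 0) (x m) \<le> gromov_product d p (x 0) (x n) + \<delta>"
      | "gromov_product d p (x m) (x n) \<le> gromov_product d p (x 0) (x n) + \<delta>"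
      by linarith
    then show ?thesis
    proof cases
      case 1
      obtain i where "i < m" "gromov_product d p (x i) (x (Suc i)) \<le> gromov_product d p (x 0) (x m) + real k * \<delta>"
        using Suc.IH[of m x] m Suc.prems by auto
      with 1 m show ?thesis by (intro exI[of _ i]) (auto simp: algebra_simps)
    next
      case 2
      obtain i where "i < n - m" "gromov_product d p (x (m + i)) (x (m + Suc i)) \<le> gromov_product d p (x m) (x n) + real k * \<delta>"
      proof -
        have "\<exists>i<n - m. gromov_product d p (x (m + i)) (x (m + Suc i)) \<le> gromov_product d p (x m) (x n) + real k * \<delta>"
          using Suc.IH[of "n - m" "\<lambda>i. x (m + i)"] m Suc.prems by (simp del: add_Suc_right)
        then show ?thesis using that by blast
      qed
      with 2 m show ?thesis by (intro exI[of _ "m + i"]) (auto simp: algebra_simps)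
    qed
  qed
qed

text \<open>With \<open>k\<close> about \<open>D / (2 * (\<delta> + 1))\<close>, the product
  \<open>k * \<delta>\<close> stays below \<open>D / 2\<close> while \<open>2 ^ k\<close> grows
  exponentially in \<open>D\<close>. It sets the linear length of a detour against the logarithmic
  loss along a chain.\<close>

lemma linear_less_exponential:
  fixes a b \<delta> :: real
  assumes "0 \<le> a" "0 \<le> \<delta>"
  shows "\<exists>D0. \<forall>D\<ge>D0. \<exists>k::nat. a * D + b \<le> 2 ^ k \<and> c + real k * \<delta> < D"
proof -
  define s where "s = 2 * (\<delta> + 1)"
  have s: "s > 0" using assms by (simp add: s_def)
  have "((\<lambda>k::nat. (a * s * (real k + 1) + b) / 2 ^ k) \<longlongrightarrow> 0) sequentially"
  proof -
    have "(\<lambda>k. (a * s) * (real k / 2 ^ k) + (a * s + b) * (1 / 2) ^ k) \<longlonglongrightarrow> (a * s) * 0 + (a * s + b) * 0"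
      by (intro tendsto_intros lim_n_over_pown LIMSEQ_power_zero) auto
    then show ?thesis by (simp add: power_one_over add_divide_distrib algebra_simps)
  qed
  then have "\<forall>\<^sub>F k in sequentially. (a * s * (real k + 1) + b) / 2 ^ k < 1"
    by (rule order_tendstoD) simp
  then obtain k0 where k0: "\<And>k. k \<ge> k0 \<Longrightarrow> a * s * (real k + 1) + b < 2 ^ k"
    by (auto simp: eventually_sequentially)
  show ?thesis
  proof (intro exI allI impI)
    \<comment> \<open>The first bound makes \<open>k\<close> at least \<open>k0\<close>, the second
      keeps \<open>c\<close> below \<open>D / 2\<close>.\<close>
    fix D assume D: "D \<ge> max (s * (real k0 + 1)) (2 * \<bar>c\<bar> + 1)"
    define k where "k = nat \<lfloor>D / s\<rfloor>"
    have "D / s \<ge> real k0 + 1" using D s by (simp add: field_simps)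
    then have k: "real k \<le> D / s" "D / s \<le> real k + 1" "k \<ge> k0"
      unfolding k_def by linarith+
    have "D \<le> s * (real k + 1)" using k s by (simp add: field_simps)
    then have "a * D + b \<le> a * s * (real k + 1) + b"
      using assms by (simp add: mult_left_mono mult.assoc)
    moreover have "real k * \<delta> \<le> D / 2"
    proof -
      have "real k * s \<le> D" using k s by (simp add: field_simps)
      then have "real k * \<delta> + real k \<le> D / 2" by (simp add: s_def algebra_simps)
      then show ?thesis by linarith
    qed
    ultimately show "a * D + b \<le> 2 ^ k \<and> c + real k * \<delta> < D"
      using k0[OF k(3)] D by auto
  qed
qed

text \<open>The Morse lemma. Among the points almost on a geodesic between the endpoints take one,
  \<open>p\<close>, of maximal distance \<open>D\<close> from the path. Walk from \<open>p\<close>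
  towards each endpoint by \<open>2 * D\<close>, drop to the path by at most \<open>D\<close>, and
  follow the path between the two feet. This gives a chain of length linear in \<open>D\<close>
  whose consecutive Gromov products at \<open>p\<close> are at least \<open>D - 1 / 2\<close>, while
  the product of its two ends is at most \<open>c / 2\<close>. The logarithmic loss along chains
  then bounds \<open>D\<close>.\<close>

lemma (in discrete_geodesic) quasigeodesic_stability:
  fixes K :: real and c :: nat
  assumes hyp: "hyperbolic_on \<delta> M (\<lambda>x y. real (d x y))" and K: "0 \<le> K"
  shows "\<exists>R. \<forall>n x p. (\<forall>i\<le>n. x i \<in> M) \<and> (\<forall>i<n. d (x i) (x (Suc i)) \<le> 1) \<and>
    (\<forall>i j. i \<le> j \<and> j \<le> n \<longrightarrow> real (j - i) \<le> K * real (d (x i) (x j))) \<and>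
    p \<in> M \<and> d (x 0) p + d p (x n) \<le> d (x 0) (x n) + c \<longrightarrow> (\<exists>i\<le>n. d (x i) p \<le> R)"
proof (cases "M = {}")
  case False
  then have \<delta>: "0 \<le> \<delta>" using hyperbolic_on_nonneg[OF hyp] by blast
  \<comment> \<open>The stretch of path between the two feet will have at most
    \<open>6 * K * D\<close> steps, and 2 more join it to the ends of the chain. The term
    \<open>c / 2\<close> bounds the Gromov product of the ends, and \<open>1 / 2\<close> is lost to
    a unit step.\<close>
  obtain D0 where D0: "\<And>D. D \<ge> D0 \<Longrightarrow>
      \<exists>k::nat. 6 * K * D + 2 \<le> 2 ^ k \<and> (real c / 2 + 1 / 2) + real k * \<delta> < D"
    using linear_less_exponential[of "6 * K" \<delta> 2 "real c / 2 + 1 / 2"] K \<delta> by auto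
  show ?thesis
  proof (rule exI[of _ "nat \<lceil>D0\<rceil>"], intro allI impI, elim conjE)
    fix n x p0
    assume x: "\<forall>i\<le>n. x i \<in> M" and step: "\<forall>i<n. d (x i) (x (Suc i)) \<le> 1"
      and qg: "\<forall>i j. i \<le> j \<and> j \<le> n \<longrightarrow> real (j - i) \<le> K * real (d (x i) (x j))"
      and p0: "p0 \<in> M" "d (x 0) p0 + d p0 (x n) \<le> d (x 0) (x n) + c"
    define P where "P q \<longleftrightarrow> q \<in> M \<and> d (x 0) q + d q (x n) \<le> d (x 0) (x n) + c" for q
    define f where "f q = Min ((\<lambda>i. d (x i) q) ` {..n})" for q
    have f_le: "f q \<le> d (x i) q" if "i \<le> n" for q i
      using that by (simp add: f_def)
    have f_attained: "\<exists>i\<le>n. d (x i) q = f q" for q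
    proof -
      have "f q \<in> (\<lambda>i. d (x i) q) ` {..n}"
        unfolding f_def by (intro Min_in) auto
      then show ?thesis by auto
    qed
    \<comment> \<open>A uniform bound is what provides a maximiser, as the set of candidates may be
      infinite.\<close>
    have "\<forall>q. P q \<longrightarrow> f q < Suc (d (x 0) (x n) + c)"
    proof (intro allI impI)
      fix q assume "P q"
      then show "f q < Suc (d (x 0) (x n) + c)" using f_le[of 0 q] by (simp add: P_def)
    qed
    moreover have "P p0" using p0 by (simp add: P_def)
    ultimately have "\<exists>p. P p \<and> (\<forall>q. P q \<longrightarrow> f q \<le> f p)"
      by (intro ex_has_greatest_nat)
    then obtain p where "P p" and max: "\<And>q. P q \<Longrightarrow> f q \<le> f p" by blast
    then have p: "p \<in> M" "d (x 0) p + d p (x n) \<le> d (x 0) (x n) + c" by (auto simp: P_def)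
    define D where "D = f p"
    have x0: "x 0 \<in> M" and xn: "x n \<in> M" using x by auto
    have "D \<le> nat \<lceil>D0\<rceil>"
    proof (rule ccontr)
      assume "\<not> D \<le> nat \<lceil>D0\<rceil>"
      then have "real D \<ge> D0" by linarith
      then obtain k where k: "6 * K * real D + 2 \<le> 2 ^ k" "(real c / 2 + 1 / 2) + real k * \<delta> < real D"
        using D0 by blast
      have far: "D \<le> d p (x i)" if "i \<le> n" for i
        using f_le[OF that, of p] x that p by (simp add: D_def d_commute)
      \<comment> \<open>An endpoint within \<open>2 * D\<close> of \<open>p\<close> takes the place
        of \<open>y\<close> and is its own foot. The last inequality says that the Gromov product at
        \<open>p\<close> of \<open>y\<close> and its foot is at least \<open>D\<close>.\<close>
      have near: "\<exists>y\<in>M. \<exists>i\<le>n. d (x e) y + d y p = d (x e) p \<and> d y (x i) \<le> D \<and> d y p \<le> 2 * D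
            \<and> 2 * D + d y (x i) \<le> d p y + d p (x i)"
        if e: "e \<le> n" and Py: "\<And>y. \<lbrakk>y \<in> M; d (x e) y + d y p = d (x e) p\<rbrakk> \<Longrightarrow> P y" for e
      proof (cases "d (x e) p \<le> 2 * D")
        case True
        have "x e \<in> M" using x e by auto
        with True show ?thesis using e far[OF e] p
          by (intro bexI[of _ "x e"] exI[of _ e]) (auto simp: d_self d_commute)
      next
        case False
        have xe: "x e \<in> M" using x e by auto
        obtain y where y: "y \<in> M" "d (x e) y = d (x e) p - 2 * D" "d y p = 2 * D"
          using d_between[OF xe p(1), of "d (x e) p - 2 * D"] False by auto
        then have "f y \<le> D" using max[OF Py, of y] False by (simp add: D_def)
        then obtain i where i: "i \<le> n" "d (x i) y \<le> D" using f_attained[of y] by metis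
        then have "d y (x i) \<le> D" using x y by (simp add: d_commute)
        moreover have "d p y = 2 * D" using y p by (simp add: d_commute)
        ultimately show ?thesis using y i far[OF i(1)] False
          by (intro bexI[of _ y] exI[of _ i]) auto
      qed
      obtain y i where y: "y \<in> M" "i \<le> n" "d (x 0) y + d y p = d (x 0) p" "d y (x i) \<le> D"
          "d y p \<le> 2 * D" "2 * D + d y (x i) \<le> d p y + d p (x i)"
      proof -
        \<comment> \<open>Points between an endpoint and \<open>p\<close> are again almost on the
          geodesic, so the maximality of \<open>D\<close> applies to them.\<close>
        have "P y" if "y \<in> M" "d (x 0) y + d y p = d (x 0) p" for y
          using that p d_triangle[OF that(1) p(1) xn] by (simp add: P_def)
        then show ?thesis using near[of 0] that by blast
      qed
      obtain y' j where y': "y' \<in> M" "j \<le> n" "d (x n) y' + d y' p = d (x n) p" "d y' (x j) \<le> D"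
          "d y' p \<le> 2 * D" "2 * D + d y' (x j) \<le> d p y' + d p (x j)"
      proof -
        have "P y" if "y \<in> M" "d (x n) y + d y p = d (x n) p" for y
          using that p d_triangle[OF x0 p(1) that(1)] xn by (simp add: P_def d_commute)
        then show ?thesis using near[of n] that by blast
      qed
      have xi: "x i \<in> M" and xj: "x j \<in> M" using x y y' by auto
      obtain m s where s: "s 0 = x i" "s m = x j" "\<And>l. l < m \<Longrightarrow> d (s l) (s (Suc l)) \<le> 1"
        "\<And>l. l \<le> m \<Longrightarrow> s l \<in> x ` {..n}" "real m \<le> K * real (d (x i) (x j))"
      proof (cases "i \<le> j")
        case True
        show ?thesis
          by (rule that[of "\<lambda>l. x (i + l)" "j - i"]) (use True y' step qg in auto)
      next
        case False
        have "d (x (i - l)) (x (i - Suc l)) \<le> 1" if "l < i - j" for l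
        proof -
          have "d (x (i - Suc l)) (x (Suc (i - Suc l))) \<le> 1"
            using step y that by auto
          moreover have "Suc (i - Suc l) = i - l" using that by auto
          moreover have "x (i - Suc l) \<in> M" "x (i - l) \<in> M" using x y by auto
          ultimately show ?thesis by (simp add: d_commute)
        qed
        moreover have "real (i - j) \<le> K * real (d (x i) (x j))"
          using qg[rule_format, of j i] False y xi xj by (simp add: d_commute)
        ultimately show ?thesis
          using False y by (intro that[of "\<lambda>l. x (i - l)" "i - j"]) auto
      qed
      have "d (x i) (x j) \<le> d y (x i) + (d y p + (d y' p + d y' (x j)))"
        using d_triangle[OF xi y(1) xj] d_triangle[OF y(1) p(1) xj] d_triangle[OF p(1) y'(1) xj]
          d_commute[OF xi y(1)] d_commute[OF p(1) y'(1)] by linarith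
      \<comment> \<open>The sum is \<open>D + 2 * D + 2 * D + D\<close>.\<close>
      then have "d (x i) (x j) \<le> 6 * D" using y y' by linarith
      then have "K * real (d (x i) (x j)) \<le> K * (6 * real D)"
        using K by (intro mult_left_mono) linarith+
      then have "real m + 2 \<le> 6 * K * real D + 2" using s by (simp add: algebra_simps)
      then have "real (m + 2) \<le> real (2 ^ k)" using k by simp
      then have mk: "m + 2 \<le> 2 ^ k" by (simp only: of_nat_le_iff)
      define t where "t l = (if l = 0 then y else if l = m + 2 then y' else s (l - 1))" for l
      have sM: "s l \<in> M" "D \<le> d p (s l)" if "l \<le> m" for l
        using s(4)[OF that] x far by auto
      have t: "\<forall>l\<le>m+2. t l \<in> M"
        using y y' sM by (auto simp: t_def)
      obtain l where l: "l < m + 2" and "gromov_product (\<lambda>x y. real (d x y)) p (t l) (t (Suc l))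
          \<le> gromov_product (\<lambda>x y. real (d x y)) p (t 0) (t (m + 2)) + real k * \<delta>"
        using gromov_product_chain[OF hyp p(1) _ mk t] by auto
      then have *: "real (d p (t l)) + real (d p (t (Suc l))) - real (d (t l) (t (Suc l)))
          \<le> real (d p y) + real (d p y') - real (d y y') + 2 * (real k * \<delta>)"
      proof -
        have "t 0 = y" "t (m + 2) = y'" by (auto simp: t_def)
        with \<open>gromov_product _ p (t l) _ \<le> _\<close> show ?thesis
          unfolding gromov_product_def by (simp add: field_simps)
      qed
      have "d (x 0) (x n) \<le> d (x 0) y + (d y y' + d (x n) y')"
        using d_triangle[OF x0 y(1) xn] d_triangle[OF y(1) y'(1) xn] d_commute[OF xn y'(1)] by linarith
      then have "d p y + d p y' \<le> d y y' + c"
        using p y y' xn d_commute[OF p(1) y(1)] d_commute[OF p(1) y'(1)] d_commute[OF p(1) xn] by linarith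
      then have "real (d p y) + real (d p y') - real (d y y') \<le> real c" by linarith
      with * k have **: "real (d p (t l)) + real (d p (t (Suc l))) < real (d (t l) (t (Suc l))) + 2 * real D - 1"
        by linarith
      consider "l = 0" | "l = m + 1" | "1 \<le> l" "l \<le> m" using l by linarith
      then show False
      proof cases
        case 1
        then show ?thesis using ** y s by (simp add: t_def)
      next
        case 2
        then show ?thesis using ** y' s d_commute[OF xj y'(1)] by (simp add: t_def)
      next
        case 3
        then have "t l = s (l - 1)" "t (Suc l) = s l" by (auto simp: t_def)
        moreover have "d (s (l - 1)) (s l) \<le> 1" using s(3)[of "l - 1"] 3 by simp
        moreover have "D \<le> d p (s (l - 1))" "D \<le> d p (s l)" using sM 3 by auto
        ultimately show ?thesis using ** by simp
      qed
    qed
    moreover have "f p0 \<le> D" using max[of p0] p0 by (simp add: P_def D_def)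
    ultimately show "\<exists>i\<le>n. d (x i) p0 \<le> nat \<lceil>D0\<rceil>" using f_attained[of p0] by (metis order_trans)
  qed
qed auto

text \<open>The centre lies on the side from \<open>x\<close> to \<open>y\<close>, at distance from
  \<open>x\<close> the Gromov product of \<open>y\<close> and \<open>z\<close>, rounded down. There
  both pairings in the four-point condition are balanced. The summand 2 absorbs the
  rounding.\<close>

lemma (in discrete_geodesic) triangle_centre:
  assumes hyp: "hyperbolic_on \<delta> M (\<lambda>x y. real (d x y))"
    and "x \<in> M" "y \<in> M" "z \<in> M"
  obtains p where "p \<in> M" "d x p + d p y = d x y" "d x p + d p z \<le> d x z + nat \<lceil>2 * \<delta> + 2\<rceil>"
    "d y p + d p z \<le> d y z + nat \<lceil>2 * \<delta> + 2\<rceil>"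
proof -
  define r where "r = (d x y + d x z - d y z) div 2"
  have tri: "d y z \<le> d x y + d x z" "d x z \<le> d x y + d y z" "d x y \<le> d x z + d y z"
    using assms d_triangle[of y x z] d_triangle[of x y z] d_triangle[of x z y] by (auto simp: d_commute)
  have r: "2 * r \<le> d x y + d x z - d y z" "d x y + d x z - d y z \<le> 2 * r + 1" "r \<le> d x y"
    using tri by (auto simp: r_def)
  obtain p where p: "p \<in> M" "d x p = r" "d p y = d x y - r"
    using d_between[OF assms(2,3) r(3)] by blast
  have "real (d p z) + real (d x y) \<le> max (real (d p x) + real (d y z)) (real (d p y) + real (d x z)) + 2 * \<delta>"
  proof -
    have "real (d p z) + real (d y x) \<le> max (real (d p x) + real (d y z)) (real (d x z) + real (d y p)) + 2 * \<delta>"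
      using hyp p assms unfolding hyperbolic_on_iff by blast
    then show ?thesis using assms p by (simp add: d_commute add.commute)
  qed
  then have "real (d p z) \<le> real (d y z) - real (d x y) + real r + 1 + 2 * \<delta>"
    using p r tri assms d_commute[of p x] by (auto simp: max_def split: if_splits)
  then have "d x p + d p z \<le> d x z + nat \<lceil>2 * \<delta> + 2\<rceil>"
    "d y p + d p z \<le> d y z + nat \<lceil>2 * \<delta> + 2\<rceil>"
    using p r tri assms d_commute[of p y] by linarith+
  with p r show ?thesis using that by auto
qed

section \<open>Central extensions of hyperbolic groups by an infinite cyclic group\<close>

locale hyperbolic_central_extension = F: word_metric F S + G: group G + group_hom G F \<pi>
  for F :: "('f, 'n) monoid_scheme" (structure) and S :: "'f set"
    and G :: "('g, 'm) monoid_scheme" (structure) and \<pi> :: "'g \<Rightarrow> 'f" +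
  fixes z :: 'g and \<delta> :: real
  assumes hyperbolic: "hyperbolic_on \<delta> (carrier F) (word_dist F S)"
    and \<pi>_surj: "\<pi> ` carrier G = carrier F"
    and z_closed: "z \<in> carrier G"
    and z_central: "g \<in> carrier G \<Longrightarrow> z \<otimes>\<^bsub>G\<^esub> g = g \<otimes>\<^bsub>G\<^esub> z"
    and \<pi>_kernel: "kernel G F \<pi> = range (\<lambda>n::int. z [^]\<^bsub>G\<^esub> n)"
    and z_inj: "inj (\<lambda>n::int. z [^]\<^bsub>G\<^esub> n)"
begin

lemma hyperbolic': "hyperbolic_on \<delta> (carrier F) (\<lambda>x y. real (F.wd x y))"
  using hyperbolic by (simp add: F.word_dist_eq[abs_def])

section \<open>Powers of the central generator\<close>

definition zp :: "int \<Rightarrow> 'g" where "zp n = z [^]\<^bsub>G\<^esub> n"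

lemma zp_closed [simp]: "zp n \<in> carrier G"
  and zp_0 [simp]: "zp 0 = \<one>\<^bsub>G\<^esub>"
  and zp_add: "zp (m + n) = zp m \<otimes>\<^bsub>G\<^esub> zp n"
  and zp_minus: "zp (- n) = inv\<^bsub>G\<^esub> (zp n)"
  and zp_eq_iff [simp]: "zp m = zp n \<longleftrightarrow> m = n"
  using z_closed z_inj by (auto simp: zp_def G.int_pow_mult G.int_pow_neg inj_eq)

lemma \<pi>_zp [simp]: "\<pi> (zp n) = \<one>\<^bsub>F\<^esub>"
  using \<pi>_kernel by (auto simp: kernel_def zp_def)

lemma zp_central: "g \<in> carrier G \<Longrightarrow> zp n \<otimes>\<^bsub>G\<^esub> g = g \<otimes>\<^bsub>G\<^esub> zp n"
proof -
  assume g: "g \<in> carrier G"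
  have nat: "zp (int k) \<otimes>\<^bsub>G\<^esub> g = g \<otimes>\<^bsub>G\<^esub> zp (int k)" for k
  proof (induction k)
    case (Suc k)
    have "zp (int (Suc k)) = zp (int k) \<otimes>\<^bsub>G\<^esub> z"
      using zp_add[of "int k" 1] z_closed by (simp add: zp_def add.commute)
    then show ?case using Suc g z_closed z_central[OF g]
      by (metis G.m_assoc zp_closed)
  qed (use g in simp)
  show ?thesis
  proof (cases n)
    case (nonneg k)
    then show ?thesis using nat by simp
  next
    case (neg k)
    define h where "h = zp (int (Suc k))"
    have h: "h \<in> carrier G" "h \<otimes>\<^bsub>G\<^esub> g = g \<otimes>\<^bsub>G\<^esub> h" using nat[of "Suc k"] by (auto simp: h_def)
    have "inv\<^bsub>G\<^esub> h \<otimes>\<^bsub>G\<^esub> g = inv\<^bsub>G\<^esub> h \<otimes>\<^bsub>G\<^esub> (g \<otimes>\<^bsub>G\<^esub> h) \<otimes>\<^bsub>G\<^esub> inv\<^bsub>G\<^esub> h"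
      using h(1) g by (simp add: G.m_assoc)
    also have "\<dots> = inv\<^bsub>G\<^esub> h \<otimes>\<^bsub>G\<^esub> h \<otimes>\<^bsub>G\<^esub> g \<otimes>\<^bsub>G\<^esub> inv\<^bsub>G\<^esub> h"
      unfolding h(2)[symmetric] using h(1) g by (simp only: G.m_assoc G.inv_closed G.m_closed)
    also have "\<dots> = g \<otimes>\<^bsub>G\<^esub> inv\<^bsub>G\<^esub> h" using h(1) g by simp
    finally show ?thesis using neg zp_minus[of "int (Suc k)"] by (simp add: h_def)
  qed
qed

lemma eq_zp:
  assumes "g \<in> carrier G" "h \<in> carrier G" "\<pi> g = \<pi> h"
  obtains n where "g = h \<otimes>\<^bsub>G\<^esub> zp n"
proof -
  have "inv\<^bsub>G\<^esub> h \<otimes>\<^bsub>G\<^esub> g \<in> kernel G F \<pi>"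
    using assms by (simp add: kernel_def)
  then obtain n where "inv\<^bsub>G\<^esub> h \<otimes>\<^bsub>G\<^esub> g = zp n"
    using \<pi>_kernel by (auto simp: zp_def)
  then have "g = h \<otimes>\<^bsub>G\<^esub> zp n" using assms by (metis G.inv_solve_left zp_closed)
  then show ?thesis using that by blast
qed

section \<open>Lifts of words and the linear isoperimetric inequality\<close>

definition lift :: "'f \<Rightarrow> 'g" where "lift f = (SOME g. g \<in> carrier G \<and> \<pi> g = f)"

lemma lift_exists: "f \<in> carrier F \<Longrightarrow> lift f \<in> carrier G \<and> \<pi> (lift f) = f"
proof -
  assume "f \<in> carrier F"
  then obtain g where "g \<in> carrier G" "\<pi> g = f" using \<pi>_surj by (metis imageE)
  then have "\<exists>g. g \<in> carrier G \<and> \<pi> g = f" by blast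
  then show ?thesis unfolding lift_def by (rule someI_ex)
qed

lemmas lift = lift_exists[THEN conjunct1] lift_exists[THEN conjunct2]

text \<open>Since \<open>lift\<close> is an arbitrary section, lifting letter by letter is what
  turns concatenation into multiplication exactly. Inversion is not respected: the lift of an
  inverse letter may differ from the inverse of the lift by a power of \<open>z\<close>.\<close>

definition lw :: "'f list \<Rightarrow> 'g" where "lw w = foldr (\<lambda>a g. lift a \<otimes>\<^bsub>G\<^esub> g) w \<one>\<^bsub>G\<^esub>"

lemma lw_Nil [simp]: "lw [] = \<one>\<^bsub>G\<^esub>"
  and lw_Cons [simp]: "lw (a # w) = lift a \<otimes>\<^bsub>G\<^esub> lw w"
  by (simp_all add: lw_def)

lemma lw_closed: "set w \<subseteq> F.letters \<Longrightarrow> lw w \<in> carrier G"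
  using F.letters_closed by (induction w) (auto simp: lift)

lemma \<pi>_lw: "set w \<subseteq> F.letters \<Longrightarrow> \<pi> (lw w) = F.ev w"
proof (induction w)
  case (Cons a w)
  then have "a \<in> carrier F" using F.letters_closed by auto
  with Cons show ?case by (simp add: lw_closed lift)
qed simp

lemma lw_append: "\<lbrakk>set u \<subseteq> F.letters; set v \<subseteq> F.letters\<rbrakk> \<Longrightarrow> lw (u @ v) = lw u \<otimes>\<^bsub>G\<^esub> lw v"
proof (induction u)
  case (Cons a u)
  then have "a \<in> carrier F" using F.letters_closed by auto
  with Cons show ?case by (simp add: lw_closed lift G.m_assoc)
qed (simp add: lw_closed)

text \<open>At the point of a loop farthest from the base point the loop backtracks: a subword of length
  \<open>2 * L\<close> centred there fails to be geodesic as soon as \<open>L > 2 * \<delta>\<close>.\<close>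

lemma loop_shortcut:
  assumes L: "real L > 2 * \<delta>" and w: "set w \<subseteq> F.letters" "F.ev w = \<one>\<^bsub>F\<^esub>" "w \<noteq> []"
  obtains u v t v' where "w = u @ v @ t" "set v' \<subseteq> F.letters" "F.ev v' = F.ev v"
    "length v' < length v" "length v \<le> 2 * L"
proof -
  define n where "n = length w"
  define x where "x i = F.ev (take i w)" for i
  have sub: "set (take i w) \<subseteq> F.letters" "set (drop i w) \<subseteq> F.letters" "set (take j (drop i w)) \<subseteq> F.letters" for i j
    using w by (auto dest!: in_set_takeD in_set_dropD)
  have x: "x i \<in> carrier F" for i using sub by (simp add: x_def F.ev_closed)
  have L0: "0 < L" using L hyperbolic_on_nonneg[OF hyperbolic' F.one_closed] by simp
  have x_add: "x (i + j) = x i \<otimes>\<^bsub>F\<^esub> F.ev (take j (drop i w))" for i j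
    unfolding x_def take_add using sub by (simp add: F.ev_append)
  have wd_le: "F.wd (x i) (x (i + j)) \<le> j" for i j
    using F.wd_ev[OF x sub(3), of i j i] by (simp add: x_add)
  have "\<exists>i j. i + j \<le> n \<and> j \<le> 2 * L \<and> F.wd (x i) (x (i + j)) < j"
  proof -
    obtain m where m: "m \<le> n" and max: "\<And>i. i \<le> n \<Longrightarrow> F.wd (x 0) (x i) \<le> F.wd (x 0) (x m)"
    proof -
      have "Max ((\<lambda>i. F.wd (x 0) (x i)) ` {..n}) \<in> (\<lambda>i. F.wd (x 0) (x i)) ` {..n}"
        by (intro Max_in) auto
      then obtain m where m: "m \<in> {..n}" "Max ((\<lambda>i. F.wd (x 0) (x i)) ` {..n}) = F.wd (x 0) (x m)"
        by (rule imageE)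
      have "F.wd (x 0) (x i) \<le> F.wd (x 0) (x m)" if "i \<le> n" for i
        unfolding m(2)[symmetric] using that by (intro Max_ge) auto
      then show ?thesis using that[of m] m(1) by simp
    qed
    have closed: "x n = x 0" using w by (simp add: x_def n_def)
    show ?thesis
    \<comment> \<open>If the loop stays within \<open>L\<close> of its base point, then its first
      \<open>2 * L\<close> letters are not geodesic, or it has fewer letters and shrinks to the
      empty word.\<close>
    proof (cases "F.wd (x 0) (x m) < L")
      case True
      show ?thesis
      proof (cases "2 * L \<le> n")
        case True
        then have "F.wd (x 0) (x (2 * L)) < 2 * L"
          using max[OF True] \<open>F.wd (x 0) (x m) < L\<close> by linarith
        then show ?thesis using True by (intro exI[of _ 0] exI[of _ "2 * L"]) auto
      next
        case False
        then show ?thesis using closed w F.d_self[OF x]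
          by (intro exI[of _ 0] exI[of _ n]) (auto simp: n_def)
      qed
    next
      case False
      have "F.wd (x 0) (x m) \<le> m" using wd_le[of 0 m] by simp
      moreover have "F.wd (x 0) (x m) \<le> n - m"
        using wd_le[of m "n - m"] m closed F.d_commute[OF x x, of m n] by simp
      ultimately have Lm: "L \<le> m" "L + m \<le> n" using False m by linarith+
      let ?a = "x (m - L)" and ?b = "x (m + L)"
      \<comment> \<open>Neither \<open>?a\<close> nor \<open>?b\<close> is farther from the base
        point than \<open>x m\<close>, so this leaves at most \<open>L + 2 * \<delta>\<close>, less
        than \<open>2 * L\<close>.\<close>
      have "real (F.wd ?a ?b) + real (F.wd (x 0) (x m)) \<le>
          max (real (F.wd ?a (x m)) + real (F.wd (x 0) ?b)) (real (F.wd (x m) ?b) + real (F.wd (x 0) ?a)) + 2 * \<delta>"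
        using hyperbolic' x unfolding hyperbolic_on_iff by blast
      moreover have "F.wd ?a (x m) \<le> L" using wd_le[of "m - L" L] Lm by simp
      moreover have "F.wd (x m) ?b \<le> L" using wd_le[of m L] by simp
      moreover have "F.wd (x 0) ?a \<le> F.wd (x 0) (x m)" "F.wd (x 0) ?b \<le> F.wd (x 0) (x m)"
        using max[of "m - L"] max[of "m + L"] Lm m by auto
      ultimately have "real (F.wd ?a ?b) < 2 * real L" using L by (auto simp: max_def split: if_splits)
      then have "F.wd ?a ?b < 2 * L" by linarith
      then show ?thesis using Lm by - (rule exI[of _ "m - L"], rule exI[of _ "2 * L"], auto simp: add.commute)
    qed
  qed
  then obtain i j where ij: "i + j \<le> n" "j \<le> 2 * L" "F.wd (x i) (x (i + j)) < j" by blast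
  let ?v = "take j (drop i w)"
  obtain v' where v': "set v' \<subseteq> F.letters" "F.ev v' = F.ev ?v" "length v' = F.wl (F.ev ?v)"
    using F.geodesic_word[OF F.ev_closed[OF sub(3)]] by metis
  have "F.wd (x i) (x (i + j)) = F.wl (F.ev ?v)"
    using x sub by (simp add: F.wd_def x_add F.ev_closed F.m_assoc[symmetric])
  then have "length v' < length ?v" using v' ij by (simp add: n_def)
  moreover have "w = take i w @ ?v @ drop j (drop i w)" by (simp only: append_take_drop_id)
  moreover have "length ?v \<le> 2 * L" using ij by simp
  ultimately show ?thesis using that v' by blast
qed

text \<open>Dehn's algorithm: each shortcut lowers the length and changes the exponent by one of
  finitely many values, because both words involved have at most \<open>2 * L\<close>
  letters.\<close>

lemma isoperimetric_loop:
  "\<exists>K\<ge>0. \<forall>w n. set w \<subseteq> F.letters \<longrightarrow> lw w = zp n \<longrightarrow> \<bar>n\<bar> \<le> K * int (length w)"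
proof -
  define L where "L = nat \<lceil>2 * \<delta> + 1\<rceil>"
  have L: "real L > 2 * \<delta>" unfolding L_def by linarith
  define W where "W = {w. set w \<subseteq> F.letters \<and> length w \<le> 2 * L}"
  have finW: "finite W" unfolding W_def using F.finite_letters by (rule finite_lists_length_le)
  \<comment> \<open>For words with different values in \<open>F\<close> this may be an arbitrary
    integer, which can only enlarge the maximum below.\<close>
  define c where "c v v' = (SOME n. lw v = lw v' \<otimes>\<^bsub>G\<^esub> zp n)" for v v'
  have c: "lw v = lw v' \<otimes>\<^bsub>G\<^esub> zp (c v v')"
    if "set v \<subseteq> F.letters" "set v' \<subseteq> F.letters" "F.ev v' = F.ev v" for v v'
  proof -
    have "\<exists>n. lw v = lw v' \<otimes>\<^bsub>G\<^esub> zp n"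
      using eq_zp[of "lw v" "lw v'"] that by (metis \<pi>_lw lw_closed)
    then show ?thesis unfolding c_def by (rule someI_ex)
  qed
  define K where "K = Max (insert 0 ((\<lambda>(v, v'). \<bar>c v v'\<bar>) ` (W \<times> W)))"
  have K0: "0 \<le> K" unfolding K_def using finW by auto
  have K: "\<bar>c v v'\<bar> \<le> K" if "v \<in> W" "v' \<in> W" for v v'
    unfolding K_def by (rule Max_ge) (use finW that in auto)
  have "\<bar>n\<bar> \<le> K * int (length w)" if "set w \<subseteq> F.letters" "lw w = zp n" for w n
    using that
  proof (induction w arbitrary: n rule: length_induct)
    case (1 w)
    show ?case
    proof (cases "w = []")
      case True
      then have "zp 0 = zp n" using 1 by simp
      then have "n = 0" by (simp only: zp_eq_iff)
      then show ?thesis using True by simp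
    next
      case False
      have "F.ev w = \<one>\<^bsub>F\<^esub>" using \<pi>_lw[of w] 1 by simp
      then obtain u v t v' where uvt: "w = u @ v @ t" "set v' \<subseteq> F.letters" "F.ev v' = F.ev v"
        "length v' < length v" "length v \<le> 2 * L"
        using loop_shortcut[OF L 1(2) _ False] by metis
      then have sub: "set u \<subseteq> F.letters" "set v \<subseteq> F.letters" "set t \<subseteq> F.letters" using 1 by auto
      let ?w = "u @ v' @ t"
      have cl: "lw u \<in> carrier G" "lw v' \<in> carrier G" "lw t \<in> carrier G"
        using sub uvt by (auto simp: lw_closed)
      have "lw w = lw u \<otimes>\<^bsub>G\<^esub> (lw v' \<otimes>\<^bsub>G\<^esub> zp (c v v') \<otimes>\<^bsub>G\<^esub> lw t)"
        using sub uvt c[of v v'] by (simp add: lw_append)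
      also have "\<dots> = lw ?w \<otimes>\<^bsub>G\<^esub> zp (c v v')"
        using sub uvt cl zp_central[of "lw t"] by (simp add: lw_append G.m_assoc)
      finally have "lw ?w \<otimes>\<^bsub>G\<^esub> zp (c v v') = zp n" using 1 by simp
      moreover have "lw ?w \<in> carrier G" using sub uvt by (simp add: lw_closed)
      ultimately have "lw ?w = zp n \<otimes>\<^bsub>G\<^esub> zp (- c v v')"
        by (metis G.inv_solve_right zp_closed zp_minus)
      then have "lw ?w = zp (n - c v v')" using zp_add[of n "- c v v'"] by simp
      then have "\<bar>n - c v v'\<bar> \<le> K * int (length ?w)"
        using 1(1) uvt sub by (metis add_less_cancel_left add_less_cancel_right le_sup_iff length_append set_append)
      moreover have "\<bar>c v v'\<bar> \<le> K" using K[of v v'] uvt sub by (simp add: W_def)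
      moreover have "K * int (length ?w) \<le> K * (int (length w) - 1)"
        using uvt K0 by (intro mult_left_mono) auto
      ultimately show ?thesis by (simp add: algebra_simps)
    qed
  qed
  then show ?thesis using K0 by blast
qed

text \<open>Both words are closed up with the formal inverse of \<open>v\<close>. As lifting does
  not commute with inversion, \<open>v\<close> followed by its formal inverse lifts to a power of
  \<open>z\<close> that has to be estimated as well, whence the factor 3. The added 1 makes the
  constant positive, so that it can be cancelled later.\<close>

lemma isoperimetric:
  "\<exists>K\<ge>1. \<forall>u v n. set u \<subseteq> F.letters \<longrightarrow> set v \<subseteq> F.letters \<longrightarrow> lw u = lw v \<otimes>\<^bsub>G\<^esub> zp n \<longrightarrow>
    \<bar>n\<bar> \<le> K * (int (length u) + int (length v))"
proof -
  obtain K where K: "K \<ge> 0" "\<And>w n. \<lbrakk>set w \<subseteq> F.letters; lw w = zp n\<rbrakk> \<Longrightarrow> \<bar>n\<bar> \<le> K * int (length w)"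
    using isoperimetric_loop by blast
  show ?thesis
  proof (intro exI[of _ "3 * K + 1"] conjI allI impI)
    fix u v n
    assume u: "set u \<subseteq> F.letters" and v: "set v \<subseteq> F.letters" and uv: "lw u = lw v \<otimes>\<^bsub>G\<^esub> zp n"
    let ?t = "F.inv_word v"
    have t: "set ?t \<subseteq> F.letters" using v by (rule F.set_inv_word)
    have cl: "lw u \<in> carrier G" "lw v \<in> carrier G" "lw ?t \<in> carrier G"
      using u v t by (auto simp: lw_closed)
    have "\<pi> (lw (v @ ?t)) = \<pi> \<one>\<^bsub>G\<^esub>"
      using v t by (simp add: lw_append lw_closed \<pi>_lw F.ev_inv_word F.ev_closed)
    then obtain b where b: "lw (v @ ?t) = zp b"
      using eq_zp[of "lw (v @ ?t)" "\<one>\<^bsub>G\<^esub>"] v t by (metis G.l_one G.one_closed lw_closed le_sup_iff set_append zp_closed)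
    have "lw (u @ ?t) = lw (v @ ?t) \<otimes>\<^bsub>G\<^esub> zp n"
      using u v t uv cl zp_central[of "lw ?t"] by (simp add: lw_append G.m_assoc)
    then have "lw (u @ ?t) = zp (b + n)" using b by (simp add: zp_add)
    then have "\<bar>b + n\<bar> \<le> K * int (length (u @ ?t))" using K(2)[of "u @ ?t" "b + n"] u t by simp
    moreover have "\<bar>b\<bar> \<le> K * int (length (v @ ?t))" using K(2)[OF _ b] v t by simp
    ultimately have "\<bar>n\<bar> \<le> K * int (length u) + 3 * (K * int (length v))"
      by (simp add: algebra_simps)
    moreover have "0 \<le> K * int (length u)" using K(1) by simp
    ultimately show "\<bar>n\<bar> \<le> (3 * K + 1) * (int (length u) + int (length v))"
      by (simp add: algebra_simps)
  qed (use K in auto)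
qed

definition K :: int where
  "K = (SOME K. K \<ge> 1 \<and> (\<forall>u v n. set u \<subseteq> F.letters \<longrightarrow> set v \<subseteq> F.letters \<longrightarrow>
      lw u = lw v \<otimes>\<^bsub>G\<^esub> zp n \<longrightarrow> \<bar>n\<bar> \<le> K * (int (length u) + int (length v))))"

lemma K: "K \<ge> 1"
  "\<lbrakk>set u \<subseteq> F.letters; set v \<subseteq> F.letters; lw u = lw v \<otimes>\<^bsub>G\<^esub> zp n\<rbrakk> \<Longrightarrow>
    \<bar>n\<bar> \<le> K * (int (length u) + int (length v))"
  using someI_ex[OF isoperimetric, folded K_def] by blast+

section \<open>Weighted lengths of elements of the extension\<close>

definition rep :: "'f list \<Rightarrow> int \<Rightarrow> 'g \<Rightarrow> bool" where
  "rep w n g \<longleftrightarrow> set w \<subseteq> F.letters \<and> lw w \<otimes>\<^bsub>G\<^esub> zp n = g"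

lemma rep_closed: "rep w n g \<Longrightarrow> g \<in> carrier G"
  and rep_\<pi>: "rep w n g \<Longrightarrow> \<pi> g = F.ev w"
  by (auto simp: rep_def lw_closed \<pi>_lw F.ev_closed)

lemma rep_mult: "\<lbrakk>rep u m g; rep v n h\<rbrakk> \<Longrightarrow> rep (u @ v) (m + n) (g \<otimes>\<^bsub>G\<^esub> h)"
proof -
  assume r: "rep u m g" "rep v n h"
  then have cl: "lw u \<in> carrier G" "lw v \<in> carrier G" by (auto simp: rep_def lw_closed)
  then have "lw u \<otimes>\<^bsub>G\<^esub> zp m \<otimes>\<^bsub>G\<^esub> (lw v \<otimes>\<^bsub>G\<^esub> zp n) = lw u \<otimes>\<^bsub>G\<^esub> (zp m \<otimes>\<^bsub>G\<^esub> lw v) \<otimes>\<^bsub>G\<^esub> zp n"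
    by (simp add: G.m_assoc)
  also have "\<dots> = lw u \<otimes>\<^bsub>G\<^esub> lw v \<otimes>\<^bsub>G\<^esub> zp (m + n)"
    using cl by (simp add: zp_central[OF cl(2)] zp_add G.m_assoc)
  finally show ?thesis using r by (simp add: rep_def lw_append)
qed

lemma rep_zp: "rep w n g \<Longrightarrow> rep w (n + m) (g \<otimes>\<^bsub>G\<^esub> zp m)"
  using rep_mult[of w n g "[]" m "zp m"] by (simp add: rep_def)

lemma ex_rep:
  assumes "g \<in> carrier G"
  obtains w n where "rep w n g"
proof -
  have "\<pi> g \<in> carrier F" using assms by simp
  then obtain w where w: "set w \<subseteq> F.letters" "F.ev w = \<pi> g" by (metis F.geodesic_word)
  then obtain n where "g = lw w \<otimes>\<^bsub>G\<^esub> zp n"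
    using eq_zp[OF assms lw_closed] by (metis \<pi>_lw)
  then show ?thesis using w that by (simp add: rep_def)
qed

lemma rep_bound:
  assumes "rep u m g" "rep v n g"
  shows "\<bar>n - m\<bar> \<le> K * (int (length u) + int (length v))"
proof -
  have uv: "set u \<subseteq> F.letters" "set v \<subseteq> F.letters" "lw u \<otimes>\<^bsub>G\<^esub> zp m = lw v \<otimes>\<^bsub>G\<^esub> zp n"
    using assms by (auto simp: rep_def)
  then have "lw u = lw v \<otimes>\<^bsub>G\<^esub> zp n \<otimes>\<^bsub>G\<^esub> zp (- m)"
    by (metis G.inv_solve_right lw_closed zp_closed zp_minus G.m_closed)
  also have "\<dots> = lw v \<otimes>\<^bsub>G\<^esub> zp (n - m)"
    using uv zp_add[of n "- m"] by (simp add: G.m_assoc lw_closed)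
  finally show ?thesis using K(2) uv by blast
qed

text \<open>Compared with a fixed representation, the exponent can drop by at most
  \<open>K * length w\<close> plus a constant, and the weight outgrows this. So all costs are at
  least \<open>B\<close>, and subtracting \<open>B\<close> makes them natural numbers.\<close>

lemma ex_min_rep:
  assumes "g \<in> carrier G"
  shows "\<exists>w n. rep w n g \<and> (\<forall>w' n'. rep w' n' g \<longrightarrow> 2 * K * int (length w) + n \<le> 2 * K * int (length w') + n')"
proof -
  obtain w0 n0 where 0: "rep w0 n0 g" using ex_rep[OF assms] .
  define B where "B = n0 - K * int (length w0)"
  have B: "B \<le> 2 * K * int (length w) + n" if "rep w n g" for w n
  proof -
    have "\<bar>n0 - n\<bar> \<le> K * int (length w) + K * int (length w0)"
      using rep_bound[OF that 0] by (simp add: algebra_simps)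
    moreover have "0 \<le> K * int (length w)" using K(1) by simp
    ultimately show ?thesis unfolding B_def by (simp add: algebra_simps)
  qed
  let ?f = "\<lambda>(w, n). nat (2 * K * int (length w) + n - B)"
  obtain p where p: "(\<lambda>(w, n). rep w n g) p" "\<And>y. (\<lambda>(w, n). rep w n g) y \<Longrightarrow> ?f p \<le> ?f y"
    using ex_has_least_nat[of "\<lambda>(w, n). rep w n g" "(w0, n0)" ?f] 0 by auto
  obtain w n where wn: "p = (w, n)" by fastforce
  show ?thesis
  proof (intro exI conjI allI impI)
    show "rep w n g" using p wn by simp
    fix w' n' assume r: "rep w' n' g"
    show "2 * K * int (length w) + n \<le> 2 * K * int (length w') + n'"
      using p(2)[of "(w', n')"] r wn B[OF r] by simp
  qed
qed

text \<open>Because of the isoperimetric inequality the weight \<open>2 * K\<close> makes length expensive enough for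
  the minimum to exist and for minimising words to project to quasigeodesics.\<close>

definition q :: "'g \<Rightarrow> int" where
  "q g = (THE c. (\<exists>w n. rep w n g \<and> c = 2 * K * int (length w) + n) \<and>
    (\<forall>w n. rep w n g \<longrightarrow> c \<le> 2 * K * int (length w) + n))"

lemma q_props:
  assumes "g \<in> carrier G"
  shows "(\<exists>w n. rep w n g \<and> q g = 2 * K * int (length w) + n) \<and>
    (\<forall>w n. rep w n g \<longrightarrow> q g \<le> 2 * K * int (length w) + n)"
proof -
  obtain w n where "rep w n g" "\<And>w' n'. rep w' n' g \<Longrightarrow> 2 * K * int (length w) + n \<le> 2 * K * int (length w') + n'"
    using ex_min_rep[OF assms] by blast
  then have "\<exists>!c. (\<exists>w n. rep w n g \<and> c = 2 * K * int (length w) + n) \<and>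
      (\<forall>w n. rep w n g \<longrightarrow> c \<le> 2 * K * int (length w) + n)"
    by (intro ex1I[of _ "2 * K * int (length w) + n"]) (auto intro: order_antisym)
  then show ?thesis unfolding q_def by (rule theI')
qed

lemma q_le: "rep w n g \<Longrightarrow> q g \<le> 2 * K * int (length w) + n"
  using q_props rep_closed by blast

lemma q_attained:
  assumes "g \<in> carrier G"
  obtains w n where "rep w n g" "q g = 2 * K * int (length w) + n"
  using q_props[OF assms] by blast

lemma q_mult: "\<lbrakk>g \<in> carrier G; h \<in> carrier G\<rbrakk> \<Longrightarrow> q (g \<otimes>\<^bsub>G\<^esub> h) \<le> q g + q h"
proof -
  assume "g \<in> carrier G" "h \<in> carrier G"
  then obtain u m v n where "rep u m g" "q g = 2 * K * int (length u) + m"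
    "rep v n h" "q h = 2 * K * int (length v) + n"
    by (metis q_attained)
  then show ?thesis using q_le[OF rep_mult, of u m g v n h] by (simp add: algebra_simps)
qed

lemma q_zp_le: "g \<in> carrier G \<Longrightarrow> q (g \<otimes>\<^bsub>G\<^esub> zp m) \<le> q g + m"
proof -
  assume "g \<in> carrier G"
  then obtain w n where "rep w n g" "q g = 2 * K * int (length w) + n" by (rule q_attained)
  then show ?thesis using q_le[OF rep_zp, of w n g m] by simp
qed

lemma q_zp: "g \<in> carrier G \<Longrightarrow> q (g \<otimes>\<^bsub>G\<^esub> zp m) = q g + m"
  using q_zp_le[of g m] q_zp_le[of "g \<otimes>\<^bsub>G\<^esub> zp m" "- m"] zp_add[of m "- m", symmetric]
  by (simp add: G.m_assoc)

text \<open>Replacing \<open>v\<close> by a geodesic word \<open>v'\<close> saves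
  \<open>2 * K * (length v - length v')\<close> and changes the exponent by at most
  \<open>K * (length v + length v')\<close>; minimality leaves
  \<open>length v \<le> 3 * length v'\<close>. A weight of \<open>K\<close> would still bound the
  costs from below, but here it would yield nothing.\<close>

lemma min_rep_quasigeodesic:
  assumes r: "rep (u @ v @ t) n g" and min: "q g = 2 * K * int (length (u @ v @ t)) + n"
  shows "length v \<le> 3 * F.wl (F.ev v)"
proof -
  have sub: "set u \<subseteq> F.letters" "set v \<subseteq> F.letters" "set t \<subseteq> F.letters"
    using r by (auto simp: rep_def)
  obtain v' where v': "set v' \<subseteq> F.letters" "F.ev v' = F.ev v" "length v' = F.wl (F.ev v)"
    using F.geodesic_word[OF F.ev_closed[OF sub(2)]] by blast
  have cl: "lw u \<in> carrier G" "lw v' \<in> carrier G" "lw t \<in> carrier G" using sub v' by (auto simp: lw_closed)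
  obtain m where m: "lw v = lw v' \<otimes>\<^bsub>G\<^esub> zp m"
    using eq_zp[of "lw v" "lw v'"] v' sub by (metis \<pi>_lw lw_closed)
  have "g = lw u \<otimes>\<^bsub>G\<^esub> (lw v' \<otimes>\<^bsub>G\<^esub> zp m \<otimes>\<^bsub>G\<^esub> lw t) \<otimes>\<^bsub>G\<^esub> zp n"
    using r sub m by (simp add: rep_def lw_append)
  also have "\<dots> = lw u \<otimes>\<^bsub>G\<^esub> (lw v' \<otimes>\<^bsub>G\<^esub> lw t) \<otimes>\<^bsub>G\<^esub> (zp m \<otimes>\<^bsub>G\<^esub> zp n)"
    using cl zp_central[of "lw t" m] by (simp add: G.m_assoc)
  finally have "rep (u @ v' @ t) (m + n) g"
    using sub v' by (simp add: rep_def lw_append zp_add)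
  from q_le[OF this] have "2 * (K * int (length v)) \<le> 2 * (K * int (length v')) + m"
    using min by (simp add: algebra_simps)
  moreover have "\<bar>m\<bar> \<le> K * int (length v) + K * int (length v')"
    using K(2)[OF sub(2) v'(1) m] by (simp add: algebra_simps)
  ultimately have "K * int (length v) \<le> K * (3 * int (length v'))" by linarith
  then have "int (length v) \<le> 3 * int (length v')" using K(1) by (simp add: mult_le_cancel_left)
  then show ?thesis using v' by linarith
qed

text \<open>A power of \<open>z\<close> shifts the two terms in opposite directions, so their sum
  depends only on \<open>\<pi> g\<close>, and balls in \<open>F\<close> are finite.\<close>

lemma q_inv_bounded: "\<exists>B\<ge>0. \<forall>g\<in>carrier G. F.wl (\<pi> g) \<le> R \<longrightarrow> q g + q (inv\<^bsub>G\<^esub> g) \<le> B"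
proof -
  define N where "N f = q (lift f) + q (inv\<^bsub>G\<^esub> lift f)" for f
  define B where "B = Max (insert 0 (N ` {f \<in> carrier F. F.wl f \<le> R}))"
  have fin: "finite (insert 0 (N ` {f \<in> carrier F. F.wl f \<le> R}))" using F.finite_wl_ball by simp
  have "q g + q (inv\<^bsub>G\<^esub> g) \<le> B" if g: "g \<in> carrier G" "F.wl (\<pi> g) \<le> R" for g
  proof -
    have f: "\<pi> g \<in> carrier F" using g by simp
    note l = lift[OF f]
    obtain m where m: "g = lift (\<pi> g) \<otimes>\<^bsub>G\<^esub> zp m" using eq_zp[OF g(1) l(1)] l by metis
    have "inv\<^bsub>G\<^esub> (lift (\<pi> g) \<otimes>\<^bsub>G\<^esub> zp m) = inv\<^bsub>G\<^esub> lift (\<pi> g) \<otimes>\<^bsub>G\<^esub> zp (- m)"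
      using l zp_central[of "inv\<^bsub>G\<^esub> lift (\<pi> g)" "- m"] by (simp add: G.inv_mult_group zp_minus)
    then have "q (inv\<^bsub>G\<^esub> g) = q (inv\<^bsub>G\<^esub> lift (\<pi> g)) - m" using q_zp[of "inv\<^bsub>G\<^esub> lift (\<pi> g)" "- m"] l m by simp
    moreover have "q g = q (lift (\<pi> g)) + m" using q_zp[OF l(1), of m] m by simp
    ultimately have "q g + q (inv\<^bsub>G\<^esub> g) = N (\<pi> g)" by (simp add: N_def)
    also have "\<dots> \<le> B" unfolding B_def by (rule Max_ge[OF fin]) (use g f in auto)
    finally show ?thesis .
  qed
  moreover have "0 \<le> B" unfolding B_def by (rule Max_ge[OF fin]) auto
  ultimately show ?thesis by blast
qed

lemma wd_\<pi>: "\<lbrakk>a \<in> carrier G; b \<in> carrier G\<rbrakk> \<Longrightarrow> F.wd (\<pi> a) (\<pi> b) = F.wl (\<pi> (inv\<^bsub>G\<^esub> a \<otimes>\<^bsub>G\<^esub> b))"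
  by (simp add: F.wd_def)

text \<open>A cost-minimising word for \<open>g\<close> is a quasigeodesic in \<open>F\<close>, and
  \<open>\<pi> f\<close> is almost on a geodesic with the same endpoints, so the word passes near
  \<open>\<pi> f\<close>. Cutting it there divides its cost between the pieces, and moving the cut
  point to \<open>f\<close> changes the costs by a bounded amount.\<close>

lemma q_almost_additive:
  fixes c :: nat
  shows "\<exists>B\<ge>0. \<forall>g\<in>carrier G. \<forall>f\<in>carrier G.
    F.wl (\<pi> f) + F.wl (\<pi> (inv\<^bsub>G\<^esub> f \<otimes>\<^bsub>G\<^esub> g)) \<le> F.wl (\<pi> g) + c \<longrightarrow> q f + q (inv\<^bsub>G\<^esub> f \<otimes>\<^bsub>G\<^esub> g) \<le> q g + B"
proof -
  \<comment> \<open>The factor 3 is the quasigeodesic constant of cost-minimising words.\<close>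
  have "\<exists>R. \<forall>n x p. (\<forall>i\<le>n. x i \<in> carrier F) \<and> (\<forall>i<n. F.wd (x i) (x (Suc i)) \<le> 1) \<and>
    (\<forall>i j. i \<le> j \<and> j \<le> n \<longrightarrow> real (j - i) \<le> 3 * real (F.wd (x i) (x j))) \<and>
    p \<in> carrier F \<and> F.wd (x 0) p + F.wd p (x n) \<le> F.wd (x 0) (x n) + c \<longrightarrow> (\<exists>i\<le>n. F.wd (x i) p \<le> R)"
    by (rule F.quasigeodesic_stability[OF hyperbolic']) simp
  then obtain R where R: "\<forall>n x p. (\<forall>i\<le>n. x i \<in> carrier F) \<and> (\<forall>i<n. F.wd (x i) (x (Suc i)) \<le> 1) \<and>
    (\<forall>i j. i \<le> j \<and> j \<le> n \<longrightarrow> real (j - i) \<le> 3 * real (F.wd (x i) (x j))) \<and>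
    p \<in> carrier F \<and> F.wd (x 0) p + F.wd p (x n) \<le> F.wd (x 0) (x n) + c \<longrightarrow> (\<exists>i\<le>n. F.wd (x i) p \<le> R)" ..
  obtain B where B: "B \<ge> 0" "\<And>g. \<lbrakk>g \<in> carrier G; F.wl (\<pi> g) \<le> R\<rbrakk> \<Longrightarrow> q g + q (inv\<^bsub>G\<^esub> g) \<le> B"
    using q_inv_bounded by blast
  show ?thesis
  proof (intro exI[of _ B] conjI ballI impI)
    fix g f
    assume g: "g \<in> carrier G" and f: "f \<in> carrier G"
      and near: "F.wl (\<pi> f) + F.wl (\<pi> (inv\<^bsub>G\<^esub> f \<otimes>\<^bsub>G\<^esub> g)) \<le> F.wl (\<pi> g) + c"
    obtain w n where w: "rep w n g" "q g = 2 * K * int (length w) + n" using q_attained[OF g] .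
    have ww: "set w \<subseteq> F.letters" using w by (simp add: rep_def)
    define x where "x i = F.ev (take i w)" for i
    have sub: "set (take i w) \<subseteq> F.letters" "set (drop i w) \<subseteq> F.letters" "set (take j (drop i w)) \<subseteq> F.letters" for i j
      using ww by (auto dest!: in_set_takeD in_set_dropD)
    have x: "x i \<in> carrier F" for i using sub by (simp add: x_def F.ev_closed)
    have x_add: "x (i + j) = x i \<otimes>\<^bsub>F\<^esub> F.ev (take j (drop i w))" for i j
      unfolding x_def take_add using sub by (simp add: F.ev_append)
    have wd_x: "F.wd (x i) (x (i + j)) = F.wl (F.ev (take j (drop i w)))" for i j
      using x sub by (simp add: F.wd_def x_add F.ev_closed F.m_assoc[symmetric])
    have x0: "x 0 = \<one>\<^bsub>F\<^esub>" and xn: "x (length w) = \<pi> g"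
      using rep_\<pi>[OF w(1)] by (simp_all add: x_def)
    have "\<exists>i\<le>length w. F.wd (x i) (\<pi> f) \<le> R"
    proof (rule R[THEN spec, THEN spec, THEN spec, THEN mp], intro conjI)
      show "\<forall>i<length w. F.wd (x i) (x (Suc i)) \<le> 1"
        using F.wd_ev[OF x sub(3), of _ 1] x_add[of _ 1] by (metis One_nat_def Suc_eq_plus1 add.commute length_take min.cobounded2 order_trans plus_1_eq_Suc)
      show "\<forall>i j. i \<le> j \<and> j \<le> length w \<longrightarrow> real (j - i) \<le> 3 * real (F.wd (x i) (x j))"
      proof (intro allI impI, elim conjE)
        fix i j assume ij: "i \<le> j" "j \<le> length w"
        let ?v = "take (j - i) (drop i w)"
        have split: "w = take i w @ ?v @ drop (j - i) (drop i w)"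
          by (simp only: append_take_drop_id)
        have "length ?v \<le> 3 * F.wl (F.ev ?v)"
          by (rule min_rep_quasigeodesic[of "take i w" _ "drop (j - i) (drop i w)" n g])
            (use w split in \<open>metis+\<close>)
        then show "real (j - i) \<le> 3 * real (F.wd (x i) (x j))"
          using wd_x[of i "j - i"] ij by simp
      qed
      show "F.wd (x 0) (\<pi> f) + F.wd (\<pi> f) (x (length w)) \<le> F.wd (x 0) (x (length w)) + c"
        using near g f by (simp add: x0 xn F.wd_def)
    qed (use x f in auto)
    then obtain i where i: "i \<le> length w" "F.wd (x i) (\<pi> f) \<le> R" by blast
    define u h where "u = lw (take i w)" and "h = lw (drop i w) \<otimes>\<^bsub>G\<^esub> zp n"
    have uh: "u \<in> carrier G" "h \<in> carrier G" using sub by (auto simp: u_def h_def lw_closed)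
    have "lw w = u \<otimes>\<^bsub>G\<^esub> lw (drop i w)" using sub lw_append[of "take i w" "drop i w"] by (simp add: u_def)
    then have guh: "g = u \<otimes>\<^bsub>G\<^esub> h" using w uh sub by (simp add: rep_def h_def G.m_assoc lw_closed)
    \<comment> \<open>The whole power of \<open>z\<close> goes to the second piece.\<close>
    have "rep (take i w) 0 u" "rep (drop i w) n h"
      using sub by (auto simp: rep_def u_def h_def lw_closed)
    then have "q u \<le> 2 * K * int (length (take i w))" "q h \<le> 2 * K * int (length (drop i w)) + n"
      using q_le by fastforce+
    moreover have "int (length w) = int (length (take i w)) + int (length (drop i w))" using i by simp
    ultimately have split: "q u + q h \<le> q g" using w(2) by (simp only: algebra_simps)
    \<comment> \<open>\<open>e\<close> leads from \<open>f\<close> to the cut point and projects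
      into the ball of radius \<open>R\<close>. It enters one estimate directly and the other
      inverted, so only \<open>q e + q (inv e)\<close> has to be bounded, not the two terms
      separately.\<close>
    define e where "e = inv\<^bsub>G\<^esub> f \<otimes>\<^bsub>G\<^esub> u"
    have e: "e \<in> carrier G" using f uh by (simp add: e_def)
    have "F.wd (\<pi> f) (x i) = F.wl (\<pi> e)"
      using f uh sub by (simp add: F.wd_def e_def u_def x_def \<pi>_lw)
    then have "q e + q (inv\<^bsub>G\<^esub> e) \<le> B" using B(2)[OF e] i f x F.d_commute[of "\<pi> f" "x i"] by simp
    moreover have "q f \<le> q u + q (inv\<^bsub>G\<^esub> e)"
    proof -
      have "f = u \<otimes>\<^bsub>G\<^esub> inv\<^bsub>G\<^esub> e" using f uh by (simp add: e_def G.inv_mult_group G.m_assoc[symmetric])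
      then show ?thesis using q_mult[OF uh(1), of "inv\<^bsub>G\<^esub> e"] e by simp
    qed
    moreover have "q (inv\<^bsub>G\<^esub> f \<otimes>\<^bsub>G\<^esub> g) \<le> q e + q h"
      using q_mult[OF e uh(2)] f uh by (simp add: e_def guh G.m_assoc)
    ultimately show "q f + q (inv\<^bsub>G\<^esub> f \<otimes>\<^bsub>G\<^esub> g) \<le> q g + B" using split by linarith
  qed (rule B)
qed

text \<open>For the two sides of a triangle that share a half-side from a vertex to the centre, the
  contributions of this half-side cancel in \<open>Q\<close> up to a bounded error.\<close>

definition Q :: "'g \<Rightarrow> int" where "Q g = q g - q (inv\<^bsub>G\<^esub> g)"

lemma Q_inv: "g \<in> carrier G \<Longrightarrow> Q (inv\<^bsub>G\<^esub> g) = - Q g"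
  by (simp add: Q_def)

lemma Q_zp: "g \<in> carrier G \<Longrightarrow> Q (g \<otimes>\<^bsub>G\<^esub> zp m) = Q g + 2 * m"
proof -
  assume g: "g \<in> carrier G"
  then have "inv\<^bsub>G\<^esub> (g \<otimes>\<^bsub>G\<^esub> zp m) = inv\<^bsub>G\<^esub> g \<otimes>\<^bsub>G\<^esub> zp (- m)"
    using zp_central[of "inv\<^bsub>G\<^esub> g" "- m"] by (simp add: G.inv_mult_group zp_minus)
  then show ?thesis using g q_zp[of g m] q_zp[of "inv\<^bsub>G\<^esub> g" "- m"] by (simp add: Q_def)
qed

lemma Q_quasimorphism:
  "\<exists>D\<ge>0. \<forall>g\<in>carrier G. \<forall>h\<in>carrier G. \<bar>Q (g \<otimes>\<^bsub>G\<^esub> h) - Q g - Q h\<bar> \<le> D"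
proof -
  define c where "c = nat \<lceil>2 * \<delta> + 2\<rceil>"
  obtain B where B: "B \<ge> 0" and add: "\<And>f g. \<lbrakk>g \<in> carrier G; f \<in> carrier G;
      F.wl (\<pi> f) + F.wl (\<pi> (inv\<^bsub>G\<^esub> f \<otimes>\<^bsub>G\<^esub> g)) \<le> F.wl (\<pi> g) + c\<rbrakk> \<Longrightarrow> q f + q (inv\<^bsub>G\<^esub> f \<otimes>\<^bsub>G\<^esub> g) \<le> q g + B"
    using q_almost_additive[of c] by blast
  \<comment> \<open>A left-invariant directed cost from \<open>a\<close> to \<open>b\<close>. The
    defect of \<open>Q\<close> is the difference between the costs of traversing a triangle in its
    two directions.\<close>
  define E where "E a b = q (inv\<^bsub>G\<^esub> a \<otimes>\<^bsub>G\<^esub> b)" for a b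
  have cancel: "inv\<^bsub>G\<^esub> (inv\<^bsub>G\<^esub> a \<otimes>\<^bsub>G\<^esub> p) \<otimes>\<^bsub>G\<^esub> (inv\<^bsub>G\<^esub> a \<otimes>\<^bsub>G\<^esub> b) = inv\<^bsub>G\<^esub> p \<otimes>\<^bsub>G\<^esub> b"
      "(inv\<^bsub>G\<^esub> a \<otimes>\<^bsub>G\<^esub> p) \<otimes>\<^bsub>G\<^esub> (inv\<^bsub>G\<^esub> p \<otimes>\<^bsub>G\<^esub> b) = inv\<^bsub>G\<^esub> a \<otimes>\<^bsub>G\<^esub> b"
    if "a \<in> carrier G" "b \<in> carrier G" "p \<in> carrier G" for a b p
  proof -
    have "a \<otimes>\<^bsub>G\<^esub> (inv\<^bsub>G\<^esub> a \<otimes>\<^bsub>G\<^esub> b) = b" "p \<otimes>\<^bsub>G\<^esub> (inv\<^bsub>G\<^esub> p \<otimes>\<^bsub>G\<^esub> b) = b"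
      using that by (simp_all add: G.m_assoc[symmetric])
    then show "inv\<^bsub>G\<^esub> (inv\<^bsub>G\<^esub> a \<otimes>\<^bsub>G\<^esub> p) \<otimes>\<^bsub>G\<^esub> (inv\<^bsub>G\<^esub> a \<otimes>\<^bsub>G\<^esub> b) = inv\<^bsub>G\<^esub> p \<otimes>\<^bsub>G\<^esub> b"
      "(inv\<^bsub>G\<^esub> a \<otimes>\<^bsub>G\<^esub> p) \<otimes>\<^bsub>G\<^esub> (inv\<^bsub>G\<^esub> p \<otimes>\<^bsub>G\<^esub> b) = inv\<^bsub>G\<^esub> a \<otimes>\<^bsub>G\<^esub> b"
      using that by (simp_all add: G.inv_mult_group G.m_assoc)
  qed
  have up: "E a b \<le> E a p + E p b" if "a \<in> carrier G" "b \<in> carrier G" "p \<in> carrier G" for a b p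
    unfolding E_def using q_mult[of "inv\<^bsub>G\<^esub> a \<otimes>\<^bsub>G\<^esub> p" "inv\<^bsub>G\<^esub> p \<otimes>\<^bsub>G\<^esub> b"] that cancel(2)[OF that] by simp
  have down: "E a p + E p b \<le> E a b + B"
    if "a \<in> carrier G" "b \<in> carrier G" "p \<in> carrier G"
      "F.wd (\<pi> a) (\<pi> p) + F.wd (\<pi> p) (\<pi> b) \<le> F.wd (\<pi> a) (\<pi> b) + c" for a b p
    using add[of "inv\<^bsub>G\<^esub> a \<otimes>\<^bsub>G\<^esub> b" "inv\<^bsub>G\<^esub> a \<otimes>\<^bsub>G\<^esub> p"] that
    unfolding E_def wd_\<pi>[OF that(1,3)] wd_\<pi>[OF that(3,2)] wd_\<pi>[OF that(1,2)] cancel(1)[OF that(1-3)]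
    by (simp only: G.inv_closed G.m_closed)
  \<comment> \<open>Each of the six directed sides costs less than its detour through the centre
    \<open>p\<close>, by between 0 and \<open>B\<close>. The detours cancel, and three of the errors
    enter with each sign, hence \<open>3 * B\<close>.\<close>
  have "\<bar>Q (g \<otimes>\<^bsub>G\<^esub> h) - Q g - Q h\<bar> \<le> 3 * B" if gh: "g \<in> carrier G" "h \<in> carrier G" for g h
  proof -
    define x y k where "x = \<one>\<^bsub>G\<^esub>" and "y = g" and "k = g \<otimes>\<^bsub>G\<^esub> h"
    have cl: "x \<in> carrier G" "y \<in> carrier G" "k \<in> carrier G" using gh by (auto simp: x_def y_def k_def)
    then have \<pi>cl: "\<pi> x \<in> carrier F" "\<pi> y \<in> carrier F" "\<pi> k \<in> carrier F" by auto
    obtain p' where p': "p' \<in> carrier F" "F.wd (\<pi> x) p' + F.wd p' (\<pi> y) = F.wd (\<pi> x) (\<pi> y)"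
      "F.wd (\<pi> x) p' + F.wd p' (\<pi> k) \<le> F.wd (\<pi> x) (\<pi> k) + c"
      "F.wd (\<pi> y) p' + F.wd p' (\<pi> k) \<le> F.wd (\<pi> y) (\<pi> k) + c"
      unfolding c_def by (rule F.triangle_centre[OF hyperbolic' \<pi>cl])
    define p where "p = lift p'"
    have p: "p \<in> carrier G" "\<pi> p = p'" using lift[OF p'(1)] by (auto simp: p_def)
    note com = F.d_commute[OF p'(1)] F.d_commute[OF \<pi>cl(2,1)] F.d_commute[OF \<pi>cl(3,1)] F.d_commute[OF \<pi>cl(3,2)]
    have "E x p + E p y \<le> E x y + B" "E y p + E p x \<le> E y x + B" "E x p + E p k \<le> E x k + B"
      "E k p + E p x \<le> E k x + B" "E y p + E p k \<le> E y k + B" "E k p + E p y \<le> E k y + B"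
      by (rule down; use cl p p' \<pi>cl com in auto)+
    moreover have "E x y \<le> E x p + E p y" "E y x \<le> E y p + E p x" "E x k \<le> E x p + E p k"
      "E k x \<le> E k p + E p x" "E y k \<le> E y p + E p k" "E k y \<le> E k p + E p y"
      using up cl p by auto
    moreover have "Q g = E x y - E y x" "Q (g \<otimes>\<^bsub>G\<^esub> h) = E x k - E k x" "Q h = E y k - E k y"
      using gh by (auto simp: Q_def E_def x_def y_def k_def G.inv_mult_group G.m_assoc[symmetric])
        (simp add: G.m_assoc)
    ultimately show ?thesis by linarith
  qed
  then show ?thesis using B by (intro exI[of _ "3 * B"]) auto
qed

text \<open>Over each of the finitely many values of \<open>\<pi> g\<close> the candidates differ by
  powers of \<open>z\<close>, and each power shifts \<open>Q\<close> by 2. This is the properness of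
  the pair of coordinates.\<close>

lemma finite_Q_ball: "finite {g \<in> carrier G. F.wl (\<pi> g) \<le> k \<and> \<bar>Q g\<bar> \<le> l}"
proof (rule finite_subset)
  let ?M = "\<lambda>f. {- l - \<bar>Q (lift f)\<bar> .. l + \<bar>Q (lift f)\<bar>}"
  show "finite (\<Union>f\<in>{f \<in> carrier F. F.wl f \<le> k}. (\<lambda>m. lift f \<otimes>\<^bsub>G\<^esub> zp m) ` ?M f)"
    using F.finite_wl_ball by auto
  show "{g \<in> carrier G. F.wl (\<pi> g) \<le> k \<and> \<bar>Q g\<bar> \<le> l} \<subseteq>
    (\<Union>f\<in>{f \<in> carrier F. F.wl f \<le> k}. (\<lambda>m. lift f \<otimes>\<^bsub>G\<^esub> zp m) ` ?M f)"
  proof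
    fix g assume "g \<in> {g \<in> carrier G. F.wl (\<pi> g) \<le> k \<and> \<bar>Q g\<bar> \<le> l}"
    then have g: "g \<in> carrier G" "F.wl (\<pi> g) \<le> k" "\<bar>Q g\<bar> \<le> l" by auto
    then have f: "\<pi> g \<in> carrier F" by simp
    obtain m where m: "g = lift (\<pi> g) \<otimes>\<^bsub>G\<^esub> zp m" using eq_zp[OF g(1) lift(1)[OF f]] lift(2)[OF f] by metis
    then have "Q g = Q (lift (\<pi> g)) + 2 * m" using Q_zp[OF lift(1)[OF f]] by metis
    then have "m \<in> ?M (\<pi> g)" using g by auto
    then show "g \<in> (\<Union>f\<in>{f \<in> carrier F. F.wl f \<le> k}. (\<lambda>m. lift f \<otimes>\<^bsub>G\<^esub> zp m) ` ?M f)"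
      using m f g by blast
  qed
qed

lemma finite_generating_set_extension: "finite_generating_set G (insert z (lift ` F.letters))"
proof -
  let ?S = "insert z (lift ` F.letters)"
  have S: "?S \<subseteq> carrier G" using z_closed lift(1) F.letters_closed by auto
  interpret gen: subgroup "generate G ?S" G using G.generate_is_subgroup[OF S] .
  have "lw w \<in> generate G ?S" if "set w \<subseteq> F.letters" for w
    using that by (induction w) (auto intro: generate.incl)
  moreover have "zp n \<in> generate G ?S" for n
    unfolding zp_def using G.subgroup_int_pow_closed[OF gen.subgroup_axioms] by (auto intro: generate.incl)
  ultimately have "g \<in> generate G ?S" if "g \<in> carrier G" for g
    using ex_rep[OF that] unfolding rep_def by (metis gen.m_closed)
  then show ?thesis
    using S gen.subset F.finite_letters by (auto simp: finite_generating_set_def)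
qed

end

section \<open>Injective hulls of pseudometric spaces\<close>

locale pseudometric =
  fixes M :: "'a set" and d :: "'a \<Rightarrow> 'a \<Rightarrow> real"
  assumes nonempty: "M \<noteq> {}"
    and self: "x \<in> M \<Longrightarrow> d x x = 0"
    and commute: "\<lbrakk>x \<in> M; y \<in> M\<rbrakk> \<Longrightarrow> d x y = d y x"
    and triangle: "\<lbrakk>x \<in> M; y \<in> M; w \<in> M\<rbrakk> \<Longrightarrow> d x w \<le> d x y + d y w"
begin

lemma nonneg: "\<lbrakk>x \<in> M; y \<in> M\<rbrakk> \<Longrightarrow> 0 \<le> d x y"
  using triangle[of x y x] commute[of x y] self[of x] by simp

definition dominating :: "('a \<Rightarrow> real) set" where
  "dominating = {f \<in> extensional M. \<forall>x\<in>M. \<forall>y\<in>M. d x y \<le> f x + f y}"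

text \<open>Isbell's extremal functions, for which \<open>f x\<close> is the supremum of
  \<open>d x y - f y\<close>. The supremum need not be attained, so the partner \<open>y\<close> of
  \<open>x\<close> is only approximate.\<close>

definition ihull :: "('a \<Rightarrow> real) set" where
  "ihull = {f \<in> dominating. \<forall>x\<in>M. \<forall>e>0. \<exists>y\<in>M. f x + f y < d x y + e}"

text \<open>The value 0 off the hull makes symmetry and nonnegativity hold for arbitrary functions,
  as the locale of metric spaces demands.\<close>

definition hdist :: "('a \<Rightarrow> real) \<Rightarrow> ('a \<Rightarrow> real) \<Rightarrow> real" where
  "hdist f g = (if f \<in> ihull \<and> g \<in> ihull then SUP x\<in>M. \<bar>f x - g x\<bar> else 0)"

definition kuratowski :: "'a \<Rightarrow> 'a \<Rightarrow> real" where
  "kuratowski z = (\<lambda>x\<in>M. d z x)"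

lemma dominatingD: "\<lbrakk>f \<in> dominating; x \<in> M; y \<in> M\<rbrakk> \<Longrightarrow> d x y \<le> f x + f y"
  by (simp add: dominating_def)

lemma dominating_nonneg: "\<lbrakk>f \<in> dominating; x \<in> M\<rbrakk> \<Longrightarrow> 0 \<le> f x"
  using dominatingD[of f x x] by (simp add: self)

lemma hull_dominating: "f \<in> ihull \<Longrightarrow> f \<in> dominating"
  by (simp add: ihull_def)

lemma hull_extremal:
  assumes "f \<in> ihull" "x \<in> M" "0 < e"
  obtains y where "y \<in> M" "f x + f y < d x y + e"
  using assms by (auto simp: ihull_def)

text \<open>An approximate partner of \<open>x\<close> is also a test point for domination at
  \<open>y\<close>.\<close>

lemma hull_le_add:
  assumes f: "f \<in> ihull" and x: "x \<in> M" and y: "y \<in> M"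
  shows "f x \<le> f y + d x y"
proof (rule field_le_epsilon)
  fix e :: real assume "0 < e"
  then obtain w where w: "w \<in> M" "f x + f w < d x w + e" using hull_extremal[OF f x] by blast
  then show "f x \<le> f y + d x y + e"
    using triangle[OF x y w(1)] dominatingD[OF hull_dominating[OF f] y w(1)] by linarith
qed

lemma hull_diff_kuratowski:
  assumes f: "f \<in> ihull" and z: "z \<in> M" and x: "x \<in> M"
  shows "\<bar>f x - d z x\<bar> \<le> f z"
  using hull_le_add[OF f x z] dominatingD[OF hull_dominating[OF f] z x] commute[OF x z] by linarith

lemma kuratowski_hull: "z \<in> M \<Longrightarrow> kuratowski z \<in> ihull"
proof -
  assume z: "z \<in> M"
  have "\<exists>y\<in>M. d z x + d z y < d x y + e" if "x \<in> M" "0 < e" for x e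
    using that z commute[OF z, of x] self[OF z] by (intro bexI[of _ z]) auto
  moreover have "d x y \<le> d z x + d z y" if "x \<in> M" "y \<in> M" for x y
    using triangle[OF that(1) z that(2)] commute[OF z that(1)] by simp
  ultimately show ?thesis using z by (simp add: ihull_def dominating_def kuratowski_def)
qed

lemma hull_diff_bounded:
  assumes "f \<in> ihull" "g \<in> ihull"
  shows "bdd_above ((\<lambda>x. \<bar>f x - g x\<bar>) ` M)"
proof -
  obtain z where z: "z \<in> M" using nonempty by blast
  have "\<bar>f x - g x\<bar> \<le> f z + g z" if "x \<in> M" for x
    using hull_diff_kuratowski[OF assms(1) z that] hull_diff_kuratowski[OF assms(2) z that] by linarith
  then show ?thesis by (intro bdd_aboveI2)
qed

lemma abs_diff_le_hdist: "\<lbrakk>f \<in> ihull; g \<in> ihull; x \<in> M\<rbrakk> \<Longrightarrow> \<bar>f x - g x\<bar> \<le> hdist f g"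
  unfolding hdist_def by (auto intro: cSUP_upper hull_diff_bounded)

lemma hdist_le: "\<lbrakk>f \<in> ihull; g \<in> ihull; \<And>x. x \<in> M \<Longrightarrow> \<bar>f x - g x\<bar> \<le> c\<rbrakk> \<Longrightarrow> hdist f g \<le> c"
  using nonempty by (simp add: hdist_def cSUP_least)

lemma hdist_nonneg: "0 \<le> hdist f g"
proof (cases "f \<in> ihull \<and> g \<in> ihull")
  case True
  obtain z where "z \<in> M" using nonempty by blast
  then show ?thesis using abs_diff_le_hdist[of f g z] True by (meson abs_ge_zero order_trans)
qed (simp only: hdist_def if_False order_refl)

lemma hull_eqI: "\<lbrakk>f \<in> ihull; g \<in> ihull; \<And>x. x \<in> M \<Longrightarrow> f x = g x\<rbrakk> \<Longrightarrow> f = g"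
  by (auto simp: ihull_def dominating_def intro: extensionalityI)

sublocale ihull: Metric_space ihull hdist
proof
  show "0 \<le> hdist f g" for f g by (rule hdist_nonneg)
  show "hdist f g = hdist g f" for f g by (auto simp: hdist_def abs_minus_commute)
  show "hdist f g = 0 \<longleftrightarrow> f = g" if "f \<in> ihull" "g \<in> ihull" for f g
  proof
    assume "hdist f g = 0"
    then have "f x = g x" if "x \<in> M" for x
      using abs_diff_le_hdist[OF \<open>f \<in> ihull\<close> \<open>g \<in> ihull\<close> that] by simp
    then show "f = g" using hull_eqI that by blast
  next
    assume "f = g"
    then have "hdist f g \<le> 0" using that by (intro hdist_le) auto
    then show "hdist f g = 0" using hdist_nonneg[of f g] by linarith
  qed
  show "hdist f h \<le> hdist f g + hdist g h" if fgh: "f \<in> ihull" "g \<in> ihull" "h \<in> ihull" for f g h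
  proof (rule hdist_le)
    fix x assume "x \<in> M"
    then show "\<bar>f x - h x\<bar> \<le> hdist f g + hdist g h"
      using abs_diff_le_hdist[of f g x] abs_diff_le_hdist[of g h x] fgh by linarith
  qed (use fgh in auto)
qed

definition hull_metric :: "('a \<Rightarrow> real) metric" where "hull_metric = metric (ihull, hdist)"

lemma mspace_hull [simp]: "mspace hull_metric = ihull"
  and mdist_hull [simp]: "mdist hull_metric = hdist"
  by (simp_all add: hull_metric_def)

text \<open>The supremum is attained at \<open>z\<close> itself, where the Kuratowski function
  vanishes. Evaluating a hull point thus measures its distance to the embedded points.\<close>

lemma hdist_kuratowski:
  assumes f: "f \<in> ihull" and z: "z \<in> M"
  shows "hdist f (kuratowski z) = f z"
proof (rule order_antisym)
  show "hdist f (kuratowski z) \<le> f z"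
    using hull_diff_kuratowski[OF f z] f z by (intro hdist_le) (auto simp: kuratowski_hull, simp add: kuratowski_def)
  show "f z \<le> hdist f (kuratowski z)"
    using abs_diff_le_hdist[OF f kuratowski_hull[OF z] z] z by (simp add: kuratowski_def self)
qed

lemma hdist_kuratowski2: "\<lbrakk>x \<in> M; y \<in> M\<rbrakk> \<Longrightarrow> hdist (kuratowski x) (kuratowski y) = d x y"
  using hdist_kuratowski[OF kuratowski_hull] by (simp add: kuratowski_def)

text \<open>Where \<open>f\<close> exceeds \<open>g\<close>, an approximate partner \<open>y\<close>
  replaces \<open>f x\<close> by \<open>d x y - f y\<close>, and symmetrically. With the converse
  bound \<open>le_add_hdist\<close>, distances in the hull are expressed through those of
  \<open>M\<close>.\<close>

lemma hdist_approx:
  assumes f: "f \<in> ihull" and g: "g \<in> ihull" and e: "0 < e"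
  obtains x y where "x \<in> M" "y \<in> M" "hdist f g - e < d x y - f x - g y"
proof -
  have "hdist f g - e / 2 < (SUP x\<in>M. \<bar>f x - g x\<bar>)" using f g e by (simp add: hdist_def)
  then obtain x where x: "x \<in> M" "hdist f g - e / 2 < \<bar>f x - g x\<bar>"
    using less_cSUP_iff[OF nonempty hull_diff_bounded[OF f g]] by blast
  have e2: "0 < e / 2" using e by simp
  show ?thesis
  proof (cases "g x \<le> f x")
    case True
    obtain y where y: "y \<in> M" "f x + f y < d x y + e / 2" using hull_extremal[OF f x(1) e2] .
    show ?thesis using that[of y x] x y True commute[of x y] by (simp add: field_simps)
  next
    case False
    obtain y where y: "y \<in> M" "g x + g y < d x y + e / 2" using hull_extremal[OF g x(1) e2] .
    show ?thesis using that[of x y] x y False by (simp add: field_simps)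
  qed
qed

lemma le_add_hdist: "\<lbrakk>f \<in> ihull; g \<in> ihull; x \<in> M; y \<in> M\<rbrakk> \<Longrightarrow> d x y \<le> f x + g y + hdist f g"
  using dominatingD[OF hull_dominating, of f x y] abs_diff_le_hdist[of f g y] by linarith

text \<open>The values of the four functions at the test points occur on both sides and cancel, so
  the four-point inequality of \<open>M\<close> passes over with the same
  \<open>\<delta>\<close>.\<close>

lemma hyperbolic_hull:
  assumes "hyperbolic_on \<delta> M d"
  shows "hyperbolic_on \<delta> ihull hdist"
  unfolding hyperbolic_on_iff
proof (intro ballI)
  fix w x y z assume fs: "w \<in> ihull" "x \<in> ihull" "y \<in> ihull" "z \<in> ihull"
  show "hdist x z + hdist w y \<le> max (hdist x y + hdist w z) (hdist y z + hdist w x) + 2 * \<delta>"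
  proof (rule field_le_epsilon)
    fix e :: real assume "0 < e"
    then have e: "0 < e / 2" by simp
    obtain a b where ab: "a \<in> M" "b \<in> M" "hdist x z - e / 2 < d a b - x a - z b"
      using hdist_approx[OF fs(2,4) e] .
    obtain p q where pq: "p \<in> M" "q \<in> M" "hdist w y - e / 2 < d p q - w p - y q"
      using hdist_approx[OF fs(1,3) e] .
    have "d a b + d p q \<le> max (d a q + d p b) (d q b + d p a) + 2 * \<delta>"
      using assms ab pq unfolding hyperbolic_on_iff by blast
    moreover have "d a q \<le> x a + y q + hdist x y" "d p b \<le> w p + z b + hdist w z"
      "d q b \<le> y q + z b + hdist y z" "d p a \<le> w p + x a + hdist w x"
      using le_add_hdist fs ab pq by auto
    ultimately show "hdist x z + hdist w y \<le> max (hdist x y + hdist w z) (hdist y z + hdist w x) + 2 * \<delta> + e"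
      using ab(3) pq(3) by linarith
  qed
qed

text \<open>By \<open>hdist_kuratowski\<close> it is enough to find a point \<open>p\<close> where
  \<open>f\<close> is small. It is taken on a coarse geodesic between an approximately extremal pair
  \<open>x\<close>, \<open>y\<close>, at distance about \<open>f x\<close> from \<open>x\<close>;
  the four-point condition with an approximate partner of \<open>p\<close> then bounds
  \<open>f p\<close>. The summand 2 collects the slack 1 of each of the two pairs.\<close>

lemma hull_coarsely_dense:
  assumes hyp: "hyperbolic_on \<delta> M d"
    and between: "\<And>x y r. \<lbrakk>x \<in> M; y \<in> M; 0 \<le> r; r \<le> d x y\<rbrakk> \<Longrightarrow> \<exists>p\<in>M. d x p \<le> r + c \<and> d p y \<le> d x y - r + c"
    and f: "f \<in> ihull"
  shows "\<exists>p\<in>M. hdist f (kuratowski p) \<le> 2 * \<delta> + c + 2"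
proof -
  obtain x where x: "x \<in> M" using nonempty by blast
  obtain y where y: "y \<in> M" "f x + f y < d x y + 1" using hull_extremal[OF f x, of 1] by auto
  have f0: "0 \<le> f x" "0 \<le> f y" and fd: "d x y \<le> f x + f y"
    using dominating_nonneg dominatingD hull_dominating[OF f] x y by auto
  obtain p where p: "p \<in> M" "d x p \<le> f x + c" "d p y \<le> f y + c"
  proof (cases "f x \<le> d x y")
    case True
    then obtain p where "p \<in> M" "d x p \<le> f x + c" "d p y \<le> d x y - f x + c"
      using between[OF x y(1) f0(1)] by blast
    then show ?thesis using that[of p] fd by simp
  next
    \<comment> \<open>As the pair is only approximately extremal, \<open>f x\<close> may exceed
      \<open>d x y\<close>; then a point near \<open>y\<close> is taken.\<close>
    case False
    then obtain p where "p \<in> M" "d x p \<le> d x y + c" "d p y \<le> c"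
      using between[OF x y(1), of "d x y"] nonneg[OF x y(1)] by auto
    then show ?thesis using that[of p] f0 False by simp
  qed
  obtain w where w: "w \<in> M" "f p + f w < d p w + 1" using hull_extremal[OF f p(1), of 1] by auto
  have "d p w + d x y \<le> max (d p y + d x w) (d y w + d x p) + 2 * \<delta>"
    using hyp x y p w unfolding hyperbolic_on_iff by blast
  moreover have "d x w \<le> f x + f w" "d y w \<le> f y + f w"
    using dominatingD hull_dominating[OF f] x y w by auto
  ultimately have "f p \<le> 2 * \<delta> + c + 2" using p w y by linarith
  then show ?thesis using hdist_kuratowski[OF f p(1)] p(1) by (intro bexI[of _ p]) simp_all
qed

subsection \<open>Geodesics in the injective hull\<close>

text \<open>The dominating functions fixed by \<open>dual\<close> are exactly the extremal ones. The
  dual of a dominating function need not dominate, but the mean of the two does, which is why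
  averages are iterated.\<close>

definition dual :: "('a \<Rightarrow> real) \<Rightarrow> 'a \<Rightarrow> real" where
  "dual f = (\<lambda>x\<in>M. SUP y\<in>M. d x y - f y)"

definition avg :: "('a \<Rightarrow> real) \<Rightarrow> 'a \<Rightarrow> real" where
  "avg f = (\<lambda>x\<in>M. (f x + dual f x) / 2)"

definition retraction :: "('a \<Rightarrow> real) \<Rightarrow> 'a \<Rightarrow> real" where
  "retraction f = (\<lambda>x\<in>M. lim (\<lambda>n. (avg ^^ n) f x))"

lemma dual_le: "\<lbrakk>x \<in> M; \<And>y. y \<in> M \<Longrightarrow> d x y - f y \<le> c\<rbrakk> \<Longrightarrow> dual f x \<le> c"
  using nonempty by (simp add: dual_def cSUP_least)

lemma dual_bdd: "\<lbrakk>f \<in> dominating; x \<in> M\<rbrakk> \<Longrightarrow> bdd_above ((\<lambda>y. d x y - f y) ` M)"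
proof (rule bdd_aboveI2)
  show "d x y - f y \<le> f x" if "f \<in> dominating" "x \<in> M" "y \<in> M" for y
    using dominatingD[OF that] by linarith
qed

lemma dual_ge: "\<lbrakk>f \<in> dominating; x \<in> M; y \<in> M\<rbrakk> \<Longrightarrow> d x y - f y \<le> dual f x"
  unfolding dual_def by (auto intro: cSUP_upper dual_bdd)

lemma dual_le_self: "\<lbrakk>f \<in> dominating; x \<in> M\<rbrakk> \<Longrightarrow> dual f x \<le> f x"
proof (rule dual_le)
  show "d x y - f y \<le> f x" if "f \<in> dominating" "x \<in> M" "y \<in> M" for y
    using dominatingD[OF that] by linarith
qed

lemma avg_dominating: "f \<in> dominating \<Longrightarrow> avg f \<in> dominating"
proof -
  assume f: "f \<in> dominating"
  have "d x y \<le> (f x + dual f x) / 2 + (f y + dual f y) / 2" if "x \<in> M" "y \<in> M" for x y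
    using dual_ge[OF f that] dual_ge[OF f that(2,1)] commute[OF that] by (simp add: field_simps)
  then show ?thesis by (simp add: dominating_def avg_def)
qed

lemma avg_le: "\<lbrakk>f \<in> dominating; x \<in> M\<rbrakk> \<Longrightarrow> avg f x \<le> f x"
  using dual_le_self[of f x] by (simp add: avg_def)

lemma iter_dominating: "f \<in> dominating \<Longrightarrow> (avg ^^ n) f \<in> dominating"
  by (induction n) (auto intro: avg_dominating)

lemma iter_decseq: "\<lbrakk>f \<in> dominating; x \<in> M\<rbrakk> \<Longrightarrow> decseq (\<lambda>n. (avg ^^ n) f x)"
  using avg_le[OF iter_dominating] by (intro decseq_SucI) simp

lemma retraction_tendsto:
  assumes "f \<in> dominating" "x \<in> M"
  shows "(\<lambda>n. (avg ^^ n) f x) \<longlonglongrightarrow> retraction f x"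
proof -
  have "\<And>n. 0 \<le> (avg ^^ n) f x" using dominating_nonneg[OF iter_dominating] assms by blast
  with iter_decseq[OF assms] obtain l where "(\<lambda>n. (avg ^^ n) f x) \<longlonglongrightarrow> l"
    by (metis decseq_convergent)
  then show ?thesis using assms by (simp add: retraction_def limI)
qed

lemma retraction_le_iter: "\<lbrakk>f \<in> dominating; x \<in> M\<rbrakk> \<Longrightarrow> retraction f x \<le> (avg ^^ n) f x"
  using decseq_ge[OF iter_decseq retraction_tendsto] by blast

text \<open>Averaging moves the function halfway to its dual, and lowering the function can only
  raise the dual, so the gap at least halves.\<close>

lemma iter_gap:
  assumes "f \<in> dominating" "x \<in> M"
  shows "(avg ^^ n) f x - dual ((avg ^^ n) f) x \<le> (f x - dual f x) / 2 ^ n"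
proof (induction n)
  case (Suc n)
  let ?g = "(avg ^^ n) f"
  have g: "?g \<in> dominating" using assms iter_dominating by blast
  have "dual ?g x \<le> dual (avg ?g) x"
  proof (rule dual_le[OF assms(2)])
    fix y assume y: "y \<in> M"
    show "d x y - ?g y \<le> dual (avg ?g) x"
      using dual_ge[OF avg_dominating[OF g] assms(2) y] avg_le[OF g y] by linarith
  qed
  moreover have "avg ?g x = (?g x + dual ?g x) / 2" using assms by (simp add: avg_def)
  ultimately have "avg ?g x - dual (avg ?g) x \<le> (?g x - dual ?g x) / 2" by (simp add: field_simps)
  with Suc show ?case by simp
qed simp

text \<open>For a late iterate the gap at \<open>x\<close> is small, so a \<open>y\<close> nearly
  attaining its dual is an approximate partner of \<open>x\<close>, and remains one for the limit,
  which is smaller still.\<close>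

lemma retraction_hull:
  assumes f: "f \<in> dominating"
  shows "retraction f \<in> ihull"
proof -
  have "d x y \<le> retraction f x + retraction f y" if "x \<in> M" "y \<in> M" for x y
  proof (rule LIMSEQ_le_const)
    show "(\<lambda>n. (avg ^^ n) f x + (avg ^^ n) f y) \<longlonglongrightarrow> retraction f x + retraction f y"
      using retraction_tendsto[OF f] that by (intro tendsto_add) auto
    show "\<exists>N. \<forall>n\<ge>N. d x y \<le> (avg ^^ n) f x + (avg ^^ n) f y"
      using dominatingD[OF iter_dominating[OF f]] that by blast
  qed
  moreover have "\<exists>y\<in>M. retraction f x + retraction f y < d x y + e" if x: "x \<in> M" and e: "0 < e" for x e
  proof -
    have "(\<lambda>n. (f x - dual f x) * (1 / 2) ^ n) \<longlonglongrightarrow> (f x - dual f x) * 0"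
      by (intro tendsto_intros LIMSEQ_power_zero) simp
    then have "\<forall>\<^sub>F n in sequentially. (f x - dual f x) * (1 / 2) ^ n < e / 2"
      using e by (intro order_tendstoD(2)) auto
    then obtain n where n: "(f x - dual f x) / 2 ^ n < e / 2"
      unfolding eventually_sequentially by (auto simp: power_one_over)
    let ?g = "(avg ^^ n) f"
    have g: "?g \<in> dominating" using f iter_dominating by blast
    have "?g x - e < dual ?g x" using iter_gap[OF f x, of n] n e by linarith
    then have "?g x - e < (SUP y\<in>M. d x y - ?g y)" using x by (simp add: dual_def)
    then obtain y where y: "y \<in> M" "?g x - e < d x y - ?g y"
      using less_cSUP_iff[OF nonempty dual_bdd[OF g x]] by blast
    then show ?thesis
      using retraction_le_iter[OF f x, of n] retraction_le_iter[OF f y(1), of n] by (intro bexI[of _ y]) auto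
  qed
  moreover have "retraction f \<in> extensional M" by (simp add: retraction_def)
  ultimately show ?thesis by (simp add: ihull_def dominating_def)
qed

lemma avg_hull: "f \<in> ihull \<Longrightarrow> avg f = f"
proof -
  assume f: "f \<in> ihull"
  have "dual f x = f x" if x: "x \<in> M" for x
  proof (rule order_antisym)
    show "f x \<le> dual f x"
    proof (rule field_le_epsilon)
      fix e :: real assume "0 < e"
      then obtain y where "y \<in> M" "f x + f y < d x y + e" using hull_extremal[OF f x] by blast
      then show "f x \<le> dual f x + e" using dual_ge[OF hull_dominating[OF f] x, of y] by linarith
    qed
  qed (simp add: dual_le_self f hull_dominating x)
  moreover have "f \<in> extensional M" using f by (simp add: ihull_def dominating_def)
  ultimately show ?thesis by (intro extensionalityI[of _ M]) (auto simp: avg_def)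
qed

lemma retraction_id: "f \<in> ihull \<Longrightarrow> retraction f = f"
proof -
  assume f: "f \<in> ihull"
  have "(avg ^^ n) f = f" for n by (induction n) (auto simp: avg_hull f)
  moreover have "f \<in> extensional M" using f by (simp add: ihull_def dominating_def)
  ultimately show ?thesis by (intro extensionalityI[of _ M]) (auto simp: retraction_def)
qed

lemma avg_nonexpansive:
  assumes f: "f \<in> dominating" and g: "g \<in> dominating" and c: "\<And>x. x \<in> M \<Longrightarrow> \<bar>f x - g x\<bar> \<le> c" and x: "x \<in> M"
  shows "\<bar>avg f x - avg g x\<bar> \<le> c"
proof -
  have "dual h x \<le> dual k x + c" if "h \<in> dominating" "k \<in> dominating" "\<And>x. x \<in> M \<Longrightarrow> \<bar>h x - k x\<bar> \<le> c" for h k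
  proof (rule dual_le[OF x])
    fix y assume "y \<in> M"
    then show "d x y - h y \<le> dual k x + c" using dual_ge[OF that(2) x, of y] that(3)[of y] by linarith
  qed
  from this[OF f g c] this[OF g f] c x have "\<bar>dual f x - dual g x\<bar> \<le> c"
    by (fastforce simp: abs_minus_commute)
  then show ?thesis using c[OF x] x by (simp add: avg_def abs_le_iff field_simps)
qed

lemma retraction_nonexpansive:
  assumes f: "f \<in> dominating" and g: "g \<in> dominating" and c: "\<And>x. x \<in> M \<Longrightarrow> \<bar>f x - g x\<bar> \<le> c"
  shows "hdist (retraction f) (retraction g) \<le> c"
proof (rule hdist_le)
  fix x assume x: "x \<in> M"
  have iter: "\<forall>x\<in>M. \<bar>(avg ^^ n) f x - (avg ^^ n) g x\<bar> \<le> c" for n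
  proof (induction n)
    case (Suc n)
    then show ?case using avg_nonexpansive[OF iter_dominating[OF f] iter_dominating[OF g]] by simp
  qed (use c in simp)
  show "\<bar>retraction f x - retraction g x\<bar> \<le> c"
  proof (rule LIMSEQ_le_const2)
    show "(\<lambda>n. \<bar>(avg ^^ n) f x - (avg ^^ n) g x\<bar>) \<longlonglongrightarrow> \<bar>retraction f x - retraction g x\<bar>"
      using retraction_tendsto f g x by (intro tendsto_intros) auto
    show "\<exists>N. \<forall>n\<ge>N. \<bar>(avg ^^ n) f x - (avg ^^ n) g x\<bar> \<le> c" using iter x by blast
  qed
qed (use f g retraction_hull in auto)

text \<open>Straight segments stay dominating functions, and the retraction maps them to geodesics.\<close>

lemma geodesic_hull: "geodesic_metric hull_metric"
  unfolding geodesic_metric_def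
proof (intro ballI)
  fix f g assume "f \<in> mspace hull_metric" "g \<in> mspace hull_metric"
  then have f: "f \<in> ihull" and g: "g \<in> ihull" by auto
  define L where "L = hdist f g"
  have L0: "0 \<le> L" using hdist_nonneg by (simp add: L_def)
  define seg where "seg t = (\<lambda>x\<in>M. f x + t / L * (g x - f x))" for t
  define \<gamma> where "\<gamma> t = retraction (seg t)" for t
  have seg: "seg t \<in> dominating" if t: "0 \<le> t" "t \<le> L" for t
  proof -
    have s: "0 \<le> t / L" "t / L \<le> 1" using t L0 by (auto simp: divide_le_eq_1)
    have "d x y \<le> (f x + t / L * (g x - f x)) + (f y + t / L * (g y - f y))" if "x \<in> M" "y \<in> M" for x y
    proof -
      have "(1 - t / L) * d x y \<le> (1 - t / L) * (f x + f y)"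
        using dominatingD[OF hull_dominating[OF f] that] s by (intro mult_left_mono) simp_all
      moreover have "t / L * d x y \<le> t / L * (g x + g y)"
        using dominatingD[OF hull_dominating[OF g] that] s by (intro mult_left_mono)
      ultimately show ?thesis by (simp add: algebra_simps)
    qed
    then show ?thesis by (simp add: dominating_def seg_def)
  qed
  have lip: "hdist (\<gamma> s) (\<gamma> t) \<le> \<bar>s - t\<bar>" if "0 \<le> s" "s \<le> L" "0 \<le> t" "t \<le> L" for s t
    unfolding \<gamma>_def
  proof (rule retraction_nonexpansive)
    fix x assume x: "x \<in> M"
    have "seg s x - seg t x = (s - t) * ((g x - f x) / L)"
      using x by (simp add: seg_def algebra_simps diff_divide_distrib)
    moreover have "\<bar>(g x - f x) / L\<bar> \<le> 1"
    \<comment> \<open>For \<open>L = 0\<close> the quotient is 0 by the convention on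
      division.\<close>
    proof (cases "L = 0")
      case False
      then have "0 < L" using L0 by simp
      then show ?thesis using abs_diff_le_hdist[OF f g x] by (simp add: L_def abs_minus_commute)
    qed simp
    ultimately show "\<bar>seg s x - seg t x\<bar> \<le> \<bar>s - t\<bar>"
      by (simp only: abs_mult mult_left_le abs_ge_zero)
  qed (use seg that in auto)
  have ext: "f \<in> extensional M" "g \<in> extensional M"
    using f g by (auto simp: ihull_def dominating_def)
  have "seg 0 = f" using ext by (intro extensionalityI[of _ M]) (auto simp: seg_def)
  then have \<gamma>0: "\<gamma> 0 = f" using f by (simp add: \<gamma>_def retraction_id)
  have "f x + L / L * (g x - f x) = g x" if "x \<in> M" for x
    using abs_diff_le_hdist[OF f g that] by (cases "L = 0") (auto simp: L_def)
  then have "seg L = g" using ext by (intro extensionalityI[of _ M]) (auto simp: seg_def)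
  then have \<gamma>L: "\<gamma> L = g" using g by (simp add: \<gamma>_def retraction_id)
  have in_hull: "\<gamma> t \<in> ihull" if "0 \<le> t" "t \<le> L" for t
    using retraction_hull[OF seg[OF that]] by (simp add: \<gamma>_def)
  \<comment> \<open>A 1-Lipschitz path joining two points in a time equal to their distance cannot
    lose length anywhere.\<close>
  have ordered: "hdist (\<gamma> s) (\<gamma> t) = t - s" if st: "0 \<le> s" "s \<le> t" "t \<le> L" for s t
  proof -
    have "L = hdist (\<gamma> 0) (\<gamma> L)" unfolding \<gamma>0 \<gamma>L by (rule L_def)
    then have "L \<le> hdist (\<gamma> 0) (\<gamma> s) + hdist (\<gamma> s) (\<gamma> t) + hdist (\<gamma> t) (\<gamma> L)"
      using ihull.triangle[of "\<gamma> 0" "\<gamma> s" "\<gamma> L"] ihull.triangle[of "\<gamma> s" "\<gamma> t" "\<gamma> L"]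
        in_hull[of 0] in_hull[of s] in_hull[of t] in_hull[of L] st by simp
    then show ?thesis using lip[of 0 s] lip[of s t] lip[of t L] st by simp
  qed
  have "geodesic_path hull_metric L \<gamma>"
    unfolding geodesic_path_def
  proof (intro conjI ballI)
    fix s t assume "s \<in> {0..L}" "t \<in> {0..L}"
    then show "mdist hull_metric (\<gamma> s) (\<gamma> t) = \<bar>s - t\<bar>"
      using ordered[of s t] ordered[of t s] ihull.commute[of "\<gamma> s" "\<gamma> t"] by (cases "s \<le> t") auto
  qed (use L0 in_hull in auto)
  with \<gamma>0 \<gamma>L show "\<exists>L \<gamma>. geodesic_path hull_metric L \<gamma> \<and> \<gamma> 0 = f \<and> \<gamma> L = g" by blast
qed

end

section \<open>Groups acting on products of two hyperbolic spaces\<close>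

lemma hyperbolic_on_mono: "\<lbrakk>hyperbolic_on \<delta> M d; \<delta> \<le> \<delta>'\<rbrakk> \<Longrightarrow> hyperbolic_on \<delta>' M d"
  unfolding hyperbolic_on_def by (metis diff_left_mono order_trans)

lemma set_mdist_singletons [simp]: "set_mdist m {a} {b} = mdist m a b"
  by (simp add: set_mdist_def)

lemma mdiam_singleton [simp]: "a \<in> mspace m \<Longrightarrow> mdiam m {a} = 0"
  by (simp add: mdiam_def)

lemma group_actionI:
  assumes "group G"
    and closed: "\<And>g x. \<lbrakk>g \<in> carrier G; x \<in> A\<rbrakk> \<Longrightarrow> f g x \<in> A"
    and ext: "\<And>g. g \<in> carrier G \<Longrightarrow> f g \<in> extensional A"
    and one: "\<And>x. x \<in> A \<Longrightarrow> f \<one>\<^bsub>G\<^esub> x = x"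
    and mult: "\<And>g h x. \<lbrakk>g \<in> carrier G; h \<in> carrier G; x \<in> A\<rbrakk> \<Longrightarrow> f (g \<otimes>\<^bsub>G\<^esub> h) x = f g (f h x)"
  shows "group_action G A f"
proof -
  interpret group G by fact
  have bij: "f g \<in> Bij A" if "g \<in> carrier G" for g
  proof -
    have "f (inv\<^bsub>G\<^esub> g) (f g x) = x" "f g (f (inv\<^bsub>G\<^esub> g) x) = x" if "x \<in> A" for x
      using mult[of "inv\<^bsub>G\<^esub> g" g x] mult[of g "inv\<^bsub>G\<^esub> g" x] \<open>g \<in> carrier G\<close> that one by auto
    then have "bij_betw (f g) A A"
      using closed that by (intro bij_betw_byWitness[where f' = "f (inv\<^bsub>G\<^esub> g)"]) auto
    then show ?thesis using ext that by (simp add: Bij_def)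
  qed
  have "f (g \<otimes>\<^bsub>G\<^esub> h) = compose A (f g) (f h)" if "g \<in> carrier G" "h \<in> carrier G" for g h
    using that by (intro extensionalityI[of _ A]) (auto simp: ext mult compose_def)
  then have "f \<in> hom G (BijGroup A)"
    using bij by (auto simp: hom_def BijGroup_def)
  then show ?thesis
    using \<open>group G\<close> group_BijGroup by (simp add: group_action_def group_hom_def group_hom_axioms_def)
qed

section \<open>Left translation on injective hulls\<close>

definition translate :: "('g, 'm) monoid_scheme \<Rightarrow> 'g \<Rightarrow> ('g \<Rightarrow> real) \<Rightarrow> 'g \<Rightarrow> real" where
  "translate G g f = (\<lambda>x\<in>carrier G. f (inv\<^bsub>G\<^esub> g \<otimes>\<^bsub>G\<^esub> x))"

lemma (in group) translate_mult:
  "\<lbrakk>g \<in> carrier G; h \<in> carrier G\<rbrakk> \<Longrightarrow> translate G (g \<otimes> h) f = translate G g (translate G h f)"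
  by (auto simp: translate_def fun_eq_iff inv_mult_group m_assoc)

lemma (in group) translate_one: "f \<in> extensional (carrier G) \<Longrightarrow> translate G \<one> f = f"
  by (auto simp: translate_def fun_eq_iff extensional_def)

text \<open>A pseudometric is enough because the Kuratowski map identifies points at distance 0; so
  the distance of a quotient can be pulled back to \<open>G\<close>. In \<open>between\<close>,
  geodesics are replaced by an additive error.\<close>

locale hyperbolic_pseudometric = group G + pseudometric "carrier G" d
  for G :: "('g, 'm) monoid_scheme" (structure) and d :: "'g \<Rightarrow> 'g \<Rightarrow> real" +
  fixes \<delta> c :: real
  assumes invariant: "\<lbrakk>g \<in> carrier G; x \<in> carrier G; y \<in> carrier G\<rbrakk> \<Longrightarrow> d (g \<otimes> x) (g \<otimes> y) = d x y"
    and hyperbolic: "hyperbolic_on \<delta> (carrier G) d"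
    and between: "\<lbrakk>x \<in> carrier G; y \<in> carrier G; 0 \<le> r; r \<le> d x y\<rbrakk> \<Longrightarrow>
      \<exists>p\<in>carrier G. d x p \<le> r + c \<and> d p y \<le> d x y - r + c"
begin

lemma translate_hull:
  assumes g: "g \<in> carrier G" and f: "f \<in> ihull"
  shows "translate G g f \<in> ihull"
proof -
  have inv: "d (inv g \<otimes> x) (inv g \<otimes> y) = d x y" if "x \<in> carrier G" "y \<in> carrier G" for x y
    using invariant g that by simp
  have "translate G g f \<in> dominating"
    using dominatingD[OF hull_dominating[OF f]] g inv by (auto simp: dominating_def translate_def) (metis inv_closed m_closed)
  moreover have "\<exists>y\<in>carrier G. translate G g f x + translate G g f y < d x y + e"
    if x: "x \<in> carrier G" and e: "0 < e" for x e
  proof -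
    obtain y where y: "y \<in> carrier G" "f (inv g \<otimes> x) + f y < d (inv g \<otimes> x) y + e"
      using hull_extremal[OF f _ e] x g by (metis inv_closed m_closed)
    have "inv g \<otimes> (g \<otimes> y) = y" using g y by (simp add: m_assoc[symmetric])
    then show ?thesis using y x g inv[of x "g \<otimes> y"]
      by (intro bexI[of _ "g \<otimes> y"]) (auto simp: translate_def)
  qed
  ultimately show ?thesis by (simp add: ihull_def)
qed

lemma translate_inverse:
  assumes "g \<in> carrier G" "f \<in> ihull"
  shows "translate G (inv g) (translate G g f) = f" "translate G g (translate G (inv g) f) = f"
proof -
  have "f \<in> extensional (carrier G)" using assms by (simp add: ihull_def dominating_def)
  then show "translate G (inv g) (translate G g f) = f" "translate G g (translate G (inv g) f) = f"
    using assms by (simp_all add: translate_mult[symmetric] translate_one)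
qed

lemma hdist_translate_le:
  assumes "g \<in> carrier G" "f \<in> ihull" "h \<in> ihull"
  shows "hdist (translate G g f) (translate G g h) \<le> hdist f h"
  using assms abs_diff_le_hdist by (intro hdist_le translate_hull) (auto simp: translate_def)

lemma isometry_translate:
  assumes g: "g \<in> carrier G"
  shows "isometry hull_metric hull_metric (translate G g)"
proof -
  have "hdist (translate G g f) (translate G g h) = hdist f h" if "f \<in> ihull" "h \<in> ihull" for f h
    using hdist_translate_le[OF g that] hdist_translate_le[of "inv g" "translate G g f" "translate G g h"]
      translate_inverse[OF g] translate_hull[OF g] that g by (simp add: order_antisym)
  moreover have "bij_betw (translate G g) ihull ihull"
    using translate_hull translate_inverse g
    by (intro bij_betw_byWitness[where f' = "translate G (inv g)"]) auto
  ultimately show ?thesis by (simp add: isometry_def)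
qed

lemma translate_kuratowski:
  assumes "g \<in> carrier G" "x \<in> carrier G"
  shows "translate G g (kuratowski x) = kuratowski (g \<otimes> x)"
proof -
  have "d x (inv g \<otimes> y) = d (g \<otimes> x) y" if "y \<in> carrier G" for y
    using invariant[of g x "inv g \<otimes> y"] that assms by (simp add: m_assoc[symmetric])
  then show ?thesis using assms by (auto simp: translate_def kuratowski_def fun_eq_iff)
qed

end

text \<open>The domains \<open>1\<close> and \<open>2\<close> are the orthogonal factors; the maximal domain \<open>0\<close> carries the zero
  pseudometric, whose injective hull is a point.\<close>

locale product_structure = word_metric G S
  for G :: "('g, 'm) monoid_scheme" (structure) and S :: "'g set" +
  fixes d :: "nat \<Rightarrow> 'g \<Rightarrow> 'g \<Rightarrow> real" and \<delta> c :: real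
  assumes hyp: "hyperbolic_pseudometric G (d V) \<delta> c"
    and d0: "d 0 x y = 0"
    and finite_balls: "finite {g \<in> carrier G. d 1 \<one> g \<le> k \<and> d 2 \<one> g \<le> k}"
    and realise: "\<lbrakk>a \<in> carrier G; b \<in> carrier G\<rbrakk> \<Longrightarrow> \<exists>x\<in>carrier G. d 1 x a \<le> c \<and> d 2 x b \<le> c"
begin

sublocale C: hyperbolic_pseudometric G "d V" \<delta> c for V
  by (rule hyp)

section \<open>The spaces and the index set of the structure\<close>

definition CV :: "nat \<Rightarrow> ('g \<Rightarrow> real) metric" where
  "CV V = pseudometric.hull_metric (carrier G) (d V)"

definition pt :: "nat \<Rightarrow> 'g \<Rightarrow> 'g \<Rightarrow> real" where
  "pt V = pseudometric.kuratowski (carrier G) (d V)"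

definition domains :: "nat set" where "domains = {0, 1, 2}"

definition nest :: "nat \<Rightarrow> nat \<Rightarrow> bool" where "nest V W \<longleftrightarrow> V = W \<or> W = 0"

definition orth :: "nat \<Rightarrow> nat \<Rightarrow> bool" where "orth V W \<longleftrightarrow> V = 1 \<and> W = 2 \<or> V = 2 \<and> W = 1"

text \<open>The points of \<open>X\<close> have to be real functions on \<open>G\<close>, so an
  element is represented by its indicator function.\<close>

definition vertex :: "'g \<Rightarrow> 'g \<Rightarrow> real" where "vertex g = (\<lambda>x. if x = g then 1 else 0)"

definition elt :: "('g \<Rightarrow> real) \<Rightarrow> 'g" where "elt = inv_into UNIV vertex"

definition X :: "('g \<Rightarrow> real) metric" where
  "X = metric (vertex ` carrier G,
     \<lambda>p q. if p \<in> vertex ` carrier G \<and> q \<in> vertex ` carrier G then real (wd (elt p) (elt q)) else 0)"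

definition act :: "'g \<Rightarrow> ('g \<Rightarrow> real) \<Rightarrow> 'g \<Rightarrow> real" where
  "act g = (\<lambda>p\<in>vertex ` carrier G. vertex (g \<otimes> elt p))"

lemma elt_vertex [simp]: "elt (vertex g) = g"
proof -
  have "inj vertex" by (rule injI) (metis vertex_def zero_neq_one)
  then show ?thesis by (simp add: elt_def)
qed

lemma mspace_X [simp]: "mspace X = vertex ` carrier G"
  and mdist_X: "\<lbrakk>x \<in> carrier G; y \<in> carrier G\<rbrakk> \<Longrightarrow> mdist X (vertex x) (vertex y) = real (wd x y)"
proof -
  have wd0: "wd x y = 0 \<longleftrightarrow> x = y" if "x \<in> carrier G" "y \<in> carrier G" for x y
    using that wl_eq_0[of "inv x \<otimes> y"] by (metis d_self inv_closed inv_comm inv_inv m_closed wd_def inv_equality)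
  interpret Metric_space "vertex ` carrier G" "\<lambda>p q. if p \<in> vertex ` carrier G \<and> q \<in> vertex ` carrier G then real (wd (elt p) (elt q)) else 0"
  proof
    show "(if p \<in> vertex ` carrier G \<and> r \<in> vertex ` carrier G then real (wd (elt p) (elt r)) else 0)
      \<le> (if p \<in> vertex ` carrier G \<and> q \<in> vertex ` carrier G then real (wd (elt p) (elt q)) else 0)
      + (if q \<in> vertex ` carrier G \<and> r \<in> vertex ` carrier G then real (wd (elt q) (elt r)) else 0)"
      if "p \<in> vertex ` carrier G" "q \<in> vertex ` carrier G" "r \<in> vertex ` carrier G" for p q r
      using that d_triangle[of "elt p" "elt q" "elt r"] by auto
  qed (use d_commute wd0 in auto)
  show "mspace X = vertex ` carrier G" by (simp add: X_def)
  show "mdist X (vertex x) (vertex y) = real (wd x y)" if "x \<in> carrier G" "y \<in> carrier G"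
    using that by (simp add: X_def)
qed

lemma act_vertex: "x \<in> carrier G \<Longrightarrow> act g (vertex x) = vertex (g \<otimes> x)"
  by (simp add: act_def)

text \<open>Time is rounded down to the vertices of a geodesic word, which changes distances by at
  most 1.\<close>

lemma X_quasigeodesic: "quasigeodesic_metric X"
  unfolding quasigeodesic_metric_def
proof (rule exI[of _ 1], intro conjI ballI)
  fix p q assume "p \<in> mspace X" "q \<in> mspace X"
  then obtain x y where xy: "x \<in> carrier G" "y \<in> carrier G" "p = vertex x" "q = vertex y" by auto
  obtain ws where ws: "set ws \<subseteq> letters" "ev ws = inv x \<otimes> y" "length ws = wd x y"
    using xy unfolding wd_def by (metis geodesic_word inv_closed m_closed)
  define L where "L = length ws"
  define z where "z i = x \<otimes> ev (take i ws)" for i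
  have sub: "set (take i ws) \<subseteq> letters" "set (take j (drop i ws)) \<subseteq> letters" for i j
    using ws by (auto dest!: in_set_takeD in_set_dropD)
  have z: "z i \<in> carrier G" for i using sub xy by (simp add: z_def ev_closed)
  have z_le: "wd (z i) (z (i + j)) \<le> j" for i j
  proof -
    have "z (i + j) = z i \<otimes> ev (take j (drop i ws))"
      unfolding z_def take_add using sub xy by (simp add: ev_append ev_closed m_assoc)
    then show ?thesis using wd_ev[OF z sub(2), of i j i] by simp
  qed
  have z0: "z 0 = x" and zL: "z L = y"
    using xy ws by (simp_all add: z_def L_def m_assoc[symmetric])
  have z_eq: "wd (z i) (z j) = j - i" if "i \<le> j" "j \<le> L" for i j
  proof -
    have "L \<le> wd (z 0) (z i) + wd (z i) (z j) + wd (z j) (z L)"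
      using d_triangle[of "z 0" "z i" "z L"] d_triangle[of "z i" "z j" "z L"] z ws(3) z0 zL xy
      by (simp add: L_def)
    then show ?thesis using z_le[of 0 i] z_le[of i "j - i"] z_le[of j "L - j"] that by simp
  qed
  have z_dist: "real (wd (z i) (z j)) = \<bar>real i - real j\<bar>" if "i \<le> L" "j \<le> L" for i j
    using z_eq[of i j] z_eq[of j i] d_commute[OF z z, of i j] that by (cases "i \<le> j") auto
  have "quasigeodesic_path X 1 (real L) (\<lambda>t. vertex (z (nat \<lfloor>t\<rfloor>)))"
    unfolding quasigeodesic_path_def
  proof (intro conjI ballI)
    fix s t assume "s \<in> {0..real L}" "t \<in> {0..real L}"
    then have st: "0 \<le> s" "0 \<le> t" "nat \<lfloor>s\<rfloor> \<le> L" "nat \<lfloor>t\<rfloor> \<le> L" by (auto, linarith+)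
    have eq: "mdist X (vertex (z (nat \<lfloor>s\<rfloor>))) (vertex (z (nat \<lfloor>t\<rfloor>))) = \<bar>of_int \<lfloor>s\<rfloor> - of_int \<lfloor>t\<rfloor>\<bar>"
      using z_dist[OF st(3,4)] st by (simp add: mdist_X z)
    have "\<bar>s - t\<bar> - 1 \<le> \<bar>a - b\<bar> \<and> \<bar>a - b\<bar> \<le> \<bar>s - t\<bar> + 1"
      if "a \<le> s" "s < a + 1" "b \<le> t" "t < b + 1" for a b :: real
      using that by linarith
    from this[of "of_int \<lfloor>s\<rfloor>" "of_int \<lfloor>t\<rfloor>"]
    show "\<bar>s - t\<bar> / 1 - 1 \<le> mdist X (vertex (z (nat \<lfloor>s\<rfloor>))) (vertex (z (nat \<lfloor>t\<rfloor>)))"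
      "mdist X (vertex (z (nat \<lfloor>s\<rfloor>))) (vertex (z (nat \<lfloor>t\<rfloor>))) \<le> 1 * \<bar>s - t\<bar> + 1"
      unfolding eq by simp_all
  qed (use z in auto)
  then show "\<exists>L \<gamma>. quasigeodesic_path X 1 L \<gamma> \<and> \<gamma> 0 = p \<and> \<gamma> L = q"
    by (intro exI[of _ "real L"] exI[of _ "\<lambda>t. vertex (z (nat \<lfloor>t\<rfloor>))"]) (simp add: z0 zL xy)
qed simp

lemma finite_elt_image:
  assumes "mbounded_of X A"
  shows "finite (elt ` A)"
proof -
  interpret X: Metric_space "mspace X" "mdist X" by (rule Metric_space_mspace_mdist)
  obtain p B where "A \<subseteq> X.mcball p B" using assms unfolding X.mbounded_def by blast
  show ?thesis
  proof (rule finite_subset)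
    show "finite ((\<lambda>g. elt p \<otimes> g) ` {g \<in> carrier G. wl g \<le> nat \<lceil>B\<rceil>})"
      using finite_wl_ball by simp
    show "elt ` A \<subseteq> (\<lambda>g. elt p \<otimes> g) ` {g \<in> carrier G. wl g \<le> nat \<lceil>B\<rceil>}"
    proof
      fix y assume "y \<in> elt ` A"
      then obtain a where "a \<in> A" "y = elt a" by blast
      then have "a \<in> X.mcball p B" using \<open>A \<subseteq> X.mcball p B\<close> by blast
      then have "p \<in> mspace X" "a \<in> mspace X" "mdist X p a \<le> B"
        by (simp_all only: X.in_mcball)
      then obtain x y' where x: "x \<in> carrier G" "p = vertex x" and y': "y' \<in> carrier G" "a = vertex y'"
        unfolding mspace_X by blast
      then have y: "y \<in> carrier G" "a = vertex y" using \<open>y = elt a\<close> by simp_all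
      have "real (wd x y) \<le> B" using \<open>mdist X p a \<le> B\<close> x y by (simp add: mdist_X)
      then have "wl (inv x \<otimes> y) \<le> nat \<lceil>B\<rceil>" unfolding wd_def by linarith
      moreover have "y = elt p \<otimes> (inv x \<otimes> y)" using x y by (simp add: m_assoc[symmetric])
      ultimately show "y \<in> (\<lambda>g. elt p \<otimes> g) ` {g \<in> carrier G. wl g \<le> nat \<lceil>B\<rceil>}"
        using x y by blast
    qed
  qed
qed

lemma CV_simps [simp]:
  "mspace (CV V) = pseudometric.ihull (carrier G) (d V)"
  "mdist (CV V) = pseudometric.hdist (carrier G) (d V)"
  by (simp_all add: CV_def)

lemma pt_closed [simp]: "x \<in> carrier G \<Longrightarrow> pt V x \<in> mspace (CV V)"
  by (simp add: pt_def C.kuratowski_hull)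

lemma mdist_pt: "\<lbrakk>x \<in> carrier G; y \<in> carrier G\<rbrakk> \<Longrightarrow> mdist (CV V) (pt V x) (pt V y) = d V x y"
  by (simp add: pt_def C.hdist_kuratowski2)

text \<open>Domination makes the values nonnegative, and an approximate partner pushes
  \<open>f x\<close> below every positive \<open>e\<close>.\<close>

lemma CV_0: "f \<in> mspace (CV 0) \<Longrightarrow> f = pt 0 \<one>"
proof -
  assume "f \<in> mspace (CV 0)"
  then have f: "f \<in> C.ihull 0" by simp
  have "f x = pt 0 \<one> x" if x: "x \<in> carrier G" for x
  proof -
    have f0: "0 \<le> f y" if "y \<in> carrier G" for y
      using C.dominating_nonneg[OF C.hull_dominating[OF f]] that by blast
    have "f x \<le> 0"
    proof (rule field_le_epsilon)
      fix e :: real assume "0 < e"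
      then obtain y where "y \<in> carrier G" "f x + f y < d 0 x y + e"
        using C.hull_extremal[OF f x] by blast
      then show "f x \<le> 0 + e" using f0[of y] by (simp add: d0)
    qed
    then show ?thesis using f0[OF x] x by (simp add: pt_def C.kuratowski_def d0)
  qed
  then show ?thesis using C.hull_eqI[OF f] by (metis CV_simps(1) one_closed pt_closed)
qed

lemma ex_Lipschitz: "\<exists>l. \<forall>V\<in>domains. \<forall>x\<in>carrier G. \<forall>y\<in>carrier G. d V x y \<le> l * real (wd x y)"
proof -
  have "\<exists>l\<ge>0. \<forall>g\<in>carrier G. d V \<one> g \<le> l * real (wl g)" for V
  proof (rule subadditive_le_wl)
    show "d V \<one> (g \<otimes> h) \<le> d V \<one> g + d V \<one> h" if "g \<in> carrier G" "h \<in> carrier G" for g h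
      using C.triangle[of \<one> g "g \<otimes> h" V] C.invariant[of g \<one> h V] that by simp
  qed (simp add: C.self)
  then obtain l where l: "\<And>V g. g \<in> carrier G \<Longrightarrow> d V \<one> g \<le> l V * real (wl g)"
    by metis
  define m where "m = max (l 0) (max (l 1) (l 2))"
  have "d V x y \<le> m * real (wd x y)" if "V \<in> domains" "x \<in> carrier G" "y \<in> carrier G" for V x y
  proof -
    have "d V x y = d V \<one> (inv x \<otimes> y)" using C.invariant[of "inv x" x y V] that by simp
    also have "\<dots> \<le> l V * real (wd x y)" using l that by (simp add: wd_def)
    also have "\<dots> \<le> m * real (wd x y)" using that by (intro mult_right_mono) (auto simp: m_def domains_def)
    finally show ?thesis .
  qed
  then show ?thesis by blast
qed

lemma index: "hhs_index domains nest orth"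
proof
  show "partial_order_on domains {(V, W). V \<in> domains \<and> W \<in> domains \<and> nest V W}"
    by (auto simp: partial_order_on_def preorder_on_def refl_on_def trans_def antisym_def nest_def)
  show "\<exists>!T. T \<in> domains \<and> (\<forall>V\<in>domains. nest T V \<longrightarrow> V = T)"
    by (intro ex1I[of _ 0]) (auto simp: nest_def domains_def)
  show "\<exists>W\<in>domains. nest W T \<and> W \<noteq> T \<and> (\<forall>V\<in>domains. nest V T \<and> orth V U \<longrightarrow> nest V W)"
    if "T \<in> domains" "U \<in> domains" "nest U T" "{V \<in> domains. nest V T \<and> orth V U} \<noteq> {}" for T U
  proof -
    have "T = 0 \<and> (U = 1 \<or> U = 2)"
      using that by (auto simp: nest_def orth_def domains_def)
    \<comment> \<open>\<open>3 - U\<close> is the other factor, the one domain orthogonal to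
      \<open>U\<close>.\<close>
    then show ?thesis
      by (intro bexI[of _ "3 - U"]) (auto simp: nest_def orth_def domains_def)
  qed
  show "orth W V" if "orth V W" for V W using that unfolding orth_def by blast
  show "\<not> orth V V" for V by (simp add: orth_def)
  show "orth V U" if "nest V W" "orth W U" for V W U using that unfolding nest_def orth_def by (metis numeral_eq_one_iff semiring_norm(85) zero_neq_numeral zero_neq_one)
  show "\<not> nest V W \<and> \<not> nest W V" if "orth V W" for V W using that unfolding nest_def orth_def by (metis numeral_eq_one_iff semiring_norm(85) zero_neq_numeral zero_neq_one)
qed

interpretation I: hhs_index "domains" nest orth
  by (rule index)

lemma pnest_iff: "I.pnest V W \<longleftrightarrow> W = 0 \<and> (V = 1 \<or> V = 2)"
  unfolding I.pnest_def by (auto simp: nest_def domains_def)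

lemma not_transv: "\<not> I.transv V W"
  unfolding I.transv_def by (auto simp: nest_def orth_def domains_def)

definition \<phi> :: "nat \<Rightarrow> ('g \<Rightarrow> real) \<Rightarrow> ('g \<Rightarrow> real) set" where "\<phi> V p = {pt V (elt p)}"

text \<open>For the pairs that occur, \<open>W\<close> is the top domain with its one-point space,
  so the base point is compatible with the action.\<close>

definition \<rho> :: "nat \<Rightarrow> nat \<Rightarrow> ('g \<Rightarrow> real) set" where "\<rho> V W = {pt W \<one>}"

definition \<rho>d :: "nat \<Rightarrow> nat \<Rightarrow> ('g \<Rightarrow> real) \<Rightarrow> ('g \<Rightarrow> real) set" where "\<rho>d W V p = {pt V \<one>}"

text \<open>Proper nesting is only in the top domain, whose space is a point, so the conditions on
  \<open>\<rho>\<close> reduce to distances 0. The substance is \<open>realise\<close>, which gives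
  partial realisation, \<open>finite_balls\<close>, which gives uniqueness, and the coarse density
  of orbits in hulls, which contributes \<open>2 * \<delta> + c + 2\<close>. The bound 3 counts the
  domains.\<close>

lemma hhs:
  assumes E: "3 \<le> E" "\<delta> \<le> E" "c \<le> E" "2 * \<delta> + c + 2 \<le> E"
    and Lip: "\<And>V x y. \<lbrakk>V \<in> domains; x \<in> carrier G; y \<in> carrier G\<rbrakk> \<Longrightarrow> d V x y \<le> E * real (wd x y)"
  shows "hhs domains nest orth E X CV \<phi> \<rho> \<rho>d"
proof (intro hhs.intro index hhs_axioms.intro)
  show "1 \<le> E" using E by simp
  show "mspace X \<noteq> {}" by auto
  show "quasigeodesic_metric X" by (rule X_quasigeodesic)
  show "geodesic_metric (CV V)" for V unfolding CV_def by (rule C.geodesic_hull)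
  show "hyperbolic_on E (mspace (CV V)) (mdist (CV V))" for V
    using hyperbolic_on_mono[OF C.hyperbolic_hull[OF C.hyperbolic] E(2)] by simp
  show "\<phi> V p \<subseteq> mspace (CV V) \<and> \<phi> V p \<noteq> {} \<and> mdiam (CV V) (\<phi> V p) \<le> ennreal E"
    if "V \<in> domains" "p \<in> mspace X" for V p
    using that pt_closed by (auto simp: \<phi>_def simp del: CV_simps)
  show "set_mdist (CV V) (\<phi> V p) (\<phi> V q) \<le> E * mdist X p q + E"
    if V: "V \<in> domains" and pq: "p \<in> mspace X" "q \<in> mspace X" for V p q
  proof -
    obtain x y where "x \<in> carrier G" "p = vertex x" "y \<in> carrier G" "q = vertex y" using pq by auto
    then show ?thesis using Lip[OF V, of x y] E by (simp add: \<phi>_def mdist_pt mdist_X del: CV_simps)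
  qed
  show "mspace (CV V) \<subseteq> mneighbourhood (CV V) E (\<Union>p\<in>mspace X. \<phi> V p)" for V
  proof
    fix f assume f: "f \<in> mspace (CV V)"
    then obtain x where "x \<in> carrier G" "C.hdist V f (pt V x) \<le> 2 * \<delta> + c + 2"
      using C.hull_coarsely_dense[OF C.hyperbolic C.between, where f = f] unfolding pt_def by auto
    then show "f \<in> mneighbourhood (CV V) E (\<Union>p\<in>mspace X. \<phi> V p)"
      using f E by (auto simp: mneighbourhood_def \<phi>_def intro!: bexI[of _ x])
  qed
  show "\<rho> V W \<subseteq> mspace (CV W) \<and> \<rho> V W \<noteq> {} \<and> mdiam (CV W) (\<rho> V W) \<le> ennreal E" for V W
    using pt_closed by (auto simp: \<rho>_def simp del: CV_simps)
  show "\<rho>d W V p \<subseteq> mspace (CV V) \<and> \<rho>d W V p \<noteq> {}" for V W p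
    using pt_closed by (auto simp: \<rho>d_def simp del: CV_simps)
  have E0: "0 \<le> E" using E by simp
  have top: "set_mdist (CV 0) (\<phi> 0 p) (\<rho> V 0) = 0" if "p \<in> mspace X" for V p
    using that by (auto simp: \<phi>_def \<rho>_def mdist_pt d0 simp del: CV_simps)
  show "min (set_mdist (CV W) (\<phi> W p) (\<rho> V W)) (set_mdist (CV V) (\<phi> V p) (\<rho> W V)) \<le> E"
    if "I.transv V W" for V W p
    using that not_transv by blast
  show "min (ennreal (set_mdist (CV W) (\<phi> W p) (\<rho> V W)))
      (mdiam (CV V) (\<phi> V p \<union> (\<Union>q\<in>\<phi> W p. \<rho>d W V q))) \<le> ennreal E"
    if "I.pnest V W" "p \<in> mspace X" for V W p
    using that top by (auto simp: pnest_iff min_def simp del: CV_simps)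
  show "set_mdist (CV W) (\<rho> U W) (\<rho> V W) \<le> E" for U V W
    using E0 by (simp add: \<rho>_def mdist_pt C.self del: CV_simps)
  show "finite A \<and> real (card A) \<le> E" if A: "A \<subseteq> domains" for A
  proof -
    have "card A \<le> card {0, 1, 2::nat}" using A by (intro card_mono) (auto simp: domains_def)
    then have "card A \<le> 3" by simp
    moreover have "finite A" using A by (rule finite_subset) (simp add: domains_def)
    ultimately show ?thesis using E by linarith
  qed
  show "\<exists>\<T>. finite \<T> \<and> int (card \<T>) \<le> \<lfloor>N\<rfloor> \<and> (\<forall>T\<in>\<T>. I.pnest T W) \<and>
      (\<forall>T. I.pnest T W \<longrightarrow> (\<exists>T'\<in>\<T>. nest T T') \<or> set_mdist (CV T) (\<phi> T p) (\<phi> T q) < E) \<and>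
      (\<forall>T\<in>\<T>. set_mdist (CV W) (\<phi> W p) (\<rho> T W) \<le> N)"
    if pq: "p \<in> mspace X" "q \<in> mspace X" and N: "N = E * set_mdist (CV W) (\<phi> W p) (\<phi> W q) + E" for W p q N
  proof (intro exI conjI)
    \<comment> \<open>All properly nested domains, at most two of them, which
      \<open>3 \<le> E\<close> and \<open>E \<le> N\<close> allow for.\<close>
    let ?T = "{T. I.pnest T W}"
    have "?T \<subseteq> {1, 2}" by (auto simp: pnest_iff)
    then have "finite ?T" "card ?T \<le> card {1, 2::nat}"
      by (rule finite_subset, simp) (rule card_mono[OF _ \<open>?T \<subseteq> {1, 2}\<close>], simp)
    then show "finite ?T" by simp
    have "E \<le> N" using N E0 by (simp add: \<phi>_def del: CV_simps)
    then show "int (card ?T) \<le> \<lfloor>N\<rfloor>" using \<open>card ?T \<le> card {1, 2}\<close> E by (simp add: le_floor_iff)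
    show "\<forall>T\<in>?T. set_mdist (CV W) (\<phi> W p) (\<rho> T W) \<le> N"
      using top[OF pq(1)] \<open>E \<le> N\<close> E0 by (auto simp: pnest_iff simp del: CV_simps)
    show "\<forall>T. I.pnest T W \<longrightarrow> (\<exists>T'\<in>?T. nest T T') \<or> set_mdist (CV T) (\<phi> T p) (\<phi> T q) < E"
      by (auto simp: nest_def)
  qed simp
  show "mdiam (CV V) (\<Union>p\<in>\<gamma> ` {0..L}. \<rho>d W V p) \<le> ennreal E \<or>
      \<gamma> ` {0..L} \<inter> mneighbourhood (CV W) E (\<rho> V W) \<noteq> {}"
    if VW: "I.pnest V W" and \<gamma>: "geodesic_path (CV W) L \<gamma>" for V W L \<gamma>
  proof -
    have "0 \<in> {0..L}" "\<gamma> 0 \<in> mspace (CV W)" using \<gamma> by (auto simp: geodesic_path_def simp del: CV_simps)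
    moreover have "W = 0" using VW by (simp add: pnest_iff)
    ultimately have "\<gamma> 0 = pt 0 \<one>" "W = 0" using CV_0 by simp_all
    then have "\<gamma> 0 \<in> mneighbourhood (CV W) E (\<rho> V W)"
      using E0 pt_closed[OF one_closed, of 0] by (simp add: mneighbourhood_def \<rho>_def mdist_pt d0 del: CV_simps)
    with \<open>0 \<in> {0..L}\<close> show ?thesis by blast
  qed
  show "\<exists>x\<in>mspace X. \<forall>V\<in>\<V>. set_mdist (CV V) (\<phi> V x) {q V} \<le> E \<and>
      (\<forall>W. I.pnest V W \<or> I.transv V W \<longrightarrow> set_mdist (CV W) (\<phi> W x) (\<rho> V W) \<le> E)"
    if \<V>: "\<V> \<subseteq> domains" and q: "\<forall>V\<in>\<V>. q V \<in> (\<Union>x\<in>mspace X. \<phi> V x)" for \<V> q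
  proof -
    have "\<forall>V. \<exists>a\<in>carrier G. V \<in> \<V> \<longrightarrow> q V = pt V a"
      using q by (auto simp: \<phi>_def)
    then obtain a where a: "\<And>V. a V \<in> carrier G" "\<And>V. V \<in> \<V> \<Longrightarrow> q V = pt V (a V)" by metis
    \<comment> \<open>One point prescribing both factor coordinates serves every family at once; in
      the top domain all distances are 0.\<close>
    obtain x where x: "x \<in> carrier G" "d 1 x (a 1) \<le> c" "d 2 x (a 2) \<le> c" using realise a by blast
    have "set_mdist (CV V) (\<phi> V (vertex x)) {q V} \<le> E" if "V \<in> \<V>" for V
    proof -
      have "V = 0 \<or> V = 1 \<or> V = 2" using \<V> that by (auto simp: domains_def)
      then have "d V x (a V) \<le> E" using x E E0 by (auto simp: d0)
      then show ?thesis using a that x by (simp add: \<phi>_def mdist_pt del: CV_simps)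
    qed
    moreover have "set_mdist (CV W) (\<phi> W (vertex x)) (\<rho> V W) \<le> E" if "I.pnest V W \<or> I.transv V W" for V W
      using that not_transv top[of "vertex x"] x E0 by (auto simp: pnest_iff simp del: CV_simps)
    ultimately show ?thesis using x by (intro bexI[of _ "vertex x"]) auto
  qed
  show "\<exists>\<theta>. \<forall>p\<in>mspace X. \<forall>q\<in>mspace X. \<theta> \<le> mdist X p q \<longrightarrow>
      (\<exists>V\<in>domains. \<kappa> \<le> set_mdist (CV V) (\<phi> V p) (\<phi> V q))" for \<kappa>
  proof -
    let ?B = "{g \<in> carrier G. d 1 \<one> g \<le> \<kappa> \<and> d 2 \<one> g \<le> \<kappa>}"
    \<comment> \<open>After moving \<open>p\<close> to the identity by left invariance, small
      coordinates put \<open>q\<close> in a finite set, whose word lengths are at most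
      \<open>m\<close>.\<close>
    define m where "m = Max (insert 0 (wl ` ?B))"
    have m: "wl g \<le> m" if "g \<in> ?B" for g
      unfolding m_def by (rule Max_ge) (use that finite_balls in auto)
    have "\<exists>V\<in>domains. \<kappa> \<le> set_mdist (CV V) (\<phi> V p) (\<phi> V q)"
      if pq: "p \<in> mspace X" "q \<in> mspace X" and large: "real m + 1 \<le> mdist X p q" for p q
    proof -
      obtain x y where xy: "x \<in> carrier G" "p = vertex x" "y \<in> carrier G" "q = vertex y" using pq by auto
      have "m < wl (inv x \<otimes> y)" using large xy by (simp add: mdist_X wd_def)
      then have "inv x \<otimes> y \<notin> ?B" using m by (meson not_less)
      moreover have "d V \<one> (inv x \<otimes> y) = d V x y" for V using C.invariant[of "inv x" x y V] xy by simp
      ultimately have "\<kappa> < d 1 x y \<or> \<kappa> < d 2 x y" using xy by auto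
      then show ?thesis using xy by (auto simp: \<phi>_def mdist_pt domains_def simp del: CV_simps)
    qed
    then show ?thesis by blast
  qed
qed

theorem hierarchically_hyperbolic_group: "hierarchically_hyperbolic_group G"
proof -
  obtain l where l: "\<And>V x y. \<lbrakk>V \<in> domains; x \<in> carrier G; y \<in> carrier G\<rbrakk> \<Longrightarrow> d V x y \<le> l * real (wd x y)"
    using ex_Lipschitz by blast
  define E where "E = max 3 (max \<delta> (max c (max (2 * \<delta> + c + 2) l)))"
  have Lip: "d V x y \<le> E * real (wd x y)" if "V \<in> domains" "x \<in> carrier G" "y \<in> carrier G" for V x y
    using l[OF that] by (rule order_trans) (auto simp: E_def intro: mult_right_mono)
  interpret H: hhs "domains" nest orth E X CV \<phi> \<rho> \<rho>d
    by (rule hhs[OF _ _ _ _ Lip]) (auto simp: E_def)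
  define iact where "iact g = (\<lambda>V\<in>domains. V)" for g :: 'g
  have iact [simp]: "V \<in> domains \<Longrightarrow> iact g V = V" for g V by (simp add: iact_def)
  have X_act: "group_action G (mspace X) act"
    by (rule group_actionI) (auto simp: act_def m_assoc is_group)
  have ind_act: "group_action G domains iact"
    by (rule group_actionI) (auto simp: iact_def is_group)
  \<comment> \<open>\<open>G\<close> fixes every domain, and the isometries of all three hulls are
    given by the same translation of functions.\<close>
  interpret hhg_structure G "domains" nest orth E X CV \<phi> \<rho> \<rho>d act iact "\<lambda>g V. translate G g"
  proof (intro hhg_structure.intro H.hhs_axioms X_act ind_act hhg_structure_axioms.intro)
    show "isometry X X (act g)" if g: "g \<in> carrier G" for g
    proof -
      interpret X_act: group_action G "mspace X" act by (rule X_act)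
      have "bij_betw (act g) (mspace X) (mspace X)"
        using X_act.inj_prop[OF g] X_act.surj_prop[OF g] by (simp add: bij_betw_def)
      then show ?thesis using g by (auto simp: isometry_def act_vertex mdist_X wd_left_mult)
    qed
    show "finite {g \<in> carrier G. act g ` A \<inter> A \<noteq> {}}" if A: "mbounded_of X A" for A
    proof (rule finite_subset)
      \<comment> \<open>The action is simply transitive, so \<open>g\<close> is recovered from one
        point of \<open>A\<close> and its image.\<close>
      show "finite ((\<lambda>(a, b). b \<otimes> inv a) ` (elt ` A \<times> elt ` A))"
        using finite_elt_image[OF A] by simp
      have "A \<subseteq> mspace X" by (rule Metric_space.mbounded_subset_mspace[OF Metric_space_mspace_mdist A])
      show "{g \<in> carrier G. act g ` A \<inter> A \<noteq> {}} \<subseteq> (\<lambda>(a, b). b \<otimes> inv a) ` (elt ` A \<times> elt ` A)"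
      proof
        fix g assume "g \<in> {g \<in> carrier G. act g ` A \<inter> A \<noteq> {}}"
        then obtain p where p: "g \<in> carrier G" "p \<in> A" "act g p \<in> A" by blast
        then obtain x where x: "x \<in> carrier G" "p = vertex x" using \<open>A \<subseteq> mspace X\<close> by auto
        have "g = (g \<otimes> x) \<otimes> inv x" using p x by (simp add: m_assoc)
        moreover have "x \<in> elt ` A" "g \<otimes> x \<in> elt ` A"
          using p x act_vertex[of x g] by (metis elt_vertex imageI)+
        ultimately show "g \<in> (\<lambda>(a, b). b \<otimes> inv a) ` (elt ` A \<times> elt ` A)"
          by (intro image_eqI[of _ _ "(x, g \<otimes> x)"]) auto
      qed
    qed
    show "\<exists>B. mbounded_of X B \<and> (\<Union>g\<in>carrier G. act g ` B) = mspace X"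
    proof (intro exI[of _ "{vertex \<one>}"] conjI)
      show "mbounded_of X {vertex \<one>}"
        using Metric_space.mbounded_insert[OF Metric_space_mspace_mdist, of X] Metric_space.mbounded_empty[OF Metric_space_mspace_mdist, of X]
        by auto
      show "(\<Union>g\<in>carrier G. act g ` {vertex \<one>}) = mspace X" by (auto simp: act_vertex)
    qed
    show "nest (iact g V) (iact g W) \<longleftrightarrow> nest V W" "orth (iact g V) (iact g W) \<longleftrightarrow> orth V W"
      "I.transv (iact g V) (iact g W) \<longleftrightarrow> I.transv V W"
      if "V \<in> domains" "W \<in> domains" for g V W
      using that by simp_all
    show "finite (orbits G domains iact)" by (simp add: orbits_def setcompr_eq_image domains_def)
    show "isometry (CV V) (CV (iact g V)) (translate G g)" if "g \<in> carrier G" "V \<in> domains" for g V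
      using C.isometry_translate[OF that(1), of V] that(2) unfolding CV_def by simp
    show "translate G (g \<otimes> h) p = translate G g (translate G h p)" if "g \<in> carrier G" "h \<in> carrier G" for g h p
      using that by (rule translate_mult)
    have pt: "translate G g (pt V x) = pt V (g \<otimes> x)" if "g \<in> carrier G" "x \<in> carrier G" for g x V
      unfolding pt_def by (rule C.translate_kuratowski[OF that])
    show "translate G g ` \<phi> V p = \<phi> (iact g V) (act g p)"
      if "g \<in> carrier G" "V \<in> domains" "p \<in> mspace X" for g V p
      using that by (auto simp: \<phi>_def pt act_vertex)
    show "translate G g ` \<rho> V U = \<rho> (iact g V) (iact g U)"
      if g: "g \<in> carrier G" and VU: "I.transv V U \<or> I.pnest V U" for g V U
    proof -
      have "U = 0" using VU not_transv by (auto simp: pnest_iff)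
      moreover have "pt 0 g = pt 0 \<one>" by (rule CV_0) (use g pt_closed in blast)
      ultimately show ?thesis using g pt[OF g one_closed] by (simp add: \<rho>_def domains_def)
    qed
  qed
  have "finitely_generated_group G"
    using gens is_group by (auto simp: finitely_generated_group_def)
  then show ?thesis
    using hhg_structure_axioms unfolding hierarchically_hyperbolic_group_def by blast
qed

end

text \<open>Each side of the four-point inequality is a sum of two distances and moves by at most
  \<open>2 * k\<close>; the total \<open>4 * k\<close> is halved because the inequality contains
  \<open>2 * \<delta>\<close>.\<close>

lemma hyperbolic_on_perturb:
  assumes e: "hyperbolic_on \<delta> M e"
    and d: "\<And>x y. \<lbrakk>x \<in> M; y \<in> M\<rbrakk> \<Longrightarrow> \<bar>d x y - e x y\<bar> \<le> k"
  shows "hyperbolic_on (\<delta> + 2 * k) M d"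
  unfolding hyperbolic_on_iff
proof (intro ballI)
  fix w x y z assume cl: "w \<in> M" "x \<in> M" "y \<in> M" "z \<in> M"
  have upper: "d x y \<le> e x y + k" and lower: "e x y \<le> d x y + k" if "x \<in> M" "y \<in> M" for x y
    using d[OF that] by linarith+
  have "e x z + e w y \<le> max (e x y + e w z) (e y z + e w x) + 2 * \<delta>"
    using e cl unfolding hyperbolic_on_iff by blast
  then show "d x z + d w y \<le> max (d x y + d w z) (d y z + d w x) + 2 * (\<delta> + 2 * k)"
    using upper[OF cl(2,4)] upper[OF cl(1,3)] lower[OF cl(2,3)] lower[OF cl(1,4)] lower[OF cl(3,4)] lower[OF cl(1,2)]
    by (auto simp: max_def split: if_splits)
qed

lemma hyperbolic_on_line: "hyperbolic_on 0 M (\<lambda>x y. \<bar>r x - r y :: real\<bar>)"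
proof -
  have "\<bar>a - b\<bar> + \<bar>c - e\<bar> \<le> \<bar>a - e\<bar> + \<bar>c - b\<bar> \<or> \<bar>a - b\<bar> + \<bar>c - e\<bar> \<le> \<bar>e - b\<bar> + \<bar>c - a\<bar>"
    for a b c e :: real
    by arith
  then show ?thesis by (simp add: hyperbolic_on_iff le_max_iff_disj)
qed

section \<open>Central extensions as hierarchically hyperbolic groups\<close>

context hyperbolic_central_extension
begin

section \<open>The two coordinates of the extension as pseudometrics\<close>

definition dF :: "'g \<Rightarrow> 'g \<Rightarrow> real" where "dF x y = real (F.wd (\<pi> x) (\<pi> y))"

lemma hyperbolic_pseudometric_dF: "hyperbolic_pseudometric G dF \<delta> 1"
proof
  show "dF x w \<le> dF x y + dF y w" if "x \<in> carrier G" "y \<in> carrier G" "w \<in> carrier G" for x y w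
    using F.d_triangle[of "\<pi> x" "\<pi> y" "\<pi> w"] that by (simp add: dF_def)
  show "hyperbolic_on \<delta> (carrier G) dF"
    using hyperbolic' by (simp add: hyperbolic_on_iff dF_def)
  show "\<exists>p\<in>carrier G. dF x p \<le> r + 1 \<and> dF p y \<le> dF x y - r + 1"
    if xy: "x \<in> carrier G" "y \<in> carrier G" and r: "0 \<le> r" "r \<le> dF x y" for x y r
  proof -
    have le: "nat \<lfloor>r\<rfloor> \<le> F.wd (\<pi> x) (\<pi> y)" using r unfolding dF_def by linarith
    obtain p where p: "p \<in> carrier F" "F.wd (\<pi> x) p = nat \<lfloor>r\<rfloor>" "F.wd p (\<pi> y) = F.wd (\<pi> x) (\<pi> y) - nat \<lfloor>r\<rfloor>"
      using F.d_between[OF _ _ le] xy by auto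
    have "real (F.wd p (\<pi> y)) = dF x y - real (nat \<lfloor>r\<rfloor>)" using p le by (simp add: dF_def)
    then show ?thesis using p r lift[OF p(1)]
      by (intro bexI[of _ "lift p"]) (auto simp: dF_def, linarith+)
  qed
qed (auto simp: dF_def F.d_self F.d_commute F.wd_left_mult)

text \<open>Adding \<open>D\<close> off the diagonal absorbs the defect of the quasimorphism in the
  triangle inequality. Symmetry is exact because \<open>Q\<close> changes sign under
  inversion.\<close>

definition dQ :: "int \<Rightarrow> 'g \<Rightarrow> 'g \<Rightarrow> real" where
  "dQ D x y = (if x = y then 0 else \<bar>of_int (Q (inv\<^bsub>G\<^esub> x \<otimes>\<^bsub>G\<^esub> y))\<bar> + of_int D)"

lemma Q_one: "Q \<one>\<^bsub>G\<^esub> = 0"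
  by (simp add: Q_def)

lemma Q_zp_diff:
  assumes "x \<in> carrier G" "y \<in> carrier G"
  shows "Q (inv\<^bsub>G\<^esub> (x \<otimes>\<^bsub>G\<^esub> zp k) \<otimes>\<^bsub>G\<^esub> y) = Q (inv\<^bsub>G\<^esub> x \<otimes>\<^bsub>G\<^esub> y) - 2 * k"
proof -
  have "inv\<^bsub>G\<^esub> (x \<otimes>\<^bsub>G\<^esub> zp k) \<otimes>\<^bsub>G\<^esub> y = zp (- k) \<otimes>\<^bsub>G\<^esub> (inv\<^bsub>G\<^esub> x \<otimes>\<^bsub>G\<^esub> y)"
    using assms by (simp add: G.inv_mult_group zp_minus G.m_assoc)
  also have "\<dots> = (inv\<^bsub>G\<^esub> x \<otimes>\<^bsub>G\<^esub> y) \<otimes>\<^bsub>G\<^esub> zp (- k)"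
    using assms by (intro zp_central) simp
  finally show ?thesis using Q_zp[of "inv\<^bsub>G\<^esub> x \<otimes>\<^bsub>G\<^esub> y" "- k"] assms by simp
qed

text \<open>Up to \<open>2 * D\<close> this is the distance on the real line pulled back by
  \<open>Q\<close>, and the line is 0-hyperbolic, hence \<open>4 * D\<close>. Intermediate points
  are found by moving along powers of \<open>z\<close>.\<close>

lemma hyperbolic_pseudometric_dQ:
  assumes D: "0 \<le> D" "\<And>g h. \<lbrakk>g \<in> carrier G; h \<in> carrier G\<rbrakk> \<Longrightarrow> \<bar>Q (g \<otimes>\<^bsub>G\<^esub> h) - Q g - Q h\<bar> \<le> D"
  shows "hyperbolic_pseudometric G (dQ D) (4 * of_int D) (of_int D + 2)"
proof
  have cancel: "(inv\<^bsub>G\<^esub> x \<otimes>\<^bsub>G\<^esub> y) \<otimes>\<^bsub>G\<^esub> (inv\<^bsub>G\<^esub> y \<otimes>\<^bsub>G\<^esub> w) = inv\<^bsub>G\<^esub> x \<otimes>\<^bsub>G\<^esub> w"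
    if "x \<in> carrier G" "y \<in> carrier G" "w \<in> carrier G" for x y w
  proof -
    have "y \<otimes>\<^bsub>G\<^esub> (inv\<^bsub>G\<^esub> y \<otimes>\<^bsub>G\<^esub> w) = w" using that by (simp add: G.m_assoc[symmetric])
    then show ?thesis using that by (simp add: G.m_assoc)
  qed
  show "carrier G \<noteq> {}" by blast
  show "dQ D x x = 0" for x by (simp add: dQ_def)
  show "dQ D x y = dQ D y x" if "x \<in> carrier G" "y \<in> carrier G" for x y
    using Q_inv[of "inv\<^bsub>G\<^esub> x \<otimes>\<^bsub>G\<^esub> y"] that by (auto simp: dQ_def G.inv_mult_group)
  show "dQ D x w \<le> dQ D x y + dQ D y w" if "x \<in> carrier G" "y \<in> carrier G" "w \<in> carrier G" for x y w
  proof -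
    have "\<bar>Q (inv\<^bsub>G\<^esub> x \<otimes>\<^bsub>G\<^esub> w)\<bar> \<le> \<bar>Q (inv\<^bsub>G\<^esub> x \<otimes>\<^bsub>G\<^esub> y)\<bar> + \<bar>Q (inv\<^bsub>G\<^esub> y \<otimes>\<^bsub>G\<^esub> w)\<bar> + D"
      using D(2)[of "inv\<^bsub>G\<^esub> x \<otimes>\<^bsub>G\<^esub> y" "inv\<^bsub>G\<^esub> y \<otimes>\<^bsub>G\<^esub> w"] cancel[OF that] that by auto
    then have "real_of_int \<bar>Q (inv\<^bsub>G\<^esub> x \<otimes>\<^bsub>G\<^esub> w)\<bar> \<le> of_int (\<bar>Q (inv\<^bsub>G\<^esub> x \<otimes>\<^bsub>G\<^esub> y)\<bar> + \<bar>Q (inv\<^bsub>G\<^esub> y \<otimes>\<^bsub>G\<^esub> w)\<bar> + D)"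
      by (simp only: of_int_le_iff)
    then show ?thesis using D(1) by (auto simp: dQ_def)
  qed
  show "dQ D (g \<otimes>\<^bsub>G\<^esub> x) (g \<otimes>\<^bsub>G\<^esub> y) = dQ D x y"
    if "g \<in> carrier G" "x \<in> carrier G" "y \<in> carrier G" for g x y
  proof -
    have "inv\<^bsub>G\<^esub> (g \<otimes>\<^bsub>G\<^esub> x) \<otimes>\<^bsub>G\<^esub> (g \<otimes>\<^bsub>G\<^esub> y) = inv\<^bsub>G\<^esub> x \<otimes>\<^bsub>G\<^esub> (inv\<^bsub>G\<^esub> g \<otimes>\<^bsub>G\<^esub> g \<otimes>\<^bsub>G\<^esub> y)"
      using that by (simp only: G.inv_mult_group G.m_assoc G.m_closed G.inv_closed)
    then show ?thesis using that by (simp add: dQ_def)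
  qed
  show "hyperbolic_on (4 * of_int D) (carrier G) (dQ D)"
  proof -
    let ?r = "\<lambda>x. real_of_int (Q x)"
    have near: "\<bar>dQ D x y - \<bar>?r x - ?r y\<bar>\<bar> \<le> 2 * of_int D" if "x \<in> carrier G" "y \<in> carrier G" for x y
    proof -
      have "\<bar>Q (inv\<^bsub>G\<^esub> x \<otimes>\<^bsub>G\<^esub> y) + Q x - Q y\<bar> \<le> D"
        using D(2)[of "inv\<^bsub>G\<^esub> x" y] that by (simp add: Q_inv)
      then have "\<bar>?r (inv\<^bsub>G\<^esub> x \<otimes>\<^bsub>G\<^esub> y) + ?r x - ?r y\<bar> \<le> of_int D"
        by (metis of_int_abs of_int_add of_int_diff of_int_le_iff)
      then show ?thesis using D(1) by (auto simp: dQ_def)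
    qed
    show ?thesis using hyperbolic_on_perturb[OF hyperbolic_on_line near] by simp
  qed
  show "\<exists>p\<in>carrier G. dQ D x p \<le> r + (of_int D + 2) \<and> dQ D p y \<le> dQ D x y - r + (of_int D + 2)"
    if xy: "x \<in> carrier G" "y \<in> carrier G" and r: "0 \<le> r" "r \<le> dQ D x y" for x y r
  proof (cases "x = y")
    case True
    then show ?thesis using xy r D(1) by (intro bexI[of _ x]) (auto simp: dQ_def)
  next
    case False
    define m where "m = Q (inv\<^bsub>G\<^esub> x \<otimes>\<^bsub>G\<^esub> y)"
    \<comment> \<open>A power of \<open>z\<close> shifts \<open>Q\<close> by an even number, so
      \<open>r\<close> is halved and rounded. As \<open>dQ D x y\<close> exceeds
      \<open>\<bar>m\<bar>\<close> by \<open>D\<close>, \<open>r\<close> may be larger than the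
      whole displacement, hence the minimum; the error \<open>D + 2\<close> pays for both
      effects.\<close>
    define j where "j = \<lfloor>min r (of_int \<bar>m\<bar>) / 2\<rfloor>"
    define k where "k = (if 0 \<le> m then j else - j)"
    have j: "0 \<le> j" "2 * real_of_int j \<le> r" "2 * real_of_int j \<le> \<bar>of_int m\<bar>" "min r (of_int \<bar>m\<bar>) < 2 * of_int j + 2"
      unfolding j_def using r by linarith+
    have dxy: "dQ D x y = \<bar>of_int m\<bar> + of_int D" using False by (simp add: dQ_def m_def)
    have p: "x \<otimes>\<^bsub>G\<^esub> zp k \<in> carrier G" using xy by simp
    have "inv\<^bsub>G\<^esub> x \<otimes>\<^bsub>G\<^esub> (x \<otimes>\<^bsub>G\<^esub> zp k) = zp k" using xy by (simp add: G.m_assoc[symmetric])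
    moreover have "Q (zp k) = 2 * k" using Q_zp[of "\<one>\<^bsub>G\<^esub>" k] by (simp add: Q_one)
    ultimately have "dQ D x (x \<otimes>\<^bsub>G\<^esub> zp k) \<le> 2 * \<bar>of_int k\<bar> + of_int D"
      using D(1) by (simp add: dQ_def abs_mult)
    moreover have "dQ D (x \<otimes>\<^bsub>G\<^esub> zp k) y \<le> \<bar>of_int m - 2 * of_int k\<bar> + of_int D"
      using D(1) Q_zp_diff[OF xy, of k] by (simp add: dQ_def m_def)
    moreover have "\<bar>real_of_int k\<bar> = of_int j" "\<bar>real_of_int m - 2 * of_int k\<bar> = \<bar>of_int m\<bar> - 2 * of_int j"
      using j by (auto simp: k_def)
    ultimately have "dQ D x (x \<otimes>\<^bsub>G\<^esub> zp k) \<le> r + (of_int D + 2)"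
      "dQ D (x \<otimes>\<^bsub>G\<^esub> zp k) y \<le> dQ D x y - r + (of_int D + 2)"
      using j r dxy D(1) by (auto simp: min_def split: if_splits)
    with p show ?thesis by blast
  qed
qed

lemma hyperbolic_pseudometric_zero: "hyperbolic_pseudometric G (\<lambda>x y. 0) 0 0"
  by unfold_locales (auto simp: hyperbolic_on_iff)

lemma hyperbolic_pseudometric_mono:
  assumes "hyperbolic_pseudometric G d a b" "a \<le> a'" "b \<le> b'"
  shows "hyperbolic_pseudometric G d a' b'"
proof -
  interpret hyperbolic_pseudometric G d a b by fact
  show ?thesis
  proof
    show "\<exists>p\<in>carrier G. d x p \<le> r + b' \<and> d p y \<le> d x y - r + b'"
      if "x \<in> carrier G" "y \<in> carrier G" "0 \<le> r" "r \<le> d x y" for x y r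
      using between[OF that] assms(3) by force
  qed (use invariant hyperbolic_on_mono[OF hyperbolic assms(2)] in auto)
qed

theorem hierarchically_hyperbolic: "hierarchically_hyperbolic_group G"
proof -
  obtain D where D: "0 \<le> D" "\<And>g h. \<lbrakk>g \<in> carrier G; h \<in> carrier G\<rbrakk> \<Longrightarrow> \<bar>Q (g \<otimes>\<^bsub>G\<^esub> h) - Q g - Q h\<bar> \<le> D"
    using Q_quasimorphism by blast
  \<comment> \<open>Hyperbolicity is required for every index, so those beyond 2 also get the zero
    pseudometric.\<close>
  define d where "d V = (if V = 1 then dF else if V = 2 then dQ D else (\<lambda>x y. 0))" for V :: nat
  define a where "a = max \<delta> (4 * of_int D)"
  have \<delta>: "0 \<le> \<delta>" using hyperbolic_on_nonneg[OF hyperbolic' F.one_closed] .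
  interpret product_structure G "insert z (lift ` F.letters)" d a "of_int D + 2"
  proof (intro product_structure.intro word_metric.intro word_metric_axioms.intro product_structure_axioms.intro)
    show "finite_generating_set G (insert z (lift ` F.letters))" by (rule finite_generating_set_extension)
    show "hyperbolic_pseudometric G (d V) a (of_int D + 2)" for V
    proof -
      have "hyperbolic_pseudometric G dF a (of_int D + 2)" "hyperbolic_pseudometric G (dQ D) a (of_int D + 2)"
        "hyperbolic_pseudometric G (\<lambda>x y. 0) a (of_int D + 2)"
        using hyperbolic_pseudometric_mono[OF hyperbolic_pseudometric_dF, of a "of_int D + 2"]
          hyperbolic_pseudometric_mono[OF hyperbolic_pseudometric_dQ[OF D], of a "of_int D + 2"]
          hyperbolic_pseudometric_mono[OF hyperbolic_pseudometric_zero, of a "of_int D + 2"] D(1) \<delta>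
        by (auto simp: a_def)
      then show ?thesis by (simp add: d_def)
    qed
    show "d 0 x y = 0" for x y by (simp add: d_def)
    show "finite {g \<in> carrier G. d 1 \<one>\<^bsub>G\<^esub> g \<le> k \<and> d 2 \<one>\<^bsub>G\<^esub> g \<le> k}" for k
    proof (rule finite_subset)
      show "finite {g \<in> carrier G. F.wl (\<pi> g) \<le> nat \<lceil>k\<rceil> \<and> \<bar>Q g\<bar> \<le> \<lceil>k\<rceil>}" by (rule finite_Q_ball)
      show "{g \<in> carrier G. d 1 \<one>\<^bsub>G\<^esub> g \<le> k \<and> d 2 \<one>\<^bsub>G\<^esub> g \<le> k} \<subseteq>
        {g \<in> carrier G. F.wl (\<pi> g) \<le> nat \<lceil>k\<rceil> \<and> \<bar>Q g\<bar> \<le> \<lceil>k\<rceil>}"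
      proof clarify
        fix g assume g: "g \<in> carrier G" "d 1 \<one>\<^bsub>G\<^esub> g \<le> k" "d 2 \<one>\<^bsub>G\<^esub> g \<le> k"
        have "real (F.wl (\<pi> g)) \<le> k" using g by (simp add: d_def dF_def F.wd_def)
        moreover have "\<bar>real_of_int (Q g)\<bar> \<le> k"
          using g D(1) by (auto simp: d_def dQ_def Q_one split: if_splits)
        ultimately show "F.wl (\<pi> g) \<le> nat \<lceil>k\<rceil> \<and> \<bar>Q g\<bar> \<le> \<lceil>k\<rceil>" by linarith
      qed
    qed
    show "\<exists>x\<in>carrier G. d 1 x a \<le> of_int D + 2 \<and> d 2 x b \<le> of_int D + 2"
      if ab: "a \<in> carrier G" "b \<in> carrier G" for a b
    proof -
      \<comment> \<open>Moving \<open>a\<close> by a power of \<open>z\<close> keeps its image in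
        \<open>F\<close> and shifts the \<open>Q\<close>-displacement to \<open>b\<close> by an even
        number; this choice leaves 0 or 1.\<close>
      define k where "k = Q (inv\<^bsub>G\<^esub> a \<otimes>\<^bsub>G\<^esub> b) div 2"
      let ?x = "a \<otimes>\<^bsub>G\<^esub> zp k"
      have "\<bar>Q (inv\<^bsub>G\<^esub> ?x \<otimes>\<^bsub>G\<^esub> b)\<bar> \<le> 1" using Q_zp_diff[OF ab, of k] by (simp add: k_def)
      then have "d 2 ?x b \<le> of_int D + 2" using D(1) by (auto simp: d_def dQ_def)
      moreover have "d 1 ?x a = 0" using ab by (simp add: d_def dF_def F.d_self)
      ultimately show ?thesis using ab D(1) by (intro bexI[of _ ?x]) auto
    qed
  qed (rule G.is_group)
  show ?thesis by (rule hierarchically_hyperbolic_group)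
qed

end

theorem corollary4p3:
  fixes Z :: "('z, 'k) monoid_scheme"
    and G :: "('g, 'm) monoid_scheme"
    and F :: "('f, 'n) monoid_scheme"
    and \<iota> :: "'z \<Rightarrow> 'g" and \<pi> :: "'g \<Rightarrow> 'f"
  assumes "central_extension Z \<iota> G \<pi> F"
    and "infinite_cyclic_group Z"
    and "hyperbolic_group F"
  shows "hierarchically_hyperbolic_group G"
proof -
  have ext: "group Z" "group G" "group F" "\<iota> \<in> hom Z G" "inj_on \<iota> (carrier Z)" "\<pi> \<in> hom G F"
    "\<pi> ` carrier G = carrier F" "\<iota> ` carrier Z = kernel G F \<pi>"
    and central: "\<And>x g. \<lbrakk>x \<in> carrier Z; g \<in> carrier G\<rbrakk> \<Longrightarrow> \<iota> x \<otimes>\<^bsub>G\<^esub> g = g \<otimes>\<^bsub>G\<^esub> \<iota> x"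
    using assms(1) by (auto simp: central_extension_def mon_def epi_def)
  interpret Z: group Z by fact
  interpret \<iota>: group_hom Z G \<iota> using ext by (simp add: group_hom_def group_hom_axioms_def)
  have "cyclic_group Z" "infinite (carrier Z)" using assms(2) by (auto simp: infinite_cyclic_group_def)
  then obtain t where t: "t \<in> carrier Z" "subgroup_generated Z {t} = Z"
    by (auto simp: cyclic_group_def)
  have range: "carrier Z = range (\<lambda>n::int. t [^]\<^bsub>Z\<^esub> n)"
    using Z.carrier_subgroup_generated_by_singleton[OF t(1)] t(2) by simp
  have inj: "\<And>i j::int. t [^]\<^bsub>Z\<^esub> i = t [^]\<^bsub>Z\<^esub> j \<Longrightarrow> i = j"
    using Z.infinite_cyclic_subgroup_int[OF t(1)] t(2) \<open>infinite (carrier Z)\<close> by simp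
  obtain S \<delta> where S: "finite_generating_set F S" "hyperbolic_on \<delta> (carrier F) (word_dist F S)"
    using assms(3) by (auto simp: hyperbolic_group_def)
  \<comment> \<open>The image of a generator of \<open>Z\<close> serves as \<open>z\<close>;
    injectivity of \<open>\<iota>\<close> keeps its powers distinct.\<close>
  interpret hyperbolic_central_extension F S G \<pi> "\<iota> t" \<delta>
  proof (intro hyperbolic_central_extension.intro word_metric.intro word_metric_axioms.intro
      group_hom.intro group_hom_axioms.intro hyperbolic_central_extension_axioms.intro)
    show "kernel G F \<pi> = range (\<lambda>n::int. \<iota> t [^]\<^bsub>G\<^esub> n)"
      unfolding ext(8)[symmetric] range using t by (auto simp: image_image \<iota>.hom_int_pow)
    show "inj (\<lambda>n::int. \<iota> t [^]\<^bsub>G\<^esub> n)"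
      using inj ext(5) t by (auto intro!: injI simp: \<iota>.hom_int_pow[symmetric] inj_on_eq_iff)
  qed (use ext t central S in auto)
  show ?thesis by (rule hierarchically_hyperbolic)
qed

end
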